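(* Let $\mathbf{A}\in\mathbb{K}^{m\times n}$, $\mathbf{b}\in\mathbb{K}^m$, $\mathbf{c}\in\mathbb{K}^n$ be such that $\boldsymbol{\mathcal{F}}^\circ\ne\emptyset$, let $0<\theta<1$, and let $t_0$ and $\delta(t)$ be as defined in the context. For all $t>t_0$ and $\mu>0$ we have $$d_\infty\bigl(\log_t\mathcal{N}^{-\infty}_{\theta,t}(\mu),\ \mathcal{C}^{\mathrm{trop}}(\log_t\mu)\bigr)\ \le\ \log_t\Bigl(\frac{N}{1-\theta}\Bigr)+\delta(t).$$
   Context: Field $\mathbb{K}$: absolutely convergent generalized real Puiseux series $f=\sum_{\alpha\in\mathbb{R}}a_\alpha t^\alpha$ with $a_\alpha\in\mathbb{R}$, whose support $\{\alpha:a_\alpha\ne0\}$ is finite or has $-\infty$ as only accumulation point, and which converge absolutely for all real $t>\rho$ for some $\rho>0$ (so $f(t)\in\mathbb{R}$ makes sense for $t$ large). $f>0$ iff its leading coefficient (at the largest exponent) is positive, equivalently $f(t)>0$ for all large $t$; this makes $\mathbb{K}$ a real closed ordered field; $\mathbb{K}_+$ is the set of nonnegative elements. $\mathrm{val}(f)$ is the largest exponent in the support, $\mathrm{val}(0)=-\infty$; $\mathrm{val}$ and evaluation at $t$ act entrywise on vectors and matrices, and $\mathrm{val}$ acts elementwise on sets. Primal-dual setting: $N=n+m$, $\boldsymbol{\mathcal{F}}=\{(x,w,s,y)\in\mathbb{K}_+^{2N}:\mathbf{A}x+w=\mathbf{b},\ s-\mathbf{A}^\top y=\mathbf{c}\}$,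 $\boldsymbol{\mathcal{F}}^\circ=\{z\in\boldsymbol{\mathcal{F}}:z>0\}\ne\emptyset$, $\mathcal{F}=\mathrm{val}(\boldsymbol{\mathcal{F}})\subset(\mathbb{R}\cup\{-\infty\})^{2N}$. The primal linear program over $\mathbb{K}$ is: minimize $\langle\mathbf{c},x\rangle$ subject to $\mathbf{A}x+w=\mathbf{b}$, $(x,w)\ge0$; the dual is: maximize $-\langle\mathbf{b},y\rangle$ subject to $s-\mathbf{A}^\top y=\mathbf{c}$, $(s,y)\ge0$. They have a common optimal value $\boldsymbol\nu\in\mathbb{K}$; fix optimal solutions $(\mathbf{x}^*,\mathbf{w}^* )$ and $(\mathbf{s}^*,\mathbf{y}^* )$. For $\boldsymbol\mu\in\mathbb{K}$, $\boldsymbol\mu>0$, $\boldsymbol{\mathcal{C}}(\boldsymbol\mu)=(x,w,s,y)$ is the unique point of $\boldsymbol{\mathcal{F}}^\circ$ with $x_js_j=\boldsymbol\mu$, $w_iy_i=\boldsymbol\mu$ for all $i,j$. The tropical central path is the map $\mathcal{C}^{\mathrm{trop}}:\mathbb{R}\to\mathbb{R}^{2N}$, $\mathcal{C}^{\mathrm{trop}}(\lambda)=\mathrm{val}(\boldsymbol{\mathcal{C}}(\boldsymbol\mu))$ for any $\boldsymbol\mu>0$ with $\mathrm{val}(\boldsymbol\mu)=\lambda$ (independent of the choice of $\boldsymbol\mu$; it is the coordinatewise maximum of $\{z=(x,w,s,y)\in\mathcal{F}:\max(\max_j(x_j+s_j),\max_i(w_i+y_i))\le\lambda\}$). Real linear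 programs: for real $t$ large, $\boldsymbol{\mathcal{F}}(t)=\{(x,w,s,y)\in\mathbb{R}_+^{2N}:\mathbf{A}(t)x+w=\mathbf{b}(t),\ s-\mathbf{A}(t)^\top y=\mathbf{c}(t)\}$ and $\boldsymbol{\mathcal{F}}^\circ(t)$ is its subset of points with all coordinates $>0$. $t_0$ is a positive real number such that for all $t>t_0$: $\boldsymbol{\mathcal{F}}^\circ(t)\neq\emptyset$; $\boldsymbol\nu(t)$ is the optimal value of the primal and dual real linear programs with data $\mathbf{A}(t),\mathbf{b}(t),\mathbf{c}(t)$; and $(\mathbf{x}^*(t),\mathbf{w}^*(t))$, $(\mathbf{s}^*(t),\mathbf{y}^*(t))$ are optimal solutions of them (such $t_0$ exists). The duality measure is $\bar\mu(z)=\frac1N(\langle x,s\rangle+\langle w,y\rangle)$ for $z=(x,w,s,y)$, and $\mathcal{N}^{-\infty}_{\theta,t}(\mu)=\{z=(x,w,s,y)\in\boldsymbol{\mathcal{F}}^\circ(t):\bar\mu(z)=\mu,\ x_js_j\ge(1-\theta)\mu,\ w_iy_i\ge(1-\theta)\mu\ \forall i,j\}$. Metrics: $\log_t(\cdot)=\log(\cdot)/\log t$, applied entrywise to vectors and elementwise to sets, $\log_t0=-\infty$. For $x,y\in(\mathbb{R}\cup\{-\infty\})^d$ let $\delta_F(x,y)=\inf\{\rho\ge0: x_k+\rho\ge y_k\ \forall k\}$ ($\inf\emptyset=+\infty$), $d_H(x,y)=\delta_F(x,y)+\delta_F(y,x)$, $d_\infty(x,y)=\max(\delta_F(x,y),\delta_F(y,x))$;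 for sets, $d(X,Y)=\sup_{x\in X}\inf_{y\in Y}d(x,y)$ for $d\in\{d_H,d_\infty\}$ (a point is viewed as a singleton). Put $\delta(t)=2\,d_H(\log_t\boldsymbol{\mathcal{F}}(t),\mathcal{F})$.
   Formalization: The formal theorem assumes t > 1 in addition to t > t_0: the base-t logarithm is undefined at t = 1, and for t_0 < t < 1 the bound can fail (A = 0, b = c = 1, where δ(t) = 0 and the right-hand side is negative). *)

theory Defs
  imports "HOL-Analysis.Analysis"
begin

section \<open>Absolutely convergent generalized real Puiseux series\<close>

definition puiseux_support :: "real set \<Rightarrow> bool" where
  "puiseux_support S \<longleftrightarrow> finite S \<or> (\<forall>p. p islimpt (ereal ` S) \<longleftrightarrow> p = -\<infinity>)"

definition is_puiseux :: "(real \<Rightarrow> real) \<Rightarrow> bool" where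
  "is_puiseux a \<longleftrightarrow> puiseux_support {\<alpha>. a \<alpha> \<noteq> 0} \<and>
     (\<exists>\<rho>>0. \<forall>t>\<rho>. (\<lambda>\<alpha>. norm (a \<alpha> * t powr \<alpha>)) summable_on UNIV)"

lemma puiseux_support_iff:
  "puiseux_support S \<longleftrightarrow> (\<forall>r. finite {\<alpha>\<in>S. r \<le> \<alpha>})" (is "_ \<longleftrightarrow> ?R")
proof
  assume L: "puiseux_support S"
  show ?R
  proof
    fix r
    show "finite {\<alpha>\<in>S. r \<le> \<alpha>}"
    proof (rule ccontr)
      assume inf: "infinite {\<alpha>\<in>S. r \<le> \<alpha>}"
      let ?T = "ereal ` {\<alpha>\<in>S. r \<le> \<alpha>}"
      have infT: "infinite ?T"
        using inf by (simp add: finite_image_iff inj_on_def)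
      have "compact {ereal r..}"
        by (simp add: compact_eq_closed)
      moreover have "?T \<subseteq> {ereal r..}" by auto
      ultimately obtain p where p: "p \<in> {ereal r..}" "p islimpt ?T"
        using Heine_Borel_imp_Bolzano_Weierstrass infT by blast
      have "p islimpt (ereal ` S)"
        by (rule islimpt_subset[OF p(2)]) auto
      moreover have "infinite S"
        using inf by (auto intro: finite_subset)
      ultimately have "p = -\<infinity>"
        using L by (auto simp: puiseux_support_def)
      with p(1) show False by simp
    qed
  qed
next
  assume R: ?R
  show "puiseux_support S"
  proof (cases "finite S")
    case False
    have "p = -\<infinity>" if p: "p islimpt (ereal ` S)" for p
    proof (rule ccontr)
      assume "p \<noteq> -\<infinity>"
      then have "-\<infinity> < p" by auto
      then obtain r where r: "ereal r < p"
        using ereal_dense2 by blast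
      have fin: "finite (ereal ` {\<alpha>\<in>S. r \<le> \<alpha>})" using R by blast
      have "infinite (ereal ` S \<inter> {ereal r<..})"
        using p r unfolding islimpt_eq_acc_point
        by (subst Int_commute) (erule allE[of _ "{ereal r<..}"], simp)
      moreover have "ereal ` S \<inter> {ereal r<..} \<subseteq> ereal ` {\<alpha>\<in>S. r \<le> \<alpha>}" by auto
      ultimately show False using fin finite_subset by blast
    qed
    moreover have "-\<infinity> islimpt (ereal ` S)"
      unfolding islimpt_def
    proof (intro allI impI)
      fix T :: "ereal set" assume T: "-\<infinity> \<in> T" "open T"
      then obtain r where r: "{..<ereal r} \<subseteq> T"
        using open_MInfty by auto
      have "S \<noteq> {\<alpha>\<in>S. r \<le> \<alpha>}" using R False by metis
      then obtain \<alpha> where "\<alpha> \<in> S" "\<alpha> < r" by force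
      then show "\<exists>y\<in>ereal ` S. y \<in> T \<and> y \<noteq> -\<infinity>"
        using r by (intro bexI[of _ "ereal \<alpha>"]) auto
    qed
    ultimately show ?thesis unfolding puiseux_support_def by blast
  qed (simp add: puiseux_support_def)
qed

lemma is_puiseux_iff:
  "is_puiseux a \<longleftrightarrow> (\<forall>r. finite {\<alpha>. a \<alpha> \<noteq> 0 \<and> r \<le> \<alpha>}) \<and>
     (\<forall>\<^sub>F t in at_top. (\<lambda>\<alpha>. norm (a \<alpha> * t powr \<alpha>)) summable_on UNIV)"
proof -
  have "(\<exists>\<rho>>0. \<forall>t>\<rho>. P t) \<longleftrightarrow> (\<forall>\<^sub>F t in at_top. P t)" for P :: "real \<Rightarrow> bool"
  proof
    assume "\<forall>\<^sub>F t in at_top. P t"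
    then obtain N where N: "\<And>t. t > N \<Longrightarrow> P t" by (auto simp: eventually_at_top_dense)
    show "\<exists>\<rho>>0. \<forall>t>\<rho>. P t" by (rule exI[of _ "max N 1"]) (use N in auto)
  qed (auto simp: eventually_at_top_dense)
  then show ?thesis
    by (simp add: is_puiseux_def puiseux_support_iff)
qed

lemma is_puiseuxI:
  "(\<And>r. finite {\<alpha>. a \<alpha> \<noteq> 0 \<and> r \<le> \<alpha>}) \<Longrightarrow>
    (\<forall>\<^sub>F t in at_top. (\<lambda>\<alpha>. norm (a \<alpha> * t powr \<alpha>)) summable_on UNIV) \<Longrightarrow> is_puiseux a"
  unfolding is_puiseux_iff by blast

lemma is_puiseuxD:
  assumes "is_puiseux a"
  shows "finite {\<alpha>. a \<alpha> \<noteq> 0 \<and> r \<le> \<alpha>}"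
    and "\<forall>r. finite {\<alpha>. a \<alpha> \<noteq> 0 \<and> r \<le> \<alpha>}"
    and "\<forall>\<^sub>F t in at_top. (\<lambda>\<alpha>. norm (a \<alpha> * t powr \<alpha>)) summable_on UNIV"
  using assms unfolding is_puiseux_iff by blast+

typedef puiseux = "{a. is_puiseux a}" morphisms coeff Abs_puiseux
  by (rule exI[of _ "\<lambda>_. 0"]) (simp add: is_puiseux_iff)

setup_lifting type_definition_puiseux

lemma puiseux_eqI: "(\<And>\<alpha>. coeff f \<alpha> = coeff g \<alpha>) \<Longrightarrow> f = g"
  by (simp add: coeff_inject[symmetric] fun_eq_iff)

lemma finite_support_above: "finite {\<alpha>. coeff f \<alpha> \<noteq> 0 \<and> r \<le> \<alpha>}"
  using coeff[of f] by (simp add: is_puiseux_iff)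

definition converges_at :: "puiseux \<Rightarrow> real \<Rightarrow> bool" where
  "converges_at f t \<longleftrightarrow> (\<lambda>\<alpha>. norm (coeff f \<alpha> * t powr \<alpha>)) summable_on UNIV"

text \<open>\<open>infsum\<close> is \<open>0\<close> by convention when the series does not converge.\<close>

definition eval_at :: "real \<Rightarrow> puiseux \<Rightarrow> real" where
  "eval_at t f = (\<Sum>\<^sub>\<infinity>\<alpha>. coeff f \<alpha> * t powr \<alpha>)"

lemma eventually_converges: "\<forall>\<^sub>F t in at_top. converges_at f t"
  using coeff[of f] by (simp add: is_puiseux_iff converges_at_def)

text \<open>The coefficient of the product at \<open>\<gamma>\<close> is a finite sum because supports are bounded above and
  finite above every level.\<close>

definition conv :: "(real \<Rightarrow> real) \<Rightarrow> (real \<Rightarrow> real) \<Rightarrow> real \<Rightarrow> real" where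
  "conv a b \<gamma> = (\<Sum>\<alpha> | a \<alpha> \<noteq> 0 \<and> b (\<gamma> - \<alpha>) \<noteq> 0. a \<alpha> * b (\<gamma> - \<alpha>))"

lemma bounded_support:
  fixes a :: "real \<Rightarrow> real"
  assumes "\<forall>r. finite {\<alpha>. a \<alpha> \<noteq> 0 \<and> r \<le> \<alpha>}"
  obtains M where "\<And>\<alpha>. a \<alpha> \<noteq> 0 \<Longrightarrow> \<alpha> \<le> M"
proof -
  have "bdd_above {\<alpha>. a \<alpha> \<noteq> 0 \<and> 0 \<le> \<alpha>}" using assms by (intro bdd_above_finite) blast
  then obtain M where "\<And>\<alpha>. a \<alpha> \<noteq> 0 \<Longrightarrow> 0 \<le> \<alpha> \<Longrightarrow> \<alpha> \<le> M" by (auto simp: bdd_above_def)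
  then have "\<And>\<alpha>. a \<alpha> \<noteq> 0 \<Longrightarrow> \<alpha> \<le> max M 0" by (metis max.coboundedI1 max.coboundedI2 linear)
  then show ?thesis using that by blast
qed

lemma conv_finite:
  fixes a b :: "real \<Rightarrow> real"
  assumes a: "\<forall>r. finite {\<alpha>. a \<alpha> \<noteq> 0 \<and> r \<le> \<alpha>}" and b: "\<forall>r. finite {\<alpha>. b \<alpha> \<noteq> 0 \<and> r \<le> \<alpha>}"
  shows "finite {\<alpha>. a \<alpha> \<noteq> 0 \<and> b (\<gamma> - \<alpha>) \<noteq> 0}"
proof -
  obtain M where M: "\<And>\<alpha>. b \<alpha> \<noteq> 0 \<Longrightarrow> \<alpha> \<le> M" using bounded_support[OF b] by blast
  have "{\<alpha>. a \<alpha> \<noteq> 0 \<and> b (\<gamma> - \<alpha>) \<noteq> 0} \<subseteq> {\<alpha>. a \<alpha> \<noteq> 0 \<and> \<gamma> - M \<le> \<alpha>}"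
    using M by (force simp: algebra_simps)
  then show ?thesis using a finite_subset by blast
qed

lemma conv_support_finite:
  fixes a b :: "real \<Rightarrow> real"
  assumes a: "\<forall>r. finite {\<alpha>. a \<alpha> \<noteq> 0 \<and> r \<le> \<alpha>}" and b: "\<forall>r. finite {\<alpha>. b \<alpha> \<noteq> 0 \<and> r \<le> \<alpha>}"
  shows "finite {\<gamma>. conv a b \<gamma> \<noteq> 0 \<and> r \<le> \<gamma>}"
proof -
  obtain M where M: "\<And>\<alpha>. a \<alpha> \<noteq> 0 \<Longrightarrow> \<alpha> \<le> M" using bounded_support[OF a] by blast
  obtain M' where M': "\<And>\<alpha>. b \<alpha> \<noteq> 0 \<Longrightarrow> \<alpha> \<le> M'" using bounded_support[OF b] by blast
  let ?P = "{\<alpha>. a \<alpha> \<noteq> 0 \<and> r - M' \<le> \<alpha>} \<times> {\<beta>. b \<beta> \<noteq> 0 \<and> r - M \<le> \<beta>}"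
  have "{\<gamma>. conv a b \<gamma> \<noteq> 0 \<and> r \<le> \<gamma>} \<subseteq> (\<lambda>(\<alpha>,\<beta>). \<alpha> + \<beta>) ` ?P"
  proof
    fix \<gamma> assume g: "\<gamma> \<in> {\<gamma>. conv a b \<gamma> \<noteq> 0 \<and> r \<le> \<gamma>}"
    then obtain \<alpha> where \<alpha>: "a \<alpha> \<noteq> 0" "b (\<gamma> - \<alpha>) \<noteq> 0"
      unfolding conv_def by (smt (verit) mem_Collect_eq sum.neutral mult_not_zero)
    from M[OF \<alpha>(1)] M'[OF \<alpha>(2)] g \<alpha> have "(\<alpha>, \<gamma> - \<alpha>) \<in> ?P" by auto
    then show "\<gamma> \<in> (\<lambda>(\<alpha>,\<beta>). \<alpha> + \<beta>) ` ?P" by (rule rev_image_eqI) simp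
  qed
  moreover have "finite ?P" using a b by blast
  ultimately show ?thesis by (meson finite_imageI finite_subset)
qed

lemma conv_infsum:
  fixes a b :: "real \<Rightarrow> real"
  assumes "\<forall>r. finite {\<alpha>. a \<alpha> \<noteq> 0 \<and> r \<le> \<alpha>}" "\<forall>r. finite {\<alpha>. b \<alpha> \<noteq> 0 \<and> r \<le> \<alpha>}" "t > 0"
  shows "((\<lambda>\<alpha>. (a \<alpha> * t powr \<alpha>) * (b (\<gamma> - \<alpha>) * t powr (\<gamma> - \<alpha>))) has_sum (conv a b \<gamma> * t powr \<gamma>)) UNIV"
proof -
  let ?S = "{\<alpha>. a \<alpha> \<noteq> 0 \<and> b (\<gamma> - \<alpha>) \<noteq> 0}"
  have *: "(a \<alpha> * t powr \<alpha>) * (b (\<gamma> - \<alpha>) * t powr (\<gamma> - \<alpha>)) = (a \<alpha> * b (\<gamma> - \<alpha>)) * t powr \<gamma>" for \<alpha>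
    using \<open>t > 0\<close> by (simp add: powr_diff)
  have "((\<lambda>\<alpha>. (a \<alpha> * b (\<gamma> - \<alpha>)) * t powr \<gamma>) has_sum (conv a b \<gamma> * t powr \<gamma>)) ?S"
    using conv_finite[OF assms(1,2)]
    by (intro has_sum_finiteI) (auto simp: conv_def sum_distrib_right)
  then show ?thesis
    unfolding * by (rule has_sum_cong_neutral[THEN iffD1, rotated -1]) auto
qed

lemma conv_summable:
  fixes a b :: "real \<Rightarrow> real"
  assumes fin: "\<forall>r. finite {\<alpha>. a \<alpha> \<noteq> 0 \<and> r \<le> \<alpha>}" "\<forall>r. finite {\<alpha>. b \<alpha> \<noteq> 0 \<and> r \<le> \<alpha>}" and "t > 0"
    and a: "(\<lambda>\<alpha>. norm (a \<alpha> * t powr \<alpha>)) summable_on UNIV"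
    and b: "(\<lambda>\<alpha>. norm (b \<alpha> * t powr \<alpha>)) summable_on UNIV"
  shows "(\<lambda>\<gamma>. norm (conv a b \<gamma> * t powr \<gamma>)) summable_on UNIV"
    and "(\<Sum>\<^sub>\<infinity>\<gamma>. conv a b \<gamma> * t powr \<gamma>) =
          (\<Sum>\<^sub>\<infinity>\<alpha>. a \<alpha> * t powr \<alpha>) * (\<Sum>\<^sub>\<infinity>\<alpha>. b \<alpha> * t powr \<alpha>)"
    and "(\<Sum>\<^sub>\<infinity>\<gamma>. \<bar>conv a b \<gamma>\<bar> * t powr \<gamma>) \<le>
          (\<Sum>\<^sub>\<infinity>\<alpha>. \<bar>a \<alpha>\<bar> * t powr \<alpha>) * (\<Sum>\<^sub>\<infinity>\<alpha>. \<bar>b \<alpha>\<bar> * t powr \<alpha>)"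
proof -
  have key: "(\<lambda>\<gamma>. norm (conv a b \<gamma> * t powr \<gamma>)) summable_on UNIV \<and>
       (\<Sum>\<^sub>\<infinity>\<gamma>. conv a b \<gamma> * t powr \<gamma>) =
          (\<Sum>\<^sub>\<infinity>\<alpha>. a \<alpha> * t powr \<alpha>) * (\<Sum>\<^sub>\<infinity>\<alpha>. b \<alpha> * t powr \<alpha>)"
    if fin: "\<forall>r. finite {\<alpha>. a \<alpha> \<noteq> 0 \<and> r \<le> \<alpha>}" "\<forall>r. finite {\<alpha>. b \<alpha> \<noteq> 0 \<and> r \<le> \<alpha>}"
    and a: "(\<lambda>\<alpha>. norm (a \<alpha> * t powr \<alpha>)) summable_on UNIV"
    and b: "(\<lambda>\<alpha>. norm (b \<alpha> * t powr \<alpha>)) summable_on UNIV" for a b :: "real \<Rightarrow> real"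
  proof -
    let ?f = "\<lambda>\<alpha>. a \<alpha> * t powr \<alpha>" and ?g = "\<lambda>\<alpha>. b \<alpha> * t powr \<alpha>"
    have "(\<lambda>(\<alpha>, \<beta>). norm (?f \<alpha>) * norm (?g \<beta>)) summable_on UNIV \<times> UNIV"
    proof (rule summable_on_SigmaI[where g = "\<lambda>\<alpha>. norm (?f \<alpha>) * (\<Sum>\<^sub>\<infinity>\<beta>. norm (?g \<beta>))"])
      show "((\<lambda>\<beta>. case (\<alpha>, \<beta>) of (\<alpha>, \<beta>) \<Rightarrow> norm (?f \<alpha>) * norm (?g \<beta>)) has_sum
          norm (?f \<alpha>) * (\<Sum>\<^sub>\<infinity>\<beta>. norm (?g \<beta>))) UNIV" for \<alpha>
        unfolding prod.case using b by (intro has_sum_cmult_right has_sum_infsum)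
      show "(\<lambda>\<alpha>. norm (?f \<alpha>) * (\<Sum>\<^sub>\<infinity>\<beta>. norm (?g \<beta>))) summable_on UNIV"
        using a by (intro summable_on_cmult_left)
    qed auto
    then have 1: "(\<lambda>p. norm (case p of (\<alpha>, \<beta>) \<Rightarrow> ?f \<alpha> * ?g \<beta>)) summable_on UNIV \<times> UNIV"
      by (simp add: case_prod_unfold norm_mult abs_mult)
    then have s: "(\<lambda>(\<alpha>, \<beta>). ?f \<alpha> * ?g \<beta>) summable_on UNIV \<times> UNIV"
      by (rule abs_summable_summable)
    have "(\<Sum>\<^sub>\<infinity>p\<in>UNIV \<times> UNIV. case p of (\<alpha>, \<beta>) \<Rightarrow> ?f \<alpha> * ?g \<beta>) = (\<Sum>\<^sub>\<infinity>\<alpha>. \<Sum>\<^sub>\<infinity>\<beta>. ?f \<alpha> * ?g \<beta>)"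
      using infsum_Sigma_banach[OF s] by simp
    also have "\<dots> = (\<Sum>\<^sub>\<infinity>\<alpha>. ?f \<alpha>) * (\<Sum>\<^sub>\<infinity>\<alpha>. ?g \<alpha>)"
      by (simp add: infsum_cmult_right' infsum_cmult_left')
    finally have val: "((\<lambda>(\<alpha>, \<beta>). ?f \<alpha> * ?g \<beta>) has_sum (\<Sum>\<^sub>\<infinity>\<alpha>. ?f \<alpha>) * (\<Sum>\<^sub>\<infinity>\<alpha>. ?g \<alpha>)) (UNIV \<times> UNIV)"
      using has_sum_infsum[OF s] by (simp only:)
    have hs: "((\<lambda>\<alpha>. ?f \<alpha> * ?g (\<gamma> - \<alpha>)) has_sum (conv a b \<gamma> * t powr \<gamma>)) UNIV" for \<gamma>
      using conv_infsum[OF fin \<open>t > 0\<close>] .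
    have bij: "bij_betw (\<lambda>(\<gamma>, \<alpha>). (\<alpha>, \<gamma> - \<alpha>)) (UNIV \<times> UNIV) (UNIV \<times> (UNIV :: real set))"
      by (rule bij_betwI[where g = "\<lambda>(\<alpha>, \<beta>). (\<alpha> + \<beta>, \<alpha>)"]) auto
    have 2: "(\<lambda>(\<gamma>, \<alpha>). norm (?f \<alpha> * ?g (\<gamma> - \<alpha>))) summable_on UNIV \<times> UNIV"
      using 1 summable_on_reindex_bij_betw[OF bij, of "\<lambda>p. norm (case p of (\<alpha>, \<beta>) \<Rightarrow> ?f \<alpha> * ?g \<beta>)"]
      by (simp add: case_prod_unfold)
    have val2: "((\<lambda>(\<gamma>, \<alpha>). ?f \<alpha> * ?g (\<gamma> - \<alpha>)) has_sum (\<Sum>\<^sub>\<infinity>\<alpha>. ?f \<alpha>) * (\<Sum>\<^sub>\<infinity>\<alpha>. ?g \<alpha>)) (UNIV \<times> UNIV)"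
      using val has_sum_reindex_bij_betw[OF bij, of "\<lambda>p. (case p of (\<alpha>, \<beta>) \<Rightarrow> ?f \<alpha> * ?g \<beta>)"]
      by (simp add: case_prod_unfold)
    have "((\<lambda>\<gamma>. conv a b \<gamma> * t powr \<gamma>) has_sum (\<Sum>\<^sub>\<infinity>\<alpha>. ?f \<alpha>) * (\<Sum>\<^sub>\<infinity>\<alpha>. ?g \<alpha>)) UNIV"
      by (rule has_sum_SigmaD[OF val2]) (use hs in auto)
    from infsumI[OF this] has_sum_imp_summable[OF this, THEN summable_on_iff_abs_summable_on_real[THEN iffD1]]
    show ?thesis by blast
  qed
  show "(\<lambda>\<gamma>. norm (conv a b \<gamma> * t powr \<gamma>)) summable_on UNIV"
    and "(\<Sum>\<^sub>\<infinity>\<gamma>. conv a b \<gamma> * t powr \<gamma>) =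
          (\<Sum>\<^sub>\<infinity>\<alpha>. a \<alpha> * t powr \<alpha>) * (\<Sum>\<^sub>\<infinity>\<alpha>. b \<alpha> * t powr \<alpha>)"
    using key[OF fin a b] by auto
  note k = key[of "\<lambda>x. \<bar>a x\<bar>" "\<lambda>x. \<bar>b x\<bar>"]
  have k1: "(\<lambda>\<gamma>. conv (\<lambda>x. \<bar>a x\<bar>) (\<lambda>x. \<bar>b x\<bar>) \<gamma> * t powr \<gamma>) summable_on UNIV"
    and k2: "(\<Sum>\<^sub>\<infinity>\<gamma>. conv (\<lambda>x. \<bar>a x\<bar>) (\<lambda>x. \<bar>b x\<bar>) \<gamma> * t powr \<gamma>) =
          (\<Sum>\<^sub>\<infinity>\<alpha>. \<bar>a \<alpha>\<bar> * t powr \<alpha>) * (\<Sum>\<^sub>\<infinity>\<alpha>. \<bar>b \<alpha>\<bar> * t powr \<alpha>)"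
    using abs_summable_summable[OF k[THEN conjunct1]] k[THEN conjunct2] fin a b
    by (simp_all add: abs_mult)
  have "\<bar>conv a b \<gamma>\<bar> \<le> conv (\<lambda>x. \<bar>a x\<bar>) (\<lambda>x. \<bar>b x\<bar>) \<gamma>" for \<gamma>
    unfolding conv_def by (rule order_trans[OF sum_abs]) (simp add: abs_mult)
  then have le: "\<bar>conv a b \<gamma>\<bar> * t powr \<gamma> \<le> conv (\<lambda>x. \<bar>a x\<bar>) (\<lambda>x. \<bar>b x\<bar>) \<gamma> * t powr \<gamma>" for \<gamma>
    by (simp add: mult_right_mono)
  show "(\<Sum>\<^sub>\<infinity>\<gamma>. \<bar>conv a b \<gamma>\<bar> * t powr \<gamma>) \<le>
          (\<Sum>\<^sub>\<infinity>\<alpha>. \<bar>a \<alpha>\<bar> * t powr \<alpha>) * (\<Sum>\<^sub>\<infinity>\<alpha>. \<bar>b \<alpha>\<bar> * t powr \<alpha>)"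
    unfolding k2[symmetric]
    using key[OF fin a b] k1 le by (intro infsum_mono) (auto simp: abs_mult)
qed

instantiation puiseux :: "{zero, one, plus, minus, uminus, times}"
begin

lift_definition zero_puiseux :: puiseux is "\<lambda>_. 0"
  by (simp add: is_puiseux_iff)

lift_definition one_puiseux :: puiseux is "\<lambda>\<alpha>. if \<alpha> = 0 then 1 else 0"
proof -
  have "(\<lambda>\<alpha>. \<bar>(if \<alpha> = 0 then 1 else 0) * t powr \<alpha>\<bar>) summable_on UNIV" for t :: real
    by (rule summable_on_cong_neutral[THEN iffD1, OF _ _ _ summable_on_finite[of "{0}"]]) auto
  moreover have "finite {\<alpha>. (if \<alpha> = (0::real) then 1 else 0 :: real) \<noteq> 0 \<and> r \<le> \<alpha>}" for r
    by (rule finite_subset[of _ "{0}"]) auto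
  ultimately show "is_puiseux (\<lambda>\<alpha>. if \<alpha> = 0 then 1 else 0)"
    by (simp only: is_puiseux_iff real_norm_def eventually_True simp_thms)
qed

lift_definition uminus_puiseux :: "puiseux \<Rightarrow> puiseux" is "\<lambda>a \<alpha>. - a \<alpha>"
  unfolding is_puiseux_iff by (simp only: neg_equal_0_iff_equal mult_minus_left norm_minus_cancel simp_thms)

lift_definition plus_puiseux :: "puiseux \<Rightarrow> puiseux \<Rightarrow> puiseux" is "\<lambda>a b \<alpha>. a \<alpha> + b \<alpha>"
proof (rule is_puiseuxI)
  fix a b :: "real \<Rightarrow> real" and r assume a: "is_puiseux a" and b: "is_puiseux b"
  have "{\<alpha>. a \<alpha> + b \<alpha> \<noteq> 0 \<and> r \<le> \<alpha>} \<subseteq>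
      {\<alpha>. a \<alpha> \<noteq> 0 \<and> r \<le> \<alpha>} \<union> {\<alpha>. b \<alpha> \<noteq> 0 \<and> r \<le> \<alpha>}" by auto
  then show "finite {\<alpha>. a \<alpha> + b \<alpha> \<noteq> 0 \<and> r \<le> \<alpha>}"
    using is_puiseuxD(1)[OF a] is_puiseuxD(1)[OF b] by (meson finite_Un finite_subset)
next
  fix a b :: "real \<Rightarrow> real" assume a: "is_puiseux a" and b: "is_puiseux b"
  show "\<forall>\<^sub>F t in at_top. (\<lambda>\<alpha>. norm ((a \<alpha> + b \<alpha>) * t powr \<alpha>)) summable_on UNIV"
    using is_puiseuxD(3)[OF a] is_puiseuxD(3)[OF b]
  proof eventually_elim
    case (elim t)
    show ?case
    proof (rule Infinite_Sum.abs_summable_on_comparison_test'[OF summable_on_add[OF elim]])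
      show "norm ((a \<alpha> + b \<alpha>) * t powr \<alpha>) \<le> norm (a \<alpha> * t powr \<alpha>) + norm (b \<alpha> * t powr \<alpha>)" for \<alpha>
        unfolding distrib_right by (rule norm_triangle_ineq)
    qed
  qed
qed

definition minus_puiseux :: "puiseux \<Rightarrow> puiseux \<Rightarrow> puiseux" where
  "minus_puiseux f g = f + - g"

lift_definition times_puiseux :: "puiseux \<Rightarrow> puiseux \<Rightarrow> puiseux" is conv
proof (rule is_puiseuxI)
  fix a b :: "real \<Rightarrow> real" and r assume a: "is_puiseux a" and b: "is_puiseux b"
  show "finite {\<gamma>. conv a b \<gamma> \<noteq> 0 \<and> r \<le> \<gamma>}"
    by (rule conv_support_finite[OF is_puiseuxD(2)[OF a] is_puiseuxD(2)[OF b]])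
next
  fix a b :: "real \<Rightarrow> real" assume a: "is_puiseux a" and b: "is_puiseux b"
  show "\<forall>\<^sub>F t in at_top. (\<lambda>\<alpha>. norm (conv a b \<alpha> * t powr \<alpha>)) summable_on UNIV"
    using is_puiseuxD(3)[OF a] is_puiseuxD(3)[OF b] eventually_gt_at_top[of 0]
  proof eventually_elim
    case (elim t)
    show ?case
      by (rule conv_summable(1)[OF is_puiseuxD(2)[OF a] is_puiseuxD(2)[OF b] elim(3,1,2)])
  qed
qed

instance ..

end

lemmas coeff_simps [simp] = zero_puiseux.rep_eq one_puiseux.rep_eq uminus_puiseux.rep_eq
  plus_puiseux.rep_eq
lemmas coeff_times = times_puiseux.rep_eq

lemma coeff_minus [simp]: "coeff (f - g) \<alpha> = coeff f \<alpha> - coeff g \<alpha>"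
  by (simp add: minus_puiseux_def)

instance puiseux :: ab_group_add
  by standard (auto intro!: puiseux_eqI)

lemma converges_at_summable:
  "converges_at f t \<Longrightarrow> (\<lambda>\<alpha>. coeff f \<alpha> * t powr \<alpha>) summable_on UNIV"
  unfolding converges_at_def by (rule abs_summable_summable)

lemma eval_at_zero [simp]: "eval_at t 0 = 0"
  by (simp add: eval_at_def)

lemma eval_at_one [simp]: "t > 0 \<Longrightarrow> eval_at t 1 = 1"
  unfolding eval_at_def
  by (rule infsumI, rule has_sum_cong_neutral[THEN iffD1, OF _ _ _ has_sum_finiteI[of "{0}"]]) auto

lemma eval_at_uminus [simp]: "eval_at t (- f) = - eval_at t f"
  by (simp add: eval_at_def infsum_uminus)

lemma eval_at_add:
  "converges_at f t \<Longrightarrow> converges_at g t \<Longrightarrow> eval_at t (f + g) = eval_at t f + eval_at t g"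
  using converges_at_summable[of f t] converges_at_summable[of g t]
  by (simp add: eval_at_def distrib_right infsum_add)

lemma
  assumes "converges_at f t" "converges_at g t" "t > 0"
  shows converges_at_times: "converges_at (f * g) t"
    and eval_at_times: "eval_at t (f * g) = eval_at t f * eval_at t g"
  using conv_summable(1,2)[of "coeff f" "coeff g" t] assms finite_support_above
  by (auto simp: converges_at_def eval_at_def coeff_times)

lemma eventually_eval_add: "\<forall>\<^sub>F t in at_top. eval_at t (f + g) = eval_at t f + eval_at t g"
  using eventually_converges[of f] eventually_converges[of g]
  by eventually_elim (rule eval_at_add)

lemma eventually_eval_times: "\<forall>\<^sub>F t in at_top. eval_at t (f * g) = eval_at t f * eval_at t g"
  using eventually_converges[of f] eventually_converges[of g] eventually_gt_at_top[of 0]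
  by eventually_elim (rule eval_at_times)

definition lead_exp :: "puiseux \<Rightarrow> real" where
  "lead_exp f = (GREATEST \<alpha>. coeff f \<alpha> \<noteq> 0)"

lemma lead_exp_exists:
  assumes "f \<noteq> 0"
  shows "\<exists>e. coeff f e \<noteq> 0 \<and> (\<forall>\<alpha>. coeff f \<alpha> \<noteq> 0 \<longrightarrow> \<alpha> \<le> e)"
proof -
  obtain r where r: "coeff f r \<noteq> 0" using assms puiseux_eqI[of f 0] by auto
  let ?S = "{\<alpha>. coeff f \<alpha> \<noteq> 0 \<and> r \<le> \<alpha>}"
  have fin: "finite ?S" by (rule finite_support_above)
  have "Max ?S \<in> ?S" using fin r by (intro Max_in) auto
  moreover have "\<alpha> \<le> Max ?S" if "coeff f \<alpha> \<noteq> 0" for \<alpha>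
  proof (cases "r \<le> \<alpha>")
    case True
    then show ?thesis using that fin by (intro Max_ge) auto
  next
    case False
    then show ?thesis using \<open>Max ?S \<in> ?S\<close> by auto
  qed
  ultimately show ?thesis by blast
qed

lemma lead_exp_eq:
  assumes "coeff f e \<noteq> 0" "\<And>\<alpha>. coeff f \<alpha> \<noteq> 0 \<Longrightarrow> \<alpha> \<le> e"
  shows "lead_exp f = e"
  unfolding lead_exp_def using assms by (intro Greatest_equality) auto

lemma
  assumes "f \<noteq> 0"
  shows coeff_lead_exp: "coeff f (lead_exp f) \<noteq> 0"
    and lead_exp_max: "coeff f \<alpha> \<noteq> 0 \<Longrightarrow> \<alpha> \<le> lead_exp f"
proof -
  obtain e where e: "coeff f e \<noteq> 0" "\<And>\<alpha>. coeff f \<alpha> \<noteq> 0 \<Longrightarrow> \<alpha> \<le> e"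
    using lead_exp_exists[OF assms] by blast
  then have "lead_exp f = e" by (rule lead_exp_eq)
  with e show "coeff f (lead_exp f) \<noteq> 0" "coeff f \<alpha> \<noteq> 0 \<Longrightarrow> \<alpha> \<le> lead_exp f" by auto
qed

lemma lead_exp_uminus [simp]: "lead_exp (- f) = lead_exp f"
  by (simp add: lead_exp_def)

definition is_pos :: "puiseux \<Rightarrow> bool" where
  "is_pos f \<longleftrightarrow> f \<noteq> 0 \<and> coeff f (lead_exp f) > 0"

lemma is_pos_trichotomy: "f = 0 \<or> is_pos f \<or> is_pos (- f)"
  using coeff_lead_exp[of f] by (auto simp: is_pos_def)

lemma lead_exp_gap:
  obtains e' where "e' < lead_exp f"
    "\<And>\<alpha>. coeff f \<alpha> \<noteq> 0 \<Longrightarrow> \<alpha> \<noteq> lead_exp f \<Longrightarrow> \<alpha> \<le> e'"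
proof (cases "f = 0")
  case True
  then show ?thesis using that[of "lead_exp f - 1"] by auto
next
  case False
  define e where "e = lead_exp f"
  let ?T = "insert (e - 1) ({\<alpha>. coeff f \<alpha> \<noteq> 0 \<and> e - 1 \<le> \<alpha>} - {e})"
  have fin: "finite ?T" using finite_support_above[of f "e - 1"] by blast
  show ?thesis
  proof (rule that[of "Max ?T"])
    have "x < e" if "x \<in> ?T" for x
      using that lead_exp_max[OF False, of x] by (force simp: e_def)
    then show "Max ?T < lead_exp f"
      using fin by (simp add: e_def[symmetric])
    fix \<alpha> assume \<alpha>: "coeff f \<alpha> \<noteq> 0" "\<alpha> \<noteq> lead_exp f"
    show "\<alpha> \<le> Max ?T"
    proof (cases "e - 1 \<le> \<alpha>")
      case True
      then show ?thesis using \<alpha> fin by (intro Max_ge) (auto simp: e_def)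
    next
      case False
      have "e - 1 \<le> Max ?T" using fin by (intro Max_ge) auto
      then show ?thesis using False by linarith
    qed
  qed
qed

lemma is_pos_eventually_pos:
  assumes "is_pos f"
  shows "\<forall>\<^sub>F t in at_top. eval_at t f > 0"
proof -
  define e where "e = lead_exp f"
  define c where "c = coeff f e"
  have c: "c > 0" using assms by (simp add: is_pos_def c_def e_def)
  obtain e' where e': "e' < e" "\<And>\<alpha>. coeff f \<alpha> \<noteq> 0 \<Longrightarrow> \<alpha> \<noteq> e \<Longrightarrow> \<alpha> \<le> e'"
    using lead_exp_gap[of f] unfolding e_def by blast
  obtain u where u: "u > 0" "converges_at f u"
    using eventually_conj[OF eventually_converges[of f] eventually_gt_at_top[of 0]]
    by (auto simp: eventually_at_top_linorder)
  define S where "S = (\<Sum>\<^sub>\<infinity>\<alpha>. \<bar>coeff f \<alpha> * u powr \<alpha>\<bar>)"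
  have "\<forall>\<^sub>F t in at_top. t powr (e - e') > S / u powr e' / c"
    using eventually_gt_at_top[of "max (S / u powr e' / c) 1 powr (1 / (e - e'))"]
  proof eventually_elim
    case (elim t)
    let ?m = "max (S / u powr e' / c) 1"
    have "?m = (?m powr (1 / (e - e'))) powr (e - e')"
      using e'(1) by (simp add: powr_powr)
    also have "\<dots> < t powr (e - e')"
      using elim e'(1) by (intro powr_less_mono2) auto
    finally show ?case by simp
  qed
  then show ?thesis
    using eventually_converges[of f] eventually_ge_at_top[of u]
  proof eventually_elim
    case (elim t)
    have t: "t > 0" using elim u by simp
    define g where "g \<alpha> = (if \<alpha> = e then 0 else coeff f \<alpha> * t powr \<alpha>)" for \<alpha>
    define h where "h \<alpha> = (if \<alpha> = e then c * t powr e else 0)" for \<alpha>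
    have fgh: "coeff f \<alpha> * t powr \<alpha> = h \<alpha> + g \<alpha>" for \<alpha>
      by (simp add: g_def h_def c_def)
    have h: "(h has_sum (c * t powr e)) UNIV"
      by (rule has_sum_cong_neutral[THEN iffD1, OF _ _ _ has_sum_finiteI[of "{e}" _ h]])
        (auto simp: h_def)
    have bnd: "norm (g \<alpha>) \<le> \<bar>coeff f \<alpha> * u powr \<alpha>\<bar> * (t / u) powr e'" for \<alpha>
    proof (cases "\<alpha> = e \<or> coeff f \<alpha> = 0")
      case False
      then have "\<alpha> \<le> e'" using e' by blast
      then have "(t / u) powr \<alpha> \<le> (t / u) powr e'" using elim u by (intro powr_mono) auto
      moreover have "t powr \<alpha> = u powr \<alpha> * (t / u) powr \<alpha>" using u t by (simp add: powr_divide)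
      ultimately have "t powr \<alpha> \<le> u powr \<alpha> * (t / u) powr e'" by (simp add: mult_left_mono)
      then have "\<bar>coeff f \<alpha>\<bar> * t powr \<alpha> \<le> \<bar>coeff f \<alpha>\<bar> * (u powr \<alpha> * (t / u) powr e')"
        by (rule mult_left_mono) simp
      then show ?thesis using False by (simp add: g_def abs_mult mult.assoc)
    qed (auto simp: g_def)
    have sm: "(\<lambda>\<alpha>. \<bar>coeff f \<alpha> * u powr \<alpha>\<bar> * (t / u) powr e') summable_on UNIV"
      using u(2) by (intro summable_on_cmult_left) (simp add: converges_at_def)
    have gn: "(\<lambda>\<alpha>. norm (g \<alpha>)) summable_on UNIV"
      by (rule Infinite_Sum.abs_summable_on_comparison_test'[OF sm bnd])
    then have g: "g summable_on UNIV" by (rule abs_summable_summable)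
    have "\<bar>infsum g UNIV\<bar> \<le> infsum (\<lambda>\<alpha>. norm (g \<alpha>)) UNIV"
      using norm_infsum_bound[OF gn] by simp
    also have "\<dots> \<le> (\<Sum>\<^sub>\<infinity>\<alpha>. \<bar>coeff f \<alpha> * u powr \<alpha>\<bar> * (t / u) powr e')"
      using gn sm bnd by (rule infsum_mono)
    also have "\<dots> = S * (t / u) powr e'"
      unfolding S_def by (rule infsum_cmult_left')
    also have "\<dots> = S / u powr e' * t powr e'"
      using t u by (simp add: powr_divide)
    also have "\<dots> < c * t powr (e - e') * t powr e'"
    proof (intro mult_strict_right_mono)
      show "S / u powr e' < c * t powr (e - e')"
        using mult_strict_left_mono[OF elim(1) c] c by simp
    qed (use t in simp)
    also have "\<dots> = c * t powr e" using t by (simp flip: powr_add)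
    finally have "\<bar>infsum g UNIV\<bar> < c * t powr e" .
    moreover have "eval_at t f = c * t powr e + infsum g UNIV"
      unfolding eval_at_def fgh using infsum_add[of h UNIV g] h g
      by (simp add: has_sum_imp_summable infsumI)
    ultimately show ?case by linarith
  qed
qed

lemma is_pos_iff: "is_pos f \<longleftrightarrow> (\<forall>\<^sub>F t in at_top. eval_at t f > 0)"
proof
  assume R: "\<forall>\<^sub>F t in at_top. eval_at t f > 0"
  have False if "f = 0 \<or> is_pos (- f)"
  proof -
    have "\<forall>\<^sub>F t in at_top. eval_at t f \<le> 0"
      using that
    proof
      assume "is_pos (- f)"
      then show ?thesis by (rule is_pos_eventually_pos[THEN eventually_mono]) simp
    qed simp
    with R have "\<forall>\<^sub>F t::real in at_top. False" by eventually_elim simp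
    then show False by simp
  qed
  then show "is_pos f" using is_pos_trichotomy by blast
qed (rule is_pos_eventually_pos)

lemma eq_zero_iff: "f = 0 \<longleftrightarrow> (\<forall>\<^sub>F t in at_top. eval_at t f = 0)"
proof
  assume R: "\<forall>\<^sub>F t in at_top. eval_at t f = 0"
  have False if "is_pos f \<or> is_pos (- f)"
  proof -
    have "\<forall>\<^sub>F t in at_top. eval_at t f \<noteq> 0"
      using that
    proof
      assume "is_pos f"
      then show ?thesis by (rule is_pos_eventually_pos[THEN eventually_mono]) simp
    next
      assume "is_pos (- f)"
      then show ?thesis by (rule is_pos_eventually_pos[THEN eventually_mono]) simp
    qed
    with R have "\<forall>\<^sub>F t::real in at_top. False" by eventually_elim simp
    then show False by simp
  qed
  then show "f = 0" using is_pos_trichotomy by blast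
qed simp

lemma eventually_eval_minus: "\<forall>\<^sub>F t in at_top. eval_at t (f - g) = eval_at t f - eval_at t g"
  using eventually_eval_add[of f "- g"] by simp

lemma eval_eqI:
  assumes "\<forall>\<^sub>F t in at_top. eval_at t f = eval_at t g"
  shows "f = g"
proof -
  have "\<forall>\<^sub>F t in at_top. eval_at t (f - g) = 0"
    using assms eventually_eval_minus[of f g] by eventually_elim simp
  then have "f - g = 0" by (simp add: eq_zero_iff)
  then show ?thesis by simp
qed

instance puiseux :: comm_ring_1
proof
  fix f g h :: puiseux
  show "f * g * h = f * (g * h)"
    by (rule eval_eqI)
      (use eventually_eval_times[of f g] eventually_eval_times[of "f * g" h]
      eventually_eval_times[of f "g * h"] eventually_eval_times[of g h] in \<open>(eventually_elim, simp)\<close>)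
  show "f * g = g * f"
    by (rule eval_eqI)
      (use eventually_eval_times[of f g] eventually_eval_times[of g f] in \<open>(eventually_elim, simp)\<close>)
  show "1 * f = f"
    by (rule eval_eqI)
      (use eventually_eval_times[of 1 f] eventually_gt_at_top[of 0] in \<open>(eventually_elim, simp)\<close>)
  show "(f + g) * h = f * h + g * h"
    by (rule eval_eqI)
      (use eventually_eval_times[of "f + g" h] eventually_eval_times[of f h]
      eventually_eval_times[of g h] eventually_eval_add[of f g]
      eventually_eval_add[of "f * h" "g * h"] in \<open>(eventually_elim, simp add: distrib_right)\<close>)
  show "(0::puiseux) \<noteq> 1"
    by (metis coeff_simps(1,2) zero_neq_one)
qed

instantiation puiseux :: linordered_idom
begin

definition less_puiseux :: "puiseux \<Rightarrow> puiseux \<Rightarrow> bool" where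
  "less_puiseux f g \<longleftrightarrow> is_pos (g - f)"

definition less_eq_puiseux :: "puiseux \<Rightarrow> puiseux \<Rightarrow> bool" where
  "less_eq_puiseux f g \<longleftrightarrow> f = g \<or> f < g"

definition abs_puiseux :: "puiseux \<Rightarrow> puiseux" where
  "abs_puiseux f = (if f < 0 then - f else f)"

definition sgn_puiseux :: "puiseux \<Rightarrow> puiseux" where
  "sgn_puiseux f = (if f = 0 then 0 else if 0 < f then 1 else - 1)"

lemma is_pos_add:
  assumes "is_pos f" "is_pos g"
  shows "is_pos (f + g)"
  using assms[unfolded is_pos_iff] eventually_eval_add[of f g]
  unfolding is_pos_iff by eventually_elim simp

lemma is_pos_mult:
  assumes "is_pos f" "is_pos g"
  shows "is_pos (f * g)"
  using assms[unfolded is_pos_iff] eventually_eval_times[of f g]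
  unfolding is_pos_iff by eventually_elim simp

lemma is_pos_asym: "is_pos f \<Longrightarrow> \<not> is_pos (- f)"
  by (simp add: is_pos_def)

instance
proof
  fix f g h :: puiseux
  have anti: "\<not> is_pos (f - g)" if "is_pos (g - f)" for f g
    using is_pos_asym[OF that] by (simp only: minus_diff_eq not_False_eq_True)
  have nz: "\<not> is_pos (f - f)" for f by (simp add: is_pos_def)
  show "f < g \<longleftrightarrow> f \<le> g \<and> \<not> g \<le> f"
    unfolding less_eq_puiseux_def less_puiseux_def using anti nz by blast
  show "f \<le> f" unfolding less_eq_puiseux_def by blast
  have tr: "is_pos (h - f)" if "is_pos (g - f)" "is_pos (h - g)"
    using is_pos_add[OF that(2,1)] by (simp only: diff_add_cancel add_diff_eq)
  show "f \<le> h" if "f \<le> g" "g \<le> h"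
    using that tr unfolding less_eq_puiseux_def less_puiseux_def by blast
  show "f = g" if "f \<le> g" "g \<le> f"
    using that anti unfolding less_eq_puiseux_def less_puiseux_def by blast
  show "f \<le> g \<or> g \<le> f"
    using is_pos_trichotomy[of "g - f"]
    unfolding less_eq_puiseux_def less_puiseux_def minus_diff_eq right_minus_eq by blast
  show "h + f \<le> h + g" if "f \<le> g"
    using that unfolding less_eq_puiseux_def less_puiseux_def add_diff_cancel_left by blast
  show "h * f < h * g" if "f < g" "0 < h"
    using is_pos_mult[of h "g - f"] that
    unfolding less_puiseux_def right_diff_distrib diff_zero by blast
  show "\<bar>f\<bar> = (if f < 0 then - f else f)" by (rule abs_puiseux_def)
  show "sgn f = (if f = 0 then 0 else if 0 < f then 1 else - 1)" by (rule sgn_puiseux_def)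
qed

end

lemma infsum_abs_le_times:
  assumes "converges_at f t" "converges_at g t" "t > 0"
  shows "(\<Sum>\<^sub>\<infinity>\<alpha>. \<bar>coeff (f * g) \<alpha>\<bar> * t powr \<alpha>) \<le>
    (\<Sum>\<^sub>\<infinity>\<alpha>. \<bar>coeff f \<alpha>\<bar> * t powr \<alpha>) * (\<Sum>\<^sub>\<infinity>\<alpha>. \<bar>coeff g \<alpha>\<bar> * t powr \<alpha>)"
  using conv_summable(3)[of "coeff f" "coeff g" t] assms finite_support_above
  by (simp add: converges_at_def coeff_times)

lemma converges_at_abs:
  "converges_at f t \<longleftrightarrow> (\<lambda>\<alpha>. \<bar>coeff f \<alpha>\<bar> * t powr \<alpha>) summable_on UNIV"
  by (simp add: converges_at_def abs_mult)

lemma has_sum_single: "((\<lambda>\<alpha>. if \<alpha> = e then c \<alpha> else 0) has_sum (c e :: real)) UNIV"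
  by (rule has_sum_cong_neutral[THEN iffD1, OF _ _ _ has_sum_finiteI[of "{e}" _ c]]) auto

lemma converges_at_one: "converges_at 1 t"
proof -
  have "(\<lambda>\<alpha>. \<bar>coeff 1 \<alpha>\<bar> * t powr \<alpha>) = (\<lambda>\<alpha>. if \<alpha> = 0 then t powr \<alpha> else 0)" by auto
  then show ?thesis
    unfolding converges_at_abs using has_sum_imp_summable[OF has_sum_single] by metis
qed

lemma converges_at_power: "converges_at f t \<Longrightarrow> t > 0 \<Longrightarrow> converges_at (f ^ n) t"
  by (induction n) (simp_all add: converges_at_one converges_at_times)

lemma eval_at_power: "converges_at f t \<Longrightarrow> t > 0 \<Longrightarrow> eval_at t (f ^ n) = eval_at t f ^ n"
  by (induction n) (simp_all add: eval_at_times converges_at_power)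

lemma infsum_abs_power_le:
  assumes "converges_at f t" "t > 0"
  shows "(\<Sum>\<^sub>\<infinity>\<alpha>. \<bar>coeff (f ^ n) \<alpha>\<bar> * t powr \<alpha>) \<le> (\<Sum>\<^sub>\<infinity>\<alpha>. \<bar>coeff f \<alpha>\<bar> * t powr \<alpha>) ^ n"
proof (induction n)
  case 0
  have "(\<lambda>\<alpha>. \<bar>coeff 1 \<alpha>\<bar> * t powr \<alpha>) = (\<lambda>\<alpha>. if \<alpha> = 0 then t powr \<alpha> else 0)" by auto
  then show ?case using infsumI[OF has_sum_single[of 0 "\<lambda>\<alpha>. t powr \<alpha>"]] assms(2) by simp
next
  case (Suc n)
  have "(\<Sum>\<^sub>\<infinity>\<alpha>. \<bar>coeff (f ^ Suc n) \<alpha>\<bar> * t powr \<alpha>) \<le>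
      (\<Sum>\<^sub>\<infinity>\<alpha>. \<bar>coeff f \<alpha>\<bar> * t powr \<alpha>) * (\<Sum>\<^sub>\<infinity>\<alpha>. \<bar>coeff (f ^ n) \<alpha>\<bar> * t powr \<alpha>)"
    using infsum_abs_le_times[OF assms(1) converges_at_power[OF assms] assms(2)] by simp
  also have "\<dots> \<le> (\<Sum>\<^sub>\<infinity>\<alpha>. \<bar>coeff f \<alpha>\<bar> * t powr \<alpha>) ^ Suc n"
    using Suc by (simp add: mult_left_mono infsum_nonneg)
  finally show ?case .
qed

lemma coeff_times_nonzero:
  assumes "coeff (f * g) \<gamma> \<noteq> 0"
  obtains \<alpha> where "coeff f \<alpha> \<noteq> 0" "coeff g (\<gamma> - \<alpha>) \<noteq> 0"
proof -
  have "{\<alpha>. coeff f \<alpha> \<noteq> 0 \<and> coeff g (\<gamma> - \<alpha>) \<noteq> 0} \<noteq> {}"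
    using assms unfolding coeff_times conv_def by (metis sum.empty)
  then show ?thesis using that by blast
qed

lemma coeff_power_bound:
  assumes "\<And>\<alpha>. coeff h \<alpha> \<noteq> 0 \<Longrightarrow> \<alpha> \<le> - \<epsilon>" "coeff (h ^ n) \<gamma> \<noteq> 0"
  shows "\<gamma> \<le> - (real n * \<epsilon>)"
  using assms(2)
proof (induction n arbitrary: \<gamma>)
  case 0
  then show ?case by (simp split: if_splits)
next
  case (Suc n)
  from Suc.prems have "coeff (h * h ^ n) \<gamma> \<noteq> 0" by simp
  then obtain \<alpha> where \<alpha>: "coeff h \<alpha> \<noteq> 0" "coeff (h ^ n) (\<gamma> - \<alpha>) \<noteq> 0"
    by (rule coeff_times_nonzero)
  from Suc.IH[OF \<alpha>(2)] assms(1)[OF \<alpha>(1)] show ?case by (simp add: algebra_simps)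
qed

lemma eventually_small:
  assumes "\<epsilon> > 0" "\<And>\<alpha>. coeff h \<alpha> \<noteq> 0 \<Longrightarrow> \<alpha> \<le> - \<epsilon>"
  shows "\<forall>\<^sub>F t in at_top. (\<Sum>\<^sub>\<infinity>\<alpha>. \<bar>coeff h \<alpha>\<bar> * t powr \<alpha>) < 1"
proof -
  have "is_puiseux (\<lambda>\<alpha>. \<bar>coeff h \<alpha>\<bar>)"
    using finite_support_above[of h] eventually_converges[of h]
    by (intro is_puiseuxI) (simp_all add: converges_at_def abs_mult)
  then have [simp]: "coeff (Abs_puiseux (\<lambda>\<alpha>. \<bar>coeff h \<alpha>\<bar>)) = (\<lambda>\<alpha>. \<bar>coeff h \<alpha>\<bar>)"
    by (simp add: Abs_puiseux_inverse)
  define k where "k = 1 - Abs_puiseux (\<lambda>\<alpha>. \<bar>coeff h \<alpha>\<bar>)"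
  have h0: "coeff h \<alpha> = 0" if "\<alpha> \<ge> 0" for \<alpha> using assms(1) assms(2)[of \<alpha>] that by force
  have k0: "coeff k 0 = 1" using h0 by (simp add: k_def)
  have "lead_exp k = 0"
  proof (rule lead_exp_eq)
    show "\<alpha> \<le> 0" if "coeff k \<alpha> \<noteq> 0" for \<alpha>
      using that h0[of \<alpha>] by (cases "\<alpha> \<le> 0") (auto simp: k_def)
  qed (simp add: k0)
  then have "is_pos k" using k0 unfolding is_pos_def by auto
  from is_pos_eventually_pos[OF this]
    eventually_eval_minus[of 1 "Abs_puiseux (\<lambda>\<alpha>. \<bar>coeff h \<alpha>\<bar>)"] eventually_gt_at_top[of 0]
  show ?thesis
  proof eventually_elim
    case (elim t)
    then show ?case by (simp add: k_def[symmetric]) (simp add: eval_at_def)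
  qed
qed

lemma geometric_inverse:
  assumes \<epsilon>: "\<epsilon> > 0" and h: "\<And>\<alpha>. coeff h \<alpha> \<noteq> 0 \<Longrightarrow> \<alpha> \<le> - \<epsilon>"
  obtains g where "(1 - h) * g = 1"
proof -
  define G where "G \<gamma> = (\<Sum>n | coeff (h ^ n) \<gamma> \<noteq> 0. coeff (h ^ n) \<gamma>)" for \<gamma>
  have index: "n \<le> nat \<lceil>- r / \<epsilon>\<rceil>" if "coeff (h ^ n) \<gamma> \<noteq> 0" "r \<le> \<gamma>" for n \<gamma> r
  proof -
    have "\<gamma> \<le> - (real n * \<epsilon>)" by (rule coeff_power_bound[OF _ that(1)]) (rule h)
    then have "real n * \<epsilon> \<le> - r" using that(2) by simp
    then have "real n \<le> - r / \<epsilon>" using \<epsilon> by (simp add: field_simps)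
    then show ?thesis by linarith
  qed
  have fin: "finite {n. coeff (h ^ n) \<gamma> \<noteq> 0}" for \<gamma>
    by (rule finite_subset[of _ "{..nat \<lceil>- \<gamma> / \<epsilon>\<rceil>}"]) (use index in auto)
  have suppG: "finite {\<gamma>. G \<gamma> \<noteq> 0 \<and> r \<le> \<gamma>}" for r
  proof (rule finite_subset)
    show "{\<gamma>. G \<gamma> \<noteq> 0 \<and> r \<le> \<gamma>} \<subseteq>
        (\<Union>n\<le>nat \<lceil>- r / \<epsilon>\<rceil>. {\<gamma>. coeff (h ^ n) \<gamma> \<noteq> 0 \<and> r \<le> \<gamma>})"
    proof
      fix \<gamma> assume \<gamma>: "\<gamma> \<in> {\<gamma>. G \<gamma> \<noteq> 0 \<and> r \<le> \<gamma>}"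
      then have "{n. coeff (h ^ n) \<gamma> \<noteq> 0} \<noteq> {}" unfolding G_def by (metis (mono_tags, lifting) mem_Collect_eq sum.empty)
      then obtain n where "coeff (h ^ n) \<gamma> \<noteq> 0" by blast
      then show "\<gamma> \<in> (\<Union>n\<le>nat \<lceil>- r / \<epsilon>\<rceil>. {\<gamma>. coeff (h ^ n) \<gamma> \<noteq> 0 \<and> r \<le> \<gamma>})"
        using index \<gamma> by blast
    qed
    show "finite (\<Union>n\<le>nat \<lceil>- r / \<epsilon>\<rceil>. {\<gamma>. coeff (h ^ n) \<gamma> \<noteq> 0 \<and> r \<le> \<gamma>})"
      using finite_support_above by blast
  qed
  have small: "\<forall>\<^sub>F t in at_top. (\<Sum>\<^sub>\<infinity>\<alpha>. \<bar>coeff h \<alpha>\<bar> * t powr \<alpha>) < 1"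
    by (rule eventually_small[OF \<epsilon>]) (rule h)
  have sum: "\<forall>\<^sub>F t in at_top. ((\<lambda>\<gamma>. G \<gamma> * t powr \<gamma>) has_sum (1 / (1 - eval_at t h))) UNIV \<and>
      eval_at t h < 1"
    using small eventually_converges[of h] eventually_gt_at_top[of 0]
  proof eventually_elim
    case (elim t)
    define q where "q = (\<Sum>\<^sub>\<infinity>\<alpha>. \<bar>coeff h \<alpha>\<bar> * t powr \<alpha>)"
    define x where "x = eval_at t h"
    have q: "0 \<le> q" "q < 1" using elim(1) by (auto simp: q_def infsum_nonneg)
    have "norm x \<le> q"
      using norm_infsum_bound[OF elim(2)[unfolded converges_at_def]]
      by (simp add: x_def q_def eval_at_def abs_mult)
    then have x: "norm x < 1" using q by simp
    define F where "F = (\<lambda>(n, \<gamma>). coeff (h ^ n) \<gamma> * t powr \<gamma>)"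
    have "(\<lambda>(n, \<gamma>). \<bar>coeff (h ^ n) \<gamma>\<bar> * t powr \<gamma>) summable_on UNIV \<times> UNIV"
    proof (rule summable_on_SigmaI)
      show "((\<lambda>\<gamma>. case (n, \<gamma>) of (n, \<gamma>) \<Rightarrow> \<bar>coeff (h ^ n) \<gamma>\<bar> * t powr \<gamma>) has_sum
          (\<Sum>\<^sub>\<infinity>\<gamma>. \<bar>coeff (h ^ n) \<gamma>\<bar> * t powr \<gamma>)) UNIV" for n
        unfolding prod.case
        using converges_at_power[OF elim(2,3), of n] by (intro has_sum_infsum) (simp add: converges_at_abs)
      have "summable (\<lambda>n. \<Sum>\<^sub>\<infinity>\<gamma>. \<bar>coeff (h ^ n) \<gamma>\<bar> * t powr \<gamma>)"
      proof (rule summable_comparison_test'[where N = 0])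
        show "summable (\<lambda>n. q ^ n)" using q by (intro summable_geometric) simp
        show "norm (\<Sum>\<^sub>\<infinity>\<gamma>. \<bar>coeff (h ^ n) \<gamma>\<bar> * t powr \<gamma>) \<le> q ^ n" for n
          using infsum_abs_power_le[OF elim(2,3), of n] by (simp add: q_def infsum_nonneg)
      qed
      then show "(\<lambda>n. \<Sum>\<^sub>\<infinity>\<gamma>. \<bar>coeff (h ^ n) \<gamma>\<bar> * t powr \<gamma>) summable_on UNIV"
        by (intro summable_nonneg_imp_summable_on) (auto intro: infsum_nonneg)
    qed auto
    then have "(\<lambda>p. norm (F p)) summable_on UNIV \<times> UNIV"
      by (simp add: F_def case_prod_unfold abs_mult)
    then have "F summable_on UNIV \<times> UNIV" by (rule abs_summable_summable)
    then obtain S where S: "(F has_sum S) (UNIV \<times> UNIV)" by (auto simp: summable_on_def)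
    have "((\<lambda>n. x ^ n) has_sum S) UNIV"
    proof (rule has_sum_SigmaD[OF S])
      show "((\<lambda>\<gamma>. F (n, \<gamma>)) has_sum x ^ n) UNIV" for n
        unfolding F_def prod.case x_def eval_at_power[OF elim(2,3), symmetric]
        by (subst eval_at_def, rule has_sum_infsum)
          (rule converges_at_summable[OF converges_at_power[OF elim(2,3)]])
    qed
    then have "(\<lambda>n. x ^ n) sums S" by (rule has_sum_imp_sums)
    then have S_eq: "S = 1 / (1 - x)" using geometric_sums[OF x] by (rule sums_unique2)
    have bij: "bij_betw (\<lambda>(\<gamma>, n). (n, \<gamma>)) (UNIV \<times> UNIV) (UNIV \<times> (UNIV :: real set))"
      by (rule bij_betwI[where g = "\<lambda>(n, \<gamma>). (\<gamma>, n)"]) auto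
    have S': "((\<lambda>(\<gamma>, n). coeff (h ^ n) \<gamma> * t powr \<gamma>) has_sum S) (UNIV \<times> UNIV)"
      using S has_sum_reindex_bij_betw[OF bij, of F] by (simp add: F_def case_prod_unfold)
    have "((\<lambda>\<gamma>. G \<gamma> * t powr \<gamma>) has_sum S) UNIV"
    proof (rule has_sum_SigmaD[OF S'])
      fix \<gamma>
      have "((\<lambda>n. coeff (h ^ n) \<gamma> * t powr \<gamma>) has_sum G \<gamma> * t powr \<gamma>) {n. coeff (h ^ n) \<gamma> \<noteq> 0}"
        using fin by (intro has_sum_finiteI) (auto simp: G_def sum_distrib_right)
      then show "((\<lambda>n. case (\<gamma>, n) of (\<gamma>, n) \<Rightarrow> coeff (h ^ n) \<gamma> * t powr \<gamma>) has_sum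
          G \<gamma> * t powr \<gamma>) UNIV"
        unfolding prod.case by (rule has_sum_cong_neutral[THEN iffD1, rotated -1]) auto
    qed
    then show ?case using x by (simp add: S_eq x_def)
  qed
  have "is_puiseux G"
  proof (rule is_puiseuxI[OF suppG])
    show "\<forall>\<^sub>F t in at_top. (\<lambda>\<alpha>. norm (G \<alpha> * t powr \<alpha>)) summable_on UNIV"
      using sum
      by eventually_elim
        (rule summable_on_iff_abs_summable_on_real[THEN iffD1], blast intro: has_sum_imp_summable)
  qed
  then have coeffG: "coeff (Abs_puiseux G) = G" by (simp add: Abs_puiseux_inverse)
  have "\<forall>\<^sub>F t in at_top. eval_at t ((1 - h) * Abs_puiseux G) = eval_at t 1"
    using sum eventually_eval_times[of "1 - h" "Abs_puiseux G"] eventually_eval_minus[of 1 h]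
      eventually_gt_at_top[of 0]
  proof eventually_elim
    case (elim t)
    have "eval_at t (Abs_puiseux G) = 1 / (1 - eval_at t h)"
      unfolding eval_at_def[of t "Abs_puiseux G"] coeffG using elim(1) by (intro infsumI) blast
    with elim show ?case by simp
  qed
  then have "(1 - h) * Abs_puiseux G = 1" by (rule eval_eqI)
  then show ?thesis by (rule that)
qed

lift_definition puiseux_monom :: "real \<Rightarrow> real \<Rightarrow> puiseux" is "\<lambda>c e \<alpha>. if \<alpha> = e then c else 0"
proof (rule is_puiseuxI)
  fix c e r :: real
  show "finite {\<alpha>. (if \<alpha> = e then c else 0) \<noteq> 0 \<and> r \<le> \<alpha>}"
    by (rule finite_subset[of _ "{e}"]) auto
next
  fix c e :: real
  have "(\<lambda>\<alpha>. norm ((if \<alpha> = e then c else 0) * t powr \<alpha>)) =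
      (\<lambda>\<alpha>. if \<alpha> = e then norm (c * t powr \<alpha>) else 0)" for t by auto
  then show "\<forall>\<^sub>F t in at_top. (\<lambda>\<alpha>. norm ((if \<alpha> = e then c else 0) * t powr \<alpha>)) summable_on UNIV"
    by (simp only: has_sum_imp_summable[OF has_sum_single] eventually_True)
qed

lemma coeff_times_monom: "coeff (f * puiseux_monom c e) \<gamma> = coeff f (\<gamma> - e) * c"
proof -
  have "conv (coeff f) (coeff (puiseux_monom c e)) \<gamma> =
      (\<Sum>\<alpha>\<in>{\<gamma> - e}. coeff f \<alpha> * coeff (puiseux_monom c e) (\<gamma> - \<alpha>))"
    unfolding conv_def
    by (rule sum.mono_neutral_left) (auto simp: puiseux_monom.rep_eq split: if_splits)
  then show ?thesis by (simp add: coeff_times puiseux_monom.rep_eq)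
qed

lemma puiseux_inverse_exists:
  fixes f :: puiseux
  assumes "f \<noteq> 0"
  obtains g where "f * g = 1"
proof -
  define e where "e = lead_exp f"
  define c where "c = coeff f e"
  have c: "c \<noteq> 0" using coeff_lead_exp[OF assms] by (simp add: c_def e_def)
  obtain e' where e': "e' < e" "\<And>\<alpha>. coeff f \<alpha> \<noteq> 0 \<Longrightarrow> \<alpha> \<noteq> e \<Longrightarrow> \<alpha> \<le> e'"
    using lead_exp_gap[of f] unfolding e_def by blast
  define m where "m = puiseux_monom (1 / c) (- e)"
  have coeff_fm: "coeff (f * m) \<gamma> = coeff f (\<gamma> + e) / c" for \<gamma>
    by (simp add: m_def coeff_times_monom)
  obtain g where "(1 - (1 - f * m)) * g = 1"
  proof (rule geometric_inverse[of "e - e'" "1 - f * m"])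
    fix \<alpha> assume \<alpha>: "coeff (1 - f * m) \<alpha> \<noteq> 0"
    have "\<alpha> \<noteq> 0" using \<alpha> c by (auto simp: coeff_fm c_def)
    moreover from this have "coeff f (\<alpha> + e) \<noteq> 0" using \<alpha> by (simp add: coeff_fm)
    ultimately show "\<alpha> \<le> - (e - e')" using e'(2)[of "\<alpha> + e"] by simp
  qed (use e' in auto)
  then have "f * (m * g) = 1" by (simp add: mult.assoc)
  then show ?thesis by (rule that)
qed

instantiation puiseux :: field
begin

definition inverse_puiseux :: "puiseux \<Rightarrow> puiseux" where
  "inverse_puiseux f = (if f = 0 then 0 else THE g. f * g = 1)"

definition divide_puiseux :: "puiseux \<Rightarrow> puiseux \<Rightarrow> puiseux" where
  "divide_puiseux f g = f * inverse g"

instance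
proof
  fix f g :: puiseux
  show "inverse f * f = 1" if f: "f \<noteq> 0"
  proof -
    obtain g where g: "f * g = 1" using puiseux_inverse_exists[OF f] .
    have "(THE g. f * g = 1) = g"
      using g f by (intro the_equality) (metis mult_cancel_left)+
    then show ?thesis using f g by (simp add: inverse_puiseux_def mult.commute)
  qed
qed (simp_all add: divide_puiseux_def inverse_puiseux_def)

end

instance puiseux :: linordered_field ..

definition val :: "puiseux \<Rightarrow> ereal" where
  "val f = (if f = 0 then -\<infinity> else ereal (lead_exp f))"

section \<open>Primal-dual pairs of linear programs\<close>

text \<open>The programs are defined over an arbitrary ordered field, so that the same definitions serve for
  Puiseux series and for the real programs obtained by evaluation. A primal-dual point is a
  quadruple \<open>(x, w, s, y)\<close>; \<open>coords\<close> lists its \<open>2N = 2(n + m)\<close> coordinates.\<close>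

type_synonym ('a, 'n, 'm) pd_point = "('a ^ 'n) \<times> ('a ^ 'm) \<times> ('a ^ 'n) \<times> ('a ^ 'm)"

fun coords :: "('a, 'n::finite, 'm::finite) pd_point \<Rightarrow> 'a ^ (('n + 'm) + ('n + 'm))" where
  "coords (x, w, s, y) =
     (\<chi> k. case k of
        Inl p \<Rightarrow> (case p of Inl j \<Rightarrow> x $ j | Inr i \<Rightarrow> w $ i)
      | Inr d \<Rightarrow> (case d of Inl j \<Rightarrow> s $ j | Inr i \<Rightarrow> y $ i))"

definition dot :: "'a::linordered_field ^ 'k::finite \<Rightarrow> 'a ^ 'k \<Rightarrow> 'a" where
  "dot u v = (\<Sum>i\<in>UNIV. u $ i * v $ i)"

definition primal_feasible ::
  "'a::linordered_field ^ 'n::finite ^ 'm::finite \<Rightarrow> 'a ^ 'm \<Rightarrow> (('a ^ 'n) \<times> ('a ^ 'm)) set" where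
  "primal_feasible A b = {(x, w). A *v x + w = b \<and> (\<forall>j. 0 \<le> x $ j) \<and> (\<forall>i. 0 \<le> w $ i)}"

definition dual_feasible ::
  "'a::linordered_field ^ 'n::finite ^ 'm::finite \<Rightarrow> 'a ^ 'n \<Rightarrow> (('a ^ 'n) \<times> ('a ^ 'm)) set" where
  "dual_feasible A c = {(s, y). s - transpose A *v y = c \<and> (\<forall>j. 0 \<le> s $ j) \<and> (\<forall>i. 0 \<le> y $ i)}"

definition primal_optimal ::
  "'a::linordered_field ^ 'n::finite ^ 'm::finite \<Rightarrow> 'a ^ 'm \<Rightarrow> 'a ^ 'n \<Rightarrow> ('a ^ 'n) \<times> ('a ^ 'm) \<Rightarrow> bool" where
  "primal_optimal A b c p \<longleftrightarrow>
     p \<in> primal_feasible A b \<and> (\<forall>q\<in>primal_feasible A b. dot c (fst p) \<le> dot c (fst q))"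

definition dual_optimal ::
  "'a::linordered_field ^ 'n::finite ^ 'm::finite \<Rightarrow> 'a ^ 'm \<Rightarrow> 'a ^ 'n \<Rightarrow> ('a ^ 'n) \<times> ('a ^ 'm) \<Rightarrow> bool" where
  "dual_optimal A b c p \<longleftrightarrow>
     p \<in> dual_feasible A c \<and> (\<forall>q\<in>dual_feasible A c. - dot b (snd q) \<le> - dot b (snd p))"

definition primal_value ::
  "'a::linordered_field ^ 'n::finite ^ 'm::finite \<Rightarrow> 'a ^ 'm \<Rightarrow> 'a ^ 'n \<Rightarrow> 'a \<Rightarrow> bool" where
  "primal_value A b c v \<longleftrightarrow> (\<exists>p. primal_optimal A b c p \<and> v = dot c (fst p))"

definition dual_value ::
  "'a::linordered_field ^ 'n::finite ^ 'm::finite \<Rightarrow> 'a ^ 'm \<Rightarrow> 'a ^ 'n \<Rightarrow> 'a \<Rightarrow> bool" where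
  "dual_value A b c v \<longleftrightarrow> (\<exists>p. dual_optimal A b c p \<and> v = - dot b (snd p))"

definition pd_feasible ::
  "'a::linordered_field ^ 'n::finite ^ 'm::finite \<Rightarrow> 'a ^ 'm \<Rightarrow> 'a ^ 'n \<Rightarrow> ('a, 'n, 'm) pd_point set" where
  "pd_feasible A b c = {(x, w, s, y).
     A *v x + w = b \<and> s - transpose A *v y = c \<and> (\<forall>k. 0 \<le> coords (x, w, s, y) $ k)}"

definition pd_strict ::
  "'a::linordered_field ^ 'n::finite ^ 'm::finite \<Rightarrow> 'a ^ 'm \<Rightarrow> 'a ^ 'n \<Rightarrow> ('a, 'n, 'm) pd_point set" where
  "pd_strict A b c = {z \<in> pd_feasible A b c. \<forall>k. 0 < coords z $ k}"

text \<open>The point of the central path with parameter \<open>\<mu>\<close>.\<close>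

definition central_point ::
  "'a::linordered_field ^ 'n::finite ^ 'm::finite \<Rightarrow> 'a ^ 'm \<Rightarrow> 'a ^ 'n \<Rightarrow> 'a \<Rightarrow> ('a, 'n, 'm) pd_point" where
  "central_point A b c \<mu> = (THE z. z \<in> pd_strict A b c \<and>
     (case z of (x, w, s, y) \<Rightarrow> (\<forall>j. x $ j * s $ j = \<mu>) \<and> (\<forall>i. w $ i * y $ i = \<mu>)))"

fun duality_measure :: "('a::linordered_field, 'n::finite, 'm::finite) pd_point \<Rightarrow> 'a" where
  "duality_measure (x, w, s, y) = (dot x s + dot w y) / of_nat (CARD('n) + CARD('m))"

definition wide_nbhd ::
  "'a::linordered_field \<Rightarrow> 'a ^ 'n::finite ^ 'm::finite \<Rightarrow> 'a ^ 'm \<Rightarrow> 'a ^ 'n \<Rightarrow> 'a \<Rightarrow>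
     ('a, 'n, 'm) pd_point set" where
  "wide_nbhd \<theta> A b c \<mu> = {(x, w, s, y). (x, w, s, y) \<in> pd_strict A b c \<and>
     duality_measure (x, w, s, y) = \<mu> \<and>
     (\<forall>j. (1 - \<theta>) * \<mu> \<le> x $ j * s $ j) \<and> (\<forall>i. (1 - \<theta>) * \<mu> \<le> w $ i * y $ i)}"

section \<open>Evaluation, valuation and logarithm maps\<close>

definition eval_vec :: "real \<Rightarrow> puiseux ^ 'k \<Rightarrow> real ^ 'k" where
  "eval_vec t v = (\<chi> i. eval_at t (v $ i))"

definition eval_mat :: "real \<Rightarrow> puiseux ^ 'k ^ 'l \<Rightarrow> real ^ 'k ^ 'l" where
  "eval_mat t M = (\<chi> i. eval_vec t (M $ i))"

definition val_vec :: "puiseux ^ 'k \<Rightarrow> ereal ^ 'k" where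
  "val_vec v = (\<chi> i. val (v $ i))"

text \<open>Only used at nonnegative reals.\<close>

definition log_ext :: "real \<Rightarrow> real \<Rightarrow> ereal" where
  "log_ext t a = (if a = 0 then -\<infinity> else ereal (log t a))"

definition log_vec :: "real \<Rightarrow> real ^ 'k \<Rightarrow> ereal ^ 'k" where
  "log_vec t v = (\<chi> i. log_ext t (v $ i))"

text \<open>The common value of \<open>val (\<C>(\<mu>))\<close> over all positive \<open>\<mu>\<close> with valuation \<open>\<lambda>\<close>.\<close>

definition trop_central_path ::
  "puiseux ^ 'n::finite ^ 'm::finite \<Rightarrow> puiseux ^ 'm \<Rightarrow> puiseux ^ 'n \<Rightarrow> real \<Rightarrow>
     ereal ^ (('n + 'm) + ('n + 'm))" where
  "trop_central_path A b c l =
     (THE p. \<forall>\<mu>>0. val \<mu> = ereal l \<longrightarrow> val_vec (coords (central_point A b c \<mu>)) = p)"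

section \<open>Metrics\<close>

definition delta_F :: "ereal ^ 'd \<Rightarrow> ereal ^ 'd \<Rightarrow> ereal" where
  "delta_F x y = Inf {ereal \<rho> |\<rho>. 0 \<le> \<rho> \<and> (\<forall>k. y $ k \<le> x $ k + ereal \<rho>)}"

definition d_H :: "ereal ^ 'd \<Rightarrow> ereal ^ 'd \<Rightarrow> ereal" where
  "d_H x y = delta_F x y + delta_F y x"

definition d_inf :: "ereal ^ 'd \<Rightarrow> ereal ^ 'd \<Rightarrow> ereal" where
  "d_inf x y = max (delta_F x y) (delta_F y x)"

text \<open>The one-sided (not symmetrized) distance between sets.\<close>

definition set_dist :: "('v \<Rightarrow> 'v \<Rightarrow> ereal) \<Rightarrow> 'v set \<Rightarrow> 'v set \<Rightarrow> ereal" where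
  "set_dist d X Y = (SUP x\<in>X. INF y\<in>Y. d x y)"

definition delta_log ::
  "puiseux ^ 'n::finite ^ 'm::finite \<Rightarrow> puiseux ^ 'm \<Rightarrow> puiseux ^ 'n \<Rightarrow> real \<Rightarrow> ereal" where
  "delta_log A b c t = 2 * set_dist d_H
     ((\<lambda>z. log_vec t (coords z)) ` pd_feasible (eval_mat t A) (eval_vec t b) (eval_vec t c))
     ((\<lambda>z. val_vec (coords z)) ` pd_feasible A b c)"

section \<open>Admissible thresholds\<close>

text \<open>Evaluation at \<open>t\<close> is meaningful only if the series involved converge at \<open>t\<close>, so this is part
  of admissibility.\<close>

definition converges_vec :: "puiseux ^ 'k \<Rightarrow> real \<Rightarrow> bool" where
  "converges_vec v t \<longleftrightarrow> (\<forall>i. converges_at (v $ i) t)"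

definition admissible_threshold ::
  "puiseux ^ 'n::finite ^ 'm::finite \<Rightarrow> puiseux ^ 'm \<Rightarrow> puiseux ^ 'n \<Rightarrow> puiseux \<Rightarrow>
     puiseux ^ 'n \<Rightarrow> puiseux ^ 'm \<Rightarrow> puiseux ^ 'n \<Rightarrow> puiseux ^ 'm \<Rightarrow> real \<Rightarrow> bool" where
  "admissible_threshold A b c \<nu> xs ws ss ys t0 \<longleftrightarrow> 0 < t0 \<and> (\<forall>t>t0.
     (\<forall>i. converges_vec (A $ i) t) \<and> converges_vec b t \<and> converges_vec c t \<and> converges_at \<nu> t \<and>
     converges_vec xs t \<and> converges_vec ws t \<and> converges_vec ss t \<and> converges_vec ys t \<and>
     pd_strict (eval_mat t A) (eval_vec t b) (eval_vec t c) \<noteq> {} \<and>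
     primal_value (eval_mat t A) (eval_vec t b) (eval_vec t c) (eval_at t \<nu>) \<and>
     dual_value (eval_mat t A) (eval_vec t b) (eval_vec t c) (eval_at t \<nu>) \<and>
     primal_optimal (eval_mat t A) (eval_vec t b) (eval_vec t c) (eval_vec t xs, eval_vec t ws) \<and>
     dual_optimal (eval_mat t A) (eval_vec t b) (eval_vec t c) (eval_vec t ss, eval_vec t ys))"

end

theory Submission
  imports Defs
begin

text \<open>
  A point of the neighbourhood satisfies \<open>(1 - \<theta>) \<mu> \<le> p\<^sub>k q\<^sub>k \<le> N \<mu>\<close> for every complementary pair of
  coordinates \<open>p\<^sub>k, q\<^sub>k\<close>. A nearby point of \<open>val \<F>\<close> therefore has products of valuation at most
  \<open>log\<^sub>t \<mu> + log\<^sub>t N + \<delta>\<close>, and so lies below the tropical central path, which is the coordinatewise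
  maximum of such points and is 1-Lipschitz in its parameter. This bounds \<open>log\<^sub>t z\<close> from above; the
  lower bound for a coordinate follows from the upper bound for its complementary partner.

  The tropical central path is defined through the central path over Puiseux series, whose existence
  has to be shown. Farkas' lemma over an ordered field gives, coordinate by coordinate, feasible
  points with \<open>p\<^sub>k q\<^sub>k \<ge> \<mu>\<close> and bounded duality gap; their average has \<open>val (p\<^sub>k q\<^sub>k) = val \<mu>\<close> for all \<open>k\<close>.
  After rescaling by this point, the residues form a real weighted barrier problem, whose solution
  corrects all \<open>p\<^sub>k q\<^sub>k / \<mu>\<close> to have residue one, and a convergent form of Hensel's lemma for quadratic
  systems turns this into an exact solution.
\<close>

text \<open>Over the reals a central point minimizes a logarithmic barrier and exists by
  compactness. Over Puiseux series neither the logarithm nor compactness is at hand, so the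
  centrality equations are solved at three levels of precision: valuations, where duality over an
  ordered field suffices; residues, which are real; and an error of negative valuation, which
  iteration removes. The levels share one mechanism. Primal and dual displacements lie in orthogonal
  subspaces \<open>V\<close> and \<open>W\<close>, which turns an inner product into a sum of
  nonnegative terms; such terms cannot cancel, so the valuation of the sum bounds that of every
  summand.

  In the final estimate the factor 2 in \<delta>(t) arises because approximating a point moves both
  factors of each product, while the way back moves one coordinate only. The constant N appears
  because the duality measure is the mean of N positive products, each of which is therefore at most
  N times the mean. The factor 1 - \<theta> enters only when a coordinate is bounded through its
  partner.\<close>

section \<open>Approximately central points over an ordered field\<close>

text \<open>Bartl's induction: if dropping the constraint \<open>m\<close> breaks the implication, some \<open>v \<in> X\<close> violates only
  \<open>f m\<close>, and substituting \<open>x + f m x v\<close> for \<open>x\<close> projects along \<open>v\<close> onto the kernel of \<open>f m\<close>.\<close>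

lemma farkas_subspace:
  fixes f :: "'i \<Rightarrow> 'v::ab_group_add \<Rightarrow> 'a::linordered_field" and scale :: "'a \<Rightarrow> 'v \<Rightarrow> 'v"
  assumes "vector_space scale" "finite S" "module.subspace scale X"
    and "\<forall>i\<in>S. Vector_Spaces.linear scale (*) (f i)" "Vector_Spaces.linear scale (*) g"
    and "\<forall>x\<in>X. (\<forall>i\<in>S. 0 \<le> f i x) \<longrightarrow> 0 \<le> g x"
  shows "\<exists>l. (\<forall>i\<in>S. 0 \<le> l i) \<and> (\<forall>x\<in>X. g x = (\<Sum>i\<in>S. l i * f i x))"
  using assms(2,4,5,6)
proof (induction S arbitrary: f g rule: finite_induct)
  case empty
  interpret vector_space scale by fact
  interpret g: Vector_Spaces.linear scale "(*)" g by fact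
  have "g x = 0" if "x \<in> X" for x
    using empty(3) that subspace_neg[OF assms(3) that] g.neg[of x]
    by (intro antisym) (metis empty_iff neg_0_le_iff_le, blast)
  then show ?case by auto
next
  case (insert m S)
  interpret vector_space scale by fact
  interpret fm: Vector_Spaces.linear scale "(*)" "f m" using insert.prems by blast
  interpret g: Vector_Spaces.linear scale "(*)" g by fact
  show ?case
  proof (cases "\<forall>x\<in>X. (\<forall>i\<in>S. 0 \<le> f i x) \<longrightarrow> 0 \<le> g x")
    case True
    from insert.IH[OF _ insert.prems(2) True] insert.prems obtain l
      where l: "\<forall>i\<in>S. 0 \<le> l i" "\<forall>x\<in>X. g x = (\<Sum>i\<in>S. l i * f i x)" by auto
    have "(\<Sum>i\<in>S. (l(m := 0)) i * f i x) = (\<Sum>i\<in>S. l i * f i x)" for x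
      using insert.hyps by (intro sum.cong) auto
    then show ?thesis using l insert.hyps by (intro exI[of _ "l(m := 0)"]) auto
  next
    case False
    then obtain u where u: "u \<in> X" "\<And>i. i \<in> S \<Longrightarrow> 0 \<le> f i u" "g u < 0" by force
    with insert.prems(3) have fu: "f m u < 0" by force
    \<comment> \<open>The scaling makes \<open>f m v = -1\<close>, so that \<open>h\<close> below
      lands in the kernel of \<open>f m\<close>.\<close>
    define v where "v = scale (- inverse (f m u)) u"
    have c: "- inverse (f m u) > 0" using fu by simp
    have fmv: "f m v = -1" using fu unfolding v_def fm.scale by simp
    have fv: "0 \<le> f i v" if "i \<in> S" for i
    proof -
      interpret fi: Vector_Spaces.linear scale "(*)" "f i" using insert.prems that by blast
      show ?thesis unfolding v_def fi.scale using u(2)[OF that] c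
        by (intro mult_nonneg_nonneg) auto
    qed
    have gv: "g v < 0" unfolding v_def g.scale using u(3) c by (intro mult_pos_neg) auto
    have vX: "v \<in> X" unfolding v_def using assms(3) u(1) by (rule subspace_scale)
    define h where "h x = x + scale (f m x) v" for x
    have hX: "h x \<in> X" if "x \<in> X" for x
      unfolding h_def using assms(3) that vX by (intro subspace_add subspace_scale)
    have h_eq: "k (h x) = k x + f m x * k v" if "Vector_Spaces.linear scale (*) k" for k :: "'v \<Rightarrow> 'a" and x
    proof -
      interpret k: Vector_Spaces.linear scale "(*)" k by fact
      show ?thesis by (simp add: h_def k.add k.scale)
    qed
    have lin: "Vector_Spaces.linear scale (*) (\<lambda>x. k (h x))" if "Vector_Spaces.linear scale (*) k" for k :: "'v \<Rightarrow> 'a"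
    proof -
      interpret k: Vector_Spaces.linear scale "(*)" k by fact
      show ?thesis unfolding h_eq[OF that]
        by unfold_locales (simp_all add: k.add k.scale fm.add fm.scale algebra_simps)
    qed
    have "\<exists>l. (\<forall>i\<in>S. 0 \<le> l i) \<and> (\<forall>x\<in>X. g (h x) = (\<Sum>i\<in>S. l i * f i (h x)))"
    proof (rule insert.IH[of "\<lambda>i x. f i (h x)" "\<lambda>x. g (h x)"])
      show "\<forall>x\<in>X. (\<forall>i\<in>S. 0 \<le> f i (h x)) \<longrightarrow> 0 \<le> g (h x)"
        using insert.prems(3) hX h_eq[of "f m"] fmv insert.prems(1) by force
    qed (use insert.prems lin in auto)
    then obtain l where l: "\<forall>i\<in>S. 0 \<le> l i"
      "\<And>x. x \<in> X \<Longrightarrow> g (h x) = (\<Sum>i\<in>S. l i * f i (h x))" by blast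
    \<comment> \<open>Expanding the identity for \<open>h x\<close> leaves exactly this coefficient
      in front of \<open>f m x\<close>. It is nonnegative because \<open>v\<close> violates only
      \<open>f m\<close> and \<open>g v < 0\<close>.\<close>
    define lm where "lm = (\<Sum>i\<in>S. l i * f i v) - g v"
    have "0 \<le> (\<Sum>i\<in>S. l i * f i v)" using l(1) fv by (intro sum_nonneg) auto
    then have lm: "0 \<le> lm" using gv by (simp add: lm_def)
    have "g x = lm * f m x + (\<Sum>i\<in>S. l i * f i x)" if "x \<in> X" for x
    proof -
      have "(\<Sum>i\<in>S. l i * f i (h x)) = (\<Sum>i\<in>S. l i * f i x + f m x * (l i * f i v))"
        using insert.prems(1) by (intro sum.cong) (auto simp: h_eq algebra_simps)
      also have "\<dots> = (\<Sum>i\<in>S. l i * f i x) + f m x * (\<Sum>i\<in>S. l i * f i v)"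
        by (simp add: sum.distrib sum_distrib_left)
      finally show ?thesis
        using l(2)[OF that] h_eq[OF insert.prems(2), of x] by (simp add: lm_def algebra_simps)
    qed
    moreover have "(\<Sum>i\<in>S. (l(m := lm)) i * f i x) = (\<Sum>i\<in>S. l i * f i x)" for x
      using insert.hyps by (intro sum.cong) auto
    ultimately show ?thesis using l(1) lm insert.hyps
      by (intro exI[of _ "l(m := lm)"]) auto
  qed
qed

section \<open>Inner products and orthogonal decompositions\<close>

lemma dot_commute: "dot u v = dot v u"
  by (simp add: dot_def mult.commute)

lemma dot_simps:
  fixes u v w :: "'a::linordered_field ^ 'k::finite"
  shows dot_add_left: "dot (u + v) w = dot u w + dot v w"
    and dot_add_right: "dot w (u + v) = dot w u + dot w v"
    and dot_diff_left: "dot (u - v) w = dot u w - dot v w"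
    and dot_diff_right: "dot w (u - v) = dot w u - dot w v"
    and dot_scale_left: "dot (c *s u) v = c * dot u v"
    and dot_scale_right: "dot u (c *s v) = c * dot u v"
    and dot_zero_left: "dot 0 v = 0"
    and dot_zero_right: "dot v 0 = 0"
    and dot_axis_left: "dot (axis k c) v = c * v $ k"
    and dot_axis_right: "dot v (axis k c) = c * v $ k"
  by (simp_all add: dot_def sum.distrib sum_subtractf sum_distrib_left algebra_simps axis_def
      if_distrib[of "\<lambda>x. _ * x"] cong: if_cong)

lemma dot_nonneg:
  "(\<And>i. 0 \<le> u $ i) \<Longrightarrow> (\<And>i. 0 \<le> v $ i) \<Longrightarrow> 0 \<le> dot u v"
  by (simp add: dot_def sum_nonneg)

lemma dot_component_le:
  assumes "\<And>i. 0 \<le> u $ i" "\<And>i. 0 \<le> v $ i"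
  shows "u $ k * v $ k \<le> dot u v"
  unfolding dot_def using assms by (intro member_le_sum) auto

lemma dot_self_zero: "dot u u = 0 \<Longrightarrow> u = 0"
  by (simp add: dot_def sum_nonneg_eq_0_iff vec_eq_iff)

lemma dot_sum_left: "dot (\<Sum>i\<in>S. u i) v = (\<Sum>i\<in>S. dot (u i) v)"
  by (induction S rule: infinite_finite_induct) (simp_all add: dot_simps)

text \<open>Scalar multiplication on the tuples (\<sigma>, p, \<tau>, q) of the homogenized linear
  program, the ambient space to which Farkas' lemma is applied.\<close>

definition quad_scale :: "'a::field \<Rightarrow> 'a \<times> ('a ^ 'k) \<times> 'a \<times> ('a ^ 'k) \<Rightarrow> 'a \<times> ('a ^ 'k) \<times> 'a \<times> ('a ^ 'k)" where
  "quad_scale c = (\<lambda>(\<sigma>, p, \<tau>, q). (c * \<sigma>, c *s p, c * \<tau>, c *s q))"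

lemma vector_space_quad_scale: "vector_space quad_scale"
  by unfold_locales (auto simp: quad_scale_def algebra_simps vector_add_ldistrib vector_sadd_rdistrib vector_smult_assoc)

text \<open>\<open>decomp\<close> asks for \<open>V + D W\<close> to be the whole space for every
  positive diagonal \<open>D\<close>, not only the identity: the linearized centrality equations
  \<open>q dp + p dq = r\<close> have this form with \<open>D = p / q\<close>.\<close>

locale orth_decomp =
  fixes V W :: "('a::linordered_field ^ 'k::finite) set"
  assumes subspace_V: "vec.subspace V" and subspace_W: "vec.subspace W"
    and orth: "v \<in> V \<Longrightarrow> w \<in> W \<Longrightarrow> dot v w = 0"
    and decomp: "(\<And>k. 0 < d $ k) \<Longrightarrow> \<exists>v\<in>V. \<exists>w\<in>W. \<forall>k. v $ k + d $ k * w $ k = r $ k"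
begin

lemma decomp_sum:
  obtains v w where "v \<in> V" "w \<in> W" "r = v + w"
  using decomp[of "1" r] by (force simp: vec_eq_iff)

text \<open>The \<open>W\<close>-component of \<open>u\<close> is orthogonal to itself, hence zero
  over an ordered field. This converse of orthogonality turns Farkas multipliers into elements of
  \<open>V\<close> and, symmetrically, of \<open>W\<close>.\<close>

lemma in_VI:
  assumes "\<And>w. w \<in> W \<Longrightarrow> dot u w = 0"
  shows "u \<in> V"
proof -
  obtain v w where *: "v \<in> V" "w \<in> W" "u = v + w" by (rule decomp_sum)
  have "dot w w = 0" using assms[OF *(2)] orth[OF *(1,2)] *(3) by (simp add: dot_simps)
  then show ?thesis using * dot_self_zero[of w] by simp
qed

lemma in_WI:
  assumes "\<And>v. v \<in> V \<Longrightarrow> dot v u = 0"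
  shows "u \<in> W"
proof -
  obtain v w where *: "v \<in> V" "w \<in> W" "u = v + w" by (rule decomp_sum)
  have "dot v v = 0" using assms[OF *(1)] orth[OF *(1,2)] *(3) by (simp add: dot_simps)
  then show ?thesis using * dot_self_zero[of v] by simp
qed

end

text \<open>The affine spaces \<open>xs + V\<close> and \<open>ss + W\<close> of a primal-dual pair, where \<open>xs\<close>, \<open>ss\<close> are optimal
  (complementary) and \<open>x0\<close>, \<open>s0\<close> are strictly feasible.\<close>

locale complementary_pair = orth_decomp V W
  for V W :: "('a::linordered_field ^ 'k::finite) set" +
  fixes xs ss x0 s0 :: "'a ^ 'k"
  assumes xs_nonneg: "0 \<le> xs $ k" and ss_nonneg: "0 \<le> ss $ k" and compl: "dot xs ss = 0"
    and x0_pos: "0 < x0 $ k" and s0_pos: "0 < s0 $ k"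
    and x0_V: "x0 - xs \<in> V" and s0_W: "s0 - ss \<in> W"
begin

text \<open>Linear programming duality for maximizing \<open>p $ k\<close> subject to \<open>dot p ss \<le> \<mu>\<close>, homogenized by \<open>\<sigma>\<close>. If
  the cone of solutions has no point with \<open>\<sigma> > 0\<close>, the multipliers given by Farkas' lemma are
  themselves a solution, because the system is self-dual.\<close>

lemma homogeneous_certificate:
  assumes "\<mu> > 0"
  obtains p \<tau> q where "p - xs \<in> V" "\<And>i. 0 \<le> p $ i" "dot p ss \<le> \<mu>"
    "q - \<tau> *s ss \<in> W" "0 \<le> \<tau>" "\<And>i. 0 \<le> q $ i" "1 \<le> q $ k"
    "\<tau> * \<mu> + dot q xs \<le> p $ k"
proof -
  define X where "X = {(\<sigma>, p, \<tau>, q). p - \<sigma> *s xs \<in> V \<and> q - \<tau> *s ss \<in> W}"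
  \<comment> \<open>The constraints encode p \<ge> 0, q \<ge> \<sigma> times the k-th unit vector,
    \<open>dot p ss\<close> \<le> \<sigma> \<mu>, \<tau> \<ge> 0 and \<tau> \<mu> +
    \<open>dot q xs\<close> \<le> \<open>p $ k\<close>. The last one reverses weak duality, so a
    solution with \<sigma> = 1 is a pair of optima.\<close>
  define f :: "'k + 'k + nat \<Rightarrow> 'a \<times> ('a ^ 'k) \<times> 'a \<times> ('a ^ 'k) \<Rightarrow> 'a" where
    "f = case_sum (\<lambda>i (\<sigma>, p, \<tau>, q). p $ i)
      (case_sum (\<lambda>i (\<sigma>, p, \<tau>, q). q $ i - (if i = k then \<sigma> else 0))
      (\<lambda>n (\<sigma>, p, \<tau>, q). if n = 0 then \<sigma> * \<mu> - dot p ss else if n = 1 then \<tau>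
        else p $ k - \<tau> * \<mu> - dot q xs))"
  define S :: "('k + 'k + nat) set" where "S = UNIV <+> UNIV <+> {0, 1, 2}"
  interpret Q: vector_space "quad_scale :: 'a \<Rightarrow> 'a \<times> ('a ^ 'k) \<times> 'a \<times> ('a ^ 'k) \<Rightarrow> _"
    by (rule vector_space_quad_scale)
  show ?thesis
  proof (cases "\<exists>x\<in>X. (\<forall>i\<in>S. 0 \<le> f i x) \<and> 0 < fst x")
    case True
    then obtain \<sigma> p \<tau> q where X: "(\<sigma>, p, \<tau>, q) \<in> X" and f: "\<forall>i\<in>S. 0 \<le> f i (\<sigma>, p, \<tau>, q)"
      and \<sigma>: "0 < \<sigma>" by auto
    let ?c = "inverse \<sigma>"
    have c: "?c > 0" "?c * \<sigma> = 1" using \<sigma> by auto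
    have f': "0 \<le> p $ i" "0 \<le> q $ i - (if i = k then \<sigma> else 0)" "0 \<le> \<sigma> * \<mu> - dot p ss" "0 \<le> \<tau>"
      "0 \<le> p $ k - \<tau> * \<mu> - dot q xs" for i
      using f[rule_format, of "Inl i"] f[rule_format, of "Inr (Inl i)"]
        f[rule_format, of "Inr (Inr 0)"] f[rule_format, of "Inr (Inr 1)"]
        f[rule_format, of "Inr (Inr 2)"]
      by (auto simp: f_def S_def Plus_def)
    have q: "0 \<le> q $ i" for i using f'(2)[of i] \<sigma> by (auto split: if_splits)
    show ?thesis
    proof (rule that[of "?c *s p" "?c *s q" "?c * \<tau>"])
      have "?c *s (p - \<sigma> *s xs) \<in> V" "?c *s (q - \<tau> *s ss) \<in> W"
        using X vec.subspace_scale[OF subspace_V] vec.subspace_scale[OF subspace_W]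
        unfolding X_def mem_Collect_eq prod.case by blast+
      then show "?c *s p - xs \<in> V" "?c *s q - (?c * \<tau>) *s ss \<in> W"
        using \<sigma> by (simp_all add: vector_ssub_ldistrib vector_smult_assoc)
      show "0 \<le> (?c *s p) $ i" "0 \<le> (?c *s q) $ i" for i
        using c f'(1)[of i] q[of i] by simp_all
      show "dot (?c *s p) ss \<le> \<mu>" "0 \<le> ?c * \<tau>" "1 \<le> (?c *s q) $ k"
        using f'(2)[of k] f'(3,4) \<sigma> by (simp_all add: dot_simps field_simps)
      have "?c * (\<tau> * \<mu> + dot q xs) \<le> ?c * p $ k" using f'(5) c by (intro mult_left_mono) auto
      then show "?c * \<tau> * \<mu> + dot (?c *s q) xs \<le> (?c *s p) $ k"
        by (simp add: dot_simps distrib_left mult.assoc)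
    qed
  next
    case False
    have subX: "Q.subspace X"
    proof (rule Q.subspaceI)
      show "0 \<in> X"
        using vec.subspace_0[OF subspace_V] vec.subspace_0[OF subspace_W] by (simp add: X_def zero_prod_def)
    next
      fix x y assume "x \<in> X" "y \<in> X"
      then obtain \<sigma> p \<tau> q \<sigma>' p' \<tau>' q' where *: "x = (\<sigma>, p, \<tau>, q)" "y = (\<sigma>', p', \<tau>', q')"
        "p - \<sigma> *s xs \<in> V" "q - \<tau> *s ss \<in> W" "p' - \<sigma>' *s xs \<in> V" "q' - \<tau>' *s ss \<in> W"
        by (auto simp: X_def)
      have "p + p' - (\<sigma> + \<sigma>') *s xs = (p - \<sigma> *s xs) + (p' - \<sigma>' *s xs)"
        "q + q' - (\<tau> + \<tau>') *s ss = (q - \<tau> *s ss) + (q' - \<tau>' *s ss)"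
        by (simp_all add: vec.scale_left_distrib)
      moreover have "x + y = (\<sigma> + \<sigma>', p + p', \<tau> + \<tau>', q + q')" by (simp add: *(1,2))
      ultimately show "x + y \<in> X"
        using vec.subspace_add[OF subspace_V *(3,5)] vec.subspace_add[OF subspace_W *(4,6)]
        by (simp only: X_def mem_Collect_eq prod.case)
    next
      fix c x assume "x \<in> X"
      then obtain \<sigma> p \<tau> q where *: "x = (\<sigma>, p, \<tau>, q)" "p - \<sigma> *s xs \<in> V" "q - \<tau> *s ss \<in> W"
        by (auto simp: X_def)
      show "quad_scale c x \<in> X"
        using vec.subspace_scale[OF subspace_V *(2), of c] vec.subspace_scale[OF subspace_W *(3), of c] *(1)
        by (simp add: X_def quad_scale_def)
    qed
    have lin: "\<forall>i\<in>S. Vector_Spaces.linear quad_scale (*) (f i)"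
    proof
      fix i assume "i \<in> S"
      consider a where "i = Inl a" | a where "i = Inr (Inl a)" | n where "i = Inr (Inr n)"
        by (metis sum.exhaust)
      then have "f i (x + y) = f i x + f i y \<and> f i (quad_scale c x) = c * f i x" for c x y
      proof cases
        case 1
        then show ?thesis by (cases x; cases y) (simp add: f_def quad_scale_def)
      next
        case 2
        then show ?thesis by (cases x; cases y) (simp add: f_def quad_scale_def algebra_simps)
      next
        case 3
        then show ?thesis
          by (cases x; cases y) (simp add: f_def quad_scale_def dot_add_left dot_scale_left algebra_simps)
      qed
      then have "f i (x + y) = f i x + f i y" "f i (quad_scale c x) = c * f i x" for c x y by blast+
      then show "Vector_Spaces.linear quad_scale (*) (f i)"
        by unfold_locales
    qed
    have "\<exists>l. (\<forall>i\<in>S. 0 \<le> l i) \<and> (\<forall>x\<in>X. - fst x = (\<Sum>i\<in>S. l i * f i x))"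
    proof (rule farkas_subspace[OF vector_space_quad_scale _ subX lin])
      show "finite S" by (simp add: S_def)
      show "\<forall>x\<in>X. (\<forall>i\<in>S. 0 \<le> f i x) \<longrightarrow> 0 \<le> - fst x"
        using False by (simp add: not_less) blast
      show "Vector_Spaces.linear quad_scale (*) (\<lambda>x :: 'a \<times> ('a ^ 'k) \<times> 'a \<times> ('a ^ 'k). - fst x)"
        by unfold_locales (simp_all add: quad_scale_def case_prod_unfold)
    qed
    then obtain l where l: "\<forall>i\<in>S. 0 \<le> l i" "\<forall>x\<in>X. - fst x = (\<Sum>i\<in>S. l i * f i x)"
      by (elim exE conjE)
    define a where "a = (\<chi> i. l (Inl i))"
    define b where "b = (\<chi> i. l (Inr (Inl i)))"
    define m where "m = l (Inr (Inr 0))"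
    define n where "n = l (Inr (Inr 1))"
    define \<theta> where "\<theta> = l (Inr (Inr 2))"
    have nonneg: "0 \<le> a $ i" "0 \<le> b $ i" "0 \<le> m" "0 \<le> n" "0 \<le> \<theta>" for i
      by (auto simp: a_def b_def m_def n_def \<theta>_def S_def intro!: l(1)[rule_format])
    \<comment> \<open>The facts below are this identity at the tuples (0, v, 0, 0), (0, 0, 0, w),
      (0, 0, 1, ss) and (1, xs, 0, 0) of \<open>X\<close>.\<close>
    have ident: "- \<sigma> = dot a p + dot b q - b $ k * \<sigma> + m * (\<sigma> * \<mu> - dot p ss) + n * \<tau>
        + \<theta> * (p $ k - \<tau> * \<mu> - dot q xs)" if "p - \<sigma> *s xs \<in> V" "q - \<tau> *s ss \<in> W" for \<sigma> p \<tau> q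
    proof -
      have "(\<Sum>i\<in>UNIV. b $ i * (q $ i - (if i = k then \<sigma> else 0))) = dot b q - b $ k * \<sigma>"
        by (simp add: dot_def algebra_simps sum_subtractf if_distrib[of "\<lambda>x. _ * x"] cong: if_cong)
      then show ?thesis
        using bspec[OF l(2), of "(\<sigma>, p, \<tau>, q)"] that unfolding S_def X_def
        by (simp add: sum.Plus f_def a_def b_def m_def n_def \<theta>_def dot_def)
    qed
    \<comment> \<open>Self-duality: (\<theta>, b, m, Q) has the shape of (\<sigma>, p, \<tau>, q).
      The multiplier \<theta> of the last constraint acts on coordinate \<open>k\<close> of
      \<open>p\<close>, hence the unit vector in \<open>Q\<close>.\<close>
    define Q where "Q = a + axis k \<theta>"
    have Qnonneg: "0 \<le> Q $ i" for i using nonneg(1)[of i] nonneg(5) by (simp add: Q_def axis_def)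
    have Qk: "\<theta> \<le> Q $ k" using nonneg(1)[of k] by (simp add: Q_def axis_def)
    have QW: "Q - m *s ss \<in> W"
    proof (rule in_WI)
      fix v assume "v \<in> V"
      then show "dot v (Q - m *s ss) = 0"
        using ident[where \<sigma> = 0 and p = v and \<tau> = 0 and q = 0] vec.subspace_0[OF subspace_W]
        by (simp add: Q_def dot_simps dot_commute[of v a] algebra_simps)
    qed
    have bV: "b - \<theta> *s xs \<in> V"
    proof (rule in_VI)
      fix w assume "w \<in> W"
      then show "dot (b - \<theta> *s xs) w = 0"
        using ident[where \<sigma> = 0 and p = 0 and \<tau> = 0 and q = w] vec.subspace_0[OF subspace_V]
        by (simp add: dot_simps dot_commute[of xs w] algebra_simps)
    qed
    have bs: "dot b ss \<le> \<theta> * \<mu>"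
      using ident[where \<sigma> = 0 and p = 0 and \<tau> = 1 and q = ss] vec.subspace_0[OF subspace_V] vec.subspace_0[OF subspace_W] nonneg(4) compl
      by (simp add: dot_simps dot_commute[of ss xs] algebra_simps)
    have bk: "b $ k = 1 + dot Q xs + m * \<mu>"
      using ident[where \<sigma> = 1 and p = xs and \<tau> = 0 and q = 0] vec.subspace_0[OF subspace_V] vec.subspace_0[OF subspace_W] compl
      by (simp add: dot_simps Q_def algebra_simps)
    show ?thesis
    proof (cases "\<theta> = 0")
      case True
      \<comment> \<open>With \<theta> = 0 the vector \<open>b\<close> is a nonnegative recession
        direction in \<open>V\<close> with \<open>b $ k > 0\<close> and \<open>dot b ss\<close>
        \<le> 0. The strictly feasible \<open>s0\<close> excludes it.\<close>
      have "dot b s0 = dot b (s0 - ss) + dot b ss" by (simp add: dot_simps)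
      also have "\<dots> \<le> 0" using orth[OF _ s0_W, of b] bV bs True by simp
      finally have "dot b s0 \<le> 0" .
      moreover have "0 \<le> dot Q xs" by (intro dot_nonneg Qnonneg xs_nonneg)
      then have "0 < b $ k" using bk nonneg(3) assms by (simp add: add_pos_nonneg)
      then have "0 < b $ k * s0 $ k" using s0_pos by simp
      then have "0 < dot b s0"
        using dot_component_le[of b s0 k] nonneg(2) s0_pos less_imp_le by fastforce
      ultimately show ?thesis by simp
    next
      case False
      then have \<theta>: "\<theta> > 0" using nonneg(5) by simp
      let ?c = "inverse \<theta>"
      have c: "?c > 0" "?c * \<theta> = 1" using \<theta> by auto
      show ?thesis
      proof (rule that[of "?c *s b" "?c *s Q" "?c * m"])
        have "?c *s (b - \<theta> *s xs) \<in> V" "?c *s (Q - m *s ss) \<in> W"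
          using bV QW vec.subspace_scale[OF subspace_V] vec.subspace_scale[OF subspace_W] by blast+
        then show "?c *s b - xs \<in> V" "?c *s Q - (?c * m) *s ss \<in> W"
          using \<theta> by (simp_all add: vector_ssub_ldistrib vector_smult_assoc)
        show "0 \<le> (?c *s b) $ i" "0 \<le> (?c *s Q) $ i" for i
          using c nonneg(2)[of i] Qnonneg[of i] by simp_all
        show "dot (?c *s b) ss \<le> \<mu>" "0 \<le> ?c * m" "1 \<le> (?c *s Q) $ k"
          using bs nonneg(3) Qk \<theta> by (simp_all add: dot_simps field_simps)
        have "?c * (m * \<mu> + dot Q xs) \<le> ?c * b $ k" using bk c by (intro mult_left_mono) auto
        then show "?c * m * \<mu> + dot (?c *s Q) xs \<le> (?c *s b) $ k"
          by (simp add: dot_simps distrib_left mult.assoc)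
      qed
    qed
  qed
qed

text \<open>The certificate has \<open>p $ k\<close> \<ge> D and \<open>q $ k\<close> \<ge> 1 for D
  = \<tau> \<mu> + \<open>dot q xs\<close>. Scaling \<open>q\<close> by \<mu> / D lifts the product
  to \<mu> and keeps \<open>dot q xs\<close> within \<mu>. The scaled vector lies over the multiple
  c \<tau> \<le> 1 of \<open>ss\<close>; adding the missing multiple returns it to
  \<open>ss + W\<close> without changing the product with \<open>xs\<close>, by
  complementarity.\<close>

lemma coordinate_pair:
  assumes "\<mu> > 0"
  obtains p q where "p - xs \<in> V" "\<And>i. 0 \<le> p $ i" "dot p ss \<le> \<mu>"
    "q - ss \<in> W" "\<And>i. 0 \<le> q $ i" "dot q xs \<le> \<mu>" "\<mu> \<le> p $ k * q $ k"
proof -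
  obtain p \<tau> q where *: "p - xs \<in> V" "\<And>i. 0 \<le> p $ i" "dot p ss \<le> \<mu>"
    "q - \<tau> *s ss \<in> W" "0 \<le> \<tau>" "\<And>i. 0 \<le> q $ i" "1 \<le> q $ k"
    "\<tau> * \<mu> + dot q xs \<le> p $ k"
    using homogeneous_certificate[OF assms, of k] by metis
  define D where "D = \<tau> * \<mu> + dot q xs"
  have qx: "0 \<le> dot q xs" by (intro dot_nonneg *(6) xs_nonneg)
  have tm: "0 \<le> \<tau> * \<mu>" using *(5) assms by simp
  \<comment> \<open>If D = 0 then \<open>q\<close> is a recession direction in \<open>W\<close> with
    \<open>q $ k\<close> \<ge> 1 and \<open>dot q xs = 0\<close>, against the strictly feasible
    \<open>x0\<close>.\<close>
  have "D \<noteq> 0"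
  proof
    assume "D = 0"
    then have "\<tau> * \<mu> = 0" "dot q xs = 0" using qx tm unfolding D_def by (simp_all add: add_nonneg_eq_0_iff)
    then have t: "\<tau> = 0" "dot q xs = 0" using assms by auto
    have "dot q x0 = dot (x0 - xs) q + dot q xs" by (simp add: dot_simps dot_commute)
    also have "\<dots> = 0" using orth[OF x0_V, of q] *(4) t by simp
    finally have "dot q x0 = 0" .
    moreover have "0 < q $ k * x0 $ k" using *(7) x0_pos[of k] by (simp add: less_le_trans[OF zero_less_one])
    moreover have "q $ k * x0 $ k \<le> dot q x0" using *(6) x0_pos less_imp_le by (intro dot_component_le) auto
    ultimately show False by simp
  qed
  then have D: "D > 0" using qx tm by (simp add: D_def less_le)
  define c where "c = \<mu> / D"
  have c: "c > 0" using assms D by (simp add: c_def)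
  have ct: "c * \<tau> \<le> 1" using qx D by (simp add: c_def D_def field_simps)
  have cq: "c * dot q xs \<le> \<mu>"
    using mult_left_mono[of "dot q xs" D c] D tm c by (simp add: c_def D_def)
  define r where "r = (1 - c * \<tau>) *s ss + c *s q"
  show ?thesis
  proof (rule that[of p r])
    have "r - ss = c *s (q - \<tau> *s ss)"
      by (simp add: r_def vec_eq_iff algebra_simps)
    then show "r - ss \<in> W" using vec.subspace_scale[OF subspace_W *(4)] by simp
    show "0 \<le> r $ i" for i unfolding r_def vector_add_component vector_smult_component
      using ct c *(6)[of i] ss_nonneg[of i] by (intro add_nonneg_nonneg mult_nonneg_nonneg) auto
    show "dot r xs \<le> \<mu>" using cq compl by (simp add: r_def dot_simps dot_commute[of ss xs])
    have "c \<le> c * q $ k" using mult_left_mono[OF *(7), of c] c by simp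
    also have "\<dots> \<le> r $ k" unfolding r_def vector_add_component vector_smult_component
      using ct ss_nonneg[of k] by (simp del: left_diff_distrib add: mult_nonneg_nonneg)
    finally have "D * c \<le> p $ k * r $ k" using *(8) D c by (intro mult_mono) (auto simp: D_def)
    then show "\<mu> \<le> p $ k * r $ k" using D by (simp add: c_def)
  qed (use * in auto)
qed

text \<open>The average of the N coordinate pairs keeps at least 1/N of each distinguished
  coordinate, which costs \<open>N ^ 2\<close> in the lower bound. For the upper bound,
  orthogonality and complementarity reduce the inner product of the averages to its two mixed terms
  with \<open>ss\<close> and \<open>xs\<close>, each at most \<mu>.\<close>

lemma approximate_center:
  assumes "\<mu> > 0"
  obtains p q where "p - xs \<in> V" "q - ss \<in> W" "\<And>i. 0 < p $ i" "\<And>i. 0 < q $ i"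
    "\<And>i. \<mu> \<le> of_nat CARD('k) ^ 2 * (p $ i * q $ i)" "\<And>i. p $ i * q $ i \<le> 2 * \<mu>"
proof -
  have "\<exists>p q. p - xs \<in> V \<and> (\<forall>i. 0 \<le> p $ i) \<and> dot p ss \<le> \<mu> \<and>
    q - ss \<in> W \<and> (\<forall>i. 0 \<le> q $ i) \<and> dot q xs \<le> \<mu> \<and> \<mu> \<le> p $ k * q $ k" for k
    by (rule coordinate_pair[OF assms, of k]) blast
  then obtain p q where *: "\<And>k. p k - xs \<in> V" "\<And>k i. 0 \<le> p k $ i" "\<And>k. dot (p k) ss \<le> \<mu>"
    "\<And>k. q k - ss \<in> W" "\<And>k i. 0 \<le> q k $ i" "\<And>k. dot (q k) xs \<le> \<mu>" "\<And>k. \<mu> \<le> p k $ k * q k $ k"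
    by metis
  define N where "N = (of_nat CARD('k) :: 'a)"
  have N: "N > 0" by (simp add: N_def)
  define P where "P = (\<Sum>k\<in>UNIV. p k)"
  define R where "R = (\<Sum>k\<in>UNIV. q k)"
  have PV: "P - N *s xs \<in> V"
  proof -
    have "P - N *s xs = (\<Sum>k\<in>UNIV. p k - xs)"
      unfolding vec_eq_iff sum_component P_def vector_minus_component vector_smult_component
      by (simp add: sum_subtractf N_def)
    then show ?thesis using * subspace_V by (simp add: vec.subspace_sum)
  qed
  have RW: "R - N *s ss \<in> W"
  proof -
    have "R - N *s ss = (\<Sum>k\<in>UNIV. q k - ss)"
      unfolding vec_eq_iff sum_component R_def vector_minus_component vector_smult_component
      by (simp add: sum_subtractf N_def)
    then show ?thesis using * subspace_W by (simp add: vec.subspace_sum)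
  qed
  have Pge: "p k $ k \<le> P $ k" and Rge: "q k $ k \<le> R $ k" for k
    unfolding P_def R_def sum_component using * by (auto intro: member_le_sum)
  have P0: "0 \<le> P $ k" and R0: "0 \<le> R $ k" for k
    using Pge[of k] Rge[of k] *(2)[of k k] *(5)[of k k] by linarith+
  have PR: "\<mu> \<le> P $ k * R $ k" for k
    using *(7)[of k] mult_mono[OF Pge[of k] Rge[of k]] P0 *(5)[of k k] by (meson order_trans)
  have Ppos: "0 < P $ k" and Rpos: "0 < R $ k" for k
    using PR[of k] P0[of k] R0[of k] assms by (auto simp: less_le)
  have Ps: "dot P ss \<le> N * \<mu>" and Rx: "dot R xs \<le> N * \<mu>"
    unfolding P_def R_def dot_sum_left N_def using * by (auto intro!: sum_bounded_above)
  have "dot (P - N *s xs) (R - N *s ss) = 0" by (rule orth[OF PV RW])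
  then have "dot P R = N * dot P ss + N * dot R xs"
    using compl by (simp add: dot_simps dot_commute[of xs R] algebra_simps)
  also have "\<dots> \<le> N * (N * \<mu>) + N * (N * \<mu>)"
    using Ps Rx N by (intro add_mono mult_left_mono) auto
  finally have PR_le: "P $ k * R $ k \<le> N ^ 2 * (2 * \<mu>)" for k
    using dot_component_le[of P R k] P0 R0 by (simp add: power2_eq_square algebra_simps)
  let ?c = "inverse N"
  have cN: "?c * N = 1" "0 < ?c" using N by auto
  show ?thesis
  proof (rule that[of "?c *s P" "?c *s R"])
    have "?c *s (P - N *s xs) \<in> V" "?c *s (R - N *s ss) \<in> W"
      using PV RW vec.subspace_scale[OF subspace_V] vec.subspace_scale[OF subspace_W] by blast+
    then show "?c *s P - xs \<in> V" "?c *s R - ss \<in> W"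
      using cN by (simp_all add: vector_ssub_ldistrib vector_smult_assoc)
    show "0 < (?c *s P) $ i" "0 < (?c *s R) $ i" for i using cN Ppos Rpos by simp_all
    have eq: "N ^ 2 * ((?c *s P) $ i * (?c *s R) $ i) = P $ i * R $ i" for i
      using N by (simp add: power2_eq_square field_simps)
    show "\<mu> \<le> of_nat CARD('k) ^ 2 * ((?c *s P) $ i * (?c *s R) $ i)" for i
      using PR[of i] unfolding eq[symmetric, of i] by (simp only: N_def)
    show "(?c *s P) $ i * (?c *s R) $ i \<le> 2 * \<mu>" for i
      using PR_le[of i] N unfolding eq[symmetric] by (simp add: mult_le_cancel_left_pos)
  qed
qed

end

section \<open>The valuation on Puiseux series\<close>

lemma val_le_iff: "val f \<le> ereal b \<longleftrightarrow> (\<forall>\<alpha>>b. coeff f \<alpha> = 0)"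
proof (cases "f = 0")
  case False
  then show ?thesis
    using coeff_lead_exp[OF False] lead_exp_max[OF False]
    by (auto simp: val_def not_le[symmetric]) (metis order_trans)
qed (simp add: val_def)

lemma val_zero [simp]: "val 0 = -\<infinity>"
  by (simp add: val_def)

lemma val_eq_MInf_iff [simp]: "val f = -\<infinity> \<longleftrightarrow> f = 0"
  by (simp add: val_def)

lemma val_not_PInf [simp]: "val f \<noteq> \<infinity>" "val f < \<infinity>"
  by (simp_all add: val_def)

lemma val_eqI: "coeff f e \<noteq> 0 \<Longrightarrow> (\<And>\<alpha>. coeff f \<alpha> \<noteq> 0 \<Longrightarrow> \<alpha> \<le> e) \<Longrightarrow> val f = ereal e"
  using lead_exp_eq[of f e] by (auto simp: val_def)

lemma val_one [simp]: "val 1 = 0"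
  unfolding zero_ereal_def by (rule val_eqI) (auto split: if_splits)

lemma val_uminus [simp]: "val (- f) = val f"
  by (simp add: val_def)

lemma val_times: "val (f * g) = val f + val g"
proof (cases "f = 0 \<or> g = 0")
  case False
  then have f: "f \<noteq> 0" and g: "g \<noteq> 0" by auto
  let ?a = "lead_exp f" and ?b = "lead_exp g"
  have "{\<alpha>. coeff f \<alpha> \<noteq> 0 \<and> coeff g (?a + ?b - \<alpha>) \<noteq> 0} = {?a}"
    using lead_exp_max[OF f] lead_exp_max[OF g] coeff_lead_exp[OF f] coeff_lead_exp[OF g]
    by (fastforce simp: algebra_simps)
  then have "coeff (f * g) (?a + ?b) = coeff f ?a * coeff g ?b"
    by (simp add: coeff_times conv_def)
  moreover have "\<gamma> \<le> ?a + ?b" if "coeff (f * g) \<gamma> \<noteq> 0" for \<gamma>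
    using that lead_exp_max[OF f] lead_exp_max[OF g] by (elim coeff_times_nonzero) force
  ultimately have "val (f * g) = ereal (?a + ?b)"
    using coeff_lead_exp[OF f] coeff_lead_exp[OF g] by (intro val_eqI) auto
  then show ?thesis using f g by (simp add: val_def)
qed auto

lemma val_add_le: "val f \<le> c \<Longrightarrow> val g \<le> c \<Longrightarrow> val (f + g) \<le> c"
  by (cases c) (auto simp: val_le_iff)

lemma val_diff_le: "val f \<le> c \<Longrightarrow> val g \<le> c \<Longrightarrow> val (f - g) \<le> c"
  using val_add_le[of f c "- g"] by simp

lemma val_sum_le: "(\<And>i. i \<in> S \<Longrightarrow> val (f i) \<le> c) \<Longrightarrow> val (\<Sum>i\<in>S. f i) \<le> c"
  by (induction S rule: infinite_finite_induct) (auto intro: val_add_le)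

lemma val_times_le: "val f \<le> a \<Longrightarrow> val g \<le> b \<Longrightarrow> val (f * g) \<le> a + b"
  unfolding val_times by (rule add_mono)

text \<open>If \<open>val f\<close> exceeded \<open>val g\<close>, then \<open>f - g\<close> would
  have the leading term of \<open>f\<close> and be positive. This is the source of all
  no-cancellation arguments below.\<close>

lemma val_mono:
  assumes "0 \<le> f" "f \<le> g"
  shows "val f \<le> val g"
proof (rule ccontr)
  assume *: "\<not> val f \<le> val g"
  then have f: "f \<noteq> 0" by auto
  then have fpos: "is_pos f" using assms(1) by (auto simp: less_eq_puiseux_def less_puiseux_def)
  have g0: "coeff g \<alpha> = 0" if "lead_exp f \<le> \<alpha>" for \<alpha>
    using * f lead_exp_max[of g \<alpha>] that by (cases "g = 0") (auto simp: val_def)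
  have "lead_exp (f - g) = lead_exp f"
  proof (rule lead_exp_eq)
    show "coeff (f - g) (lead_exp f) \<noteq> 0" using g0 coeff_lead_exp[OF f] by simp
    show "\<alpha> \<le> lead_exp f" if "coeff (f - g) \<alpha> \<noteq> 0" for \<alpha>
      using that g0[of \<alpha>] lead_exp_max[OF f, of \<alpha>] by force
  qed
  then have "is_pos (f - g)"
    using g0 fpos unfolding is_pos_def by auto
  then have "g < f" by (simp add: less_puiseux_def)
  then show False using assms(2) by simp
qed

text \<open>On the valuation ring \<open>val f\<close> \<le> 0 the coefficient at exponent 0 is the
  residue map; it is multiplicative because only the exponent pair (0, 0) contributes.\<close>

lemma coeff_zero_times:
  assumes "val f \<le> 0" "val g \<le> 0"
  shows "coeff (f * g) 0 = coeff f 0 * coeff g 0"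
proof -
  have "coeff f \<alpha> = 0" "coeff g \<alpha> = 0" if "\<alpha> > 0" for \<alpha>
    using assms that by (simp_all add: val_le_iff zero_ereal_def)
  then have "{\<alpha>. coeff f \<alpha> \<noteq> 0 \<and> coeff g (0 - \<alpha>) \<noteq> 0} \<subseteq> {0}"
    by (auto simp: not_less[symmetric]) (metis neg_0_less_iff_less linorder_neqE)
  then have "coeff (f * g) 0 = (\<Sum>\<alpha>\<in>{0}. coeff f \<alpha> * coeff g (0 - \<alpha>))"
    unfolding coeff_times conv_def by (intro sum.mono_neutral_left) auto
  then show ?thesis by simp
qed

lemma coeff_sum: "coeff (\<Sum>i\<in>S. f i) \<alpha> = (\<Sum>i\<in>S. coeff (f i) \<alpha>)"
  by (induction S rule: infinite_finite_induct) auto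

lemma puiseux_pos_residue:
  assumes "val f \<le> 0" "0 < coeff f 0"
  shows "0 < f"
proof -
  have "lead_exp f = 0"
    using assms not_le by (intro lead_exp_eq) (auto simp: val_le_iff zero_ereal_def)
  then show ?thesis using assms(2) by (auto simp: less_puiseux_def is_pos_def)
qed

lemma residue_nonneg:
  assumes "val f \<le> 0" "0 \<le> f"
  shows "0 \<le> coeff f 0"
  using puiseux_pos_residue[of "- f"] assms by force

lemma val_neg_residue: "val f \<le> 0 \<Longrightarrow> coeff f 0 = 0 \<Longrightarrow> val f < 0"
  using coeff_lead_exp[of f] by (auto simp: val_def zero_ereal_def less_le)

lemma val_monom: "c \<noteq> 0 \<Longrightarrow> val (puiseux_monom c e) = ereal e"
  by (rule val_eqI) (auto simp: puiseux_monom.rep_eq split: if_splits)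

lemma monom_pos: "0 < c \<Longrightarrow> 0 < puiseux_monom c e"
  using lead_exp_eq[of "puiseux_monom c e" e]
  by (auto simp: less_puiseux_def is_pos_def puiseux_monom.rep_eq split: if_splits)
    (metis coeff_simps(1) less_irrefl puiseux_monom.rep_eq)

section \<open>Hensel's lemma for quadratic systems\<close>

text \<open>A weighted l1 norm, subadditive and submultiplicative. Bounding it at a fixed
  \<open>t\<close> along the whole iteration is what makes the formal limit an absolutely convergent
  series.\<close>

definition majorant :: "real \<Rightarrow> puiseux \<Rightarrow> real" where
  "majorant t f = (\<Sum>\<^sub>\<infinity>\<alpha>. \<bar>coeff f \<alpha>\<bar> * t powr \<alpha>)"

lemma majorant_nonneg: "0 \<le> majorant t f"
  by (simp add: majorant_def infsum_nonneg)

lemma majorant_zero [simp]: "majorant t 0 = 0"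
  by (simp add: majorant_def)

lemma majorant_uminus [simp]: "majorant t (- f) = majorant t f"
  by (simp add: majorant_def)

lemma converges_at_uminus [simp]: "converges_at (- f) t \<longleftrightarrow> converges_at f t"
  by (simp add: converges_at_abs)

lemma converges_at_zero [simp]: "converges_at 0 t"
  by (simp add: converges_at_abs)

lemma majorant_add:
  assumes "converges_at f t" "converges_at g t"
  shows "converges_at (f + g) t" "majorant t (f + g) \<le> majorant t f + majorant t g"
proof -
  have s: "(\<lambda>\<alpha>. \<bar>coeff f \<alpha>\<bar> * t powr \<alpha> + \<bar>coeff g \<alpha>\<bar> * t powr \<alpha>) summable_on UNIV"
    using assms unfolding converges_at_abs by (rule summable_on_add)
  have le: "\<bar>coeff (f + g) \<alpha>\<bar> * t powr \<alpha> \<le> \<bar>coeff f \<alpha>\<bar> * t powr \<alpha> + \<bar>coeff g \<alpha>\<bar> * t powr \<alpha>" for \<alpha>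
    by (simp flip: distrib_right add: mult_right_mono)
  show 1: "converges_at (f + g) t"
    unfolding converges_at_def
    by (rule Infinite_Sum.abs_summable_on_comparison_test'[OF s]) (use le in \<open>simp add: abs_mult\<close>)
  have "majorant t (f + g) \<le> (\<Sum>\<^sub>\<infinity>\<alpha>. \<bar>coeff f \<alpha>\<bar> * t powr \<alpha> + \<bar>coeff g \<alpha>\<bar> * t powr \<alpha>)"
    unfolding majorant_def using 1[unfolded converges_at_abs] s le by (rule infsum_mono)
  also have "\<dots> = majorant t f + majorant t g"
    unfolding majorant_def using assms[unfolded converges_at_abs] by (rule infsum_add)
  finally show "majorant t (f + g) \<le> majorant t f + majorant t g" .
qed

lemma majorant_sum:
  assumes "\<And>i. i \<in> S \<Longrightarrow> converges_at (f i) t"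
  shows "converges_at (\<Sum>i\<in>S. f i) t \<and> majorant t (\<Sum>i\<in>S. f i) \<le> (\<Sum>i\<in>S. majorant t (f i))"
  using assms
proof (induction S rule: infinite_finite_induct)
  case (insert i S)
  then show ?case
    using majorant_add[of "f i" t "\<Sum>i\<in>S. f i"] by fastforce
qed auto

lemma majorant_times:
  "converges_at f t \<Longrightarrow> converges_at g t \<Longrightarrow> t > 0 \<Longrightarrow> majorant t (f * g) \<le> majorant t f * majorant t g"
  unfolding majorant_def by (rule infsum_abs_le_times)

lemma eventually_majorant_small:
  assumes "val f < 0" "\<delta> > 0"
  shows "\<forall>\<^sub>F t in at_top. majorant t f < \<delta>"
proof -
  obtain e where e: "e > 0" "val f \<le> ereal (- e)"
  proof (cases "f = 0")
    case True
    then show ?thesis using that[of 1] by simp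
  next
    case False
    then show ?thesis using that[of "- lead_exp f"] assms(1) by (simp add: val_def zero_ereal_def)
  qed
  let ?h = "f * puiseux_monom (1 / \<delta>) 0"
  have h: "coeff ?h \<alpha> = coeff f \<alpha> / \<delta>" for \<alpha> by (simp add: coeff_times_monom)
  have "\<forall>\<^sub>F t in at_top. (\<Sum>\<^sub>\<infinity>\<alpha>. \<bar>coeff ?h \<alpha>\<bar> * t powr \<alpha>) < 1"
  proof (rule eventually_small[OF e(1)])
    show "\<alpha> \<le> - e" if "coeff ?h \<alpha> \<noteq> 0" for \<alpha>
      using that e(2) unfolding h val_le_iff by (metis div_0 not_le)
  qed
  moreover have "(\<Sum>\<^sub>\<infinity>\<alpha>. \<bar>coeff ?h \<alpha>\<bar> * t powr \<alpha>) = majorant t f / \<delta>" for t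
  proof -
    have "\<bar>coeff ?h \<alpha>\<bar> * t powr \<alpha> = (\<bar>coeff f \<alpha>\<bar> * t powr \<alpha>) * (1 / \<delta>)" for \<alpha>
      using assms(2) by (simp add: h)
    then show ?thesis by (simp only: infsum_cmult_left' majorant_def) simp
  qed
  ultimately show ?thesis using assms(2) by (simp only: divide_less_eq_1_pos)
qed

text \<open>The constant term contributes at most its absolute value, whatever \<open>t\<close> is,
  and the rest has negative valuation, so its majorant drops below 1.\<close>

lemma eventually_majorant_bounded:
  assumes "val f \<le> 0"
  obtains C where "\<forall>\<^sub>F t in at_top. majorant t f < C"
proof -
  let ?c = "puiseux_monom (coeff f 0) 0"
  have "majorant t ?c \<le> \<bar>coeff f 0\<bar>" if "t > 0" for t
  proof -
    have "(\<lambda>\<alpha>. \<bar>coeff ?c \<alpha>\<bar> * t powr \<alpha>) = (\<lambda>\<alpha>. if \<alpha> = 0 then \<bar>coeff f 0\<bar> * t powr \<alpha> else 0)"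
      by (auto simp: puiseux_monom.rep_eq)
    then show ?thesis
      using infsumI[OF has_sum_single[of 0 "\<lambda>\<alpha>. \<bar>coeff f 0\<bar> * t powr \<alpha>"]] that
      by (simp add: majorant_def)
  qed
  moreover have "val (f - ?c) < 0"
  proof (rule val_neg_residue)
    show "val (f - ?c) \<le> 0"
      using assms by (intro val_diff_le) (auto simp: val_le_iff zero_ereal_def puiseux_monom.rep_eq)
  qed (simp add: puiseux_monom.rep_eq)
  then have "\<forall>\<^sub>F t in at_top. majorant t (f - ?c) < 1" by (rule eventually_majorant_small) simp
  then have "\<forall>\<^sub>F t in at_top. majorant t f < \<bar>coeff f 0\<bar> + 1"
    using eventually_converges[of "f - ?c"] eventually_converges[of ?c] eventually_gt_at_top[of 0]
  proof eventually_elim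
    case (elim t)
    then show ?case using majorant_add(2)[of "f - ?c" t ?c] calculation[of t] by simp
  qed
  then show ?thesis by (rule that)
qed

text \<open>Each coefficient becomes stationary, so the limit exists formally with finite support
  above every level. It converges because the majorant bound holds for all iterates at the same
  \<open>t\<close>.\<close>

lemma puiseux_limit:
  fixes r :: "nat \<Rightarrow> puiseux"
  assumes e: "e > 0" and step: "\<And>n. val (r (Suc n) - r n) \<le> ereal (- (real (Suc n) * e))"
    and conv: "\<forall>\<^sub>F t in at_top. \<forall>n. converges_at (r n) t \<and> majorant t (r n) \<le> 1"
  obtains R where "\<And>n. val (R - r n) \<le> ereal (- (real (Suc n) * e))"
proof -
  have stable: "coeff (r m) \<alpha> = coeff (r n) \<alpha>" if "n \<le> m" "- (real (Suc n) * e) < \<alpha>" for m n \<alpha>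
    using that(1)
  proof (induction m rule: dec_induct)
    case (step m)
    have "real (Suc n) * e \<le> real (Suc m) * e" using step(1) e by (intro mult_right_mono) auto
    then have "coeff (r (Suc m) - r m) \<alpha> = 0"
      using assms(2)[of m] that(2) unfolding val_le_iff by (metis le_less_trans neg_le_iff_le)
    then show ?case using step.IH by simp
  qed simp
  \<comment> \<open>From index \<open>K\<close> \<alpha> on, the coefficient at \<alpha> no longer
    changes. The \<open>Suc\<close> in the step bound provides the strict inequality needed
    here.\<close>
  define K where "K \<alpha> = nat \<lceil>- \<alpha> / e\<rceil>" for \<alpha>
  have K: "- (real (Suc n) * e) < \<alpha>" if "K \<alpha> \<le> n" for \<alpha> n
  proof -
    have "- \<alpha> / e \<le> real n" using that unfolding K_def by linarith
    then have "- \<alpha> \<le> real n * e" using e by (simp add: field_simps)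
    then show ?thesis using e by (simp add: algebra_simps)
  qed
  define L where "L \<alpha> = coeff (r (K \<alpha>)) \<alpha>" for \<alpha>
  have L: "L \<alpha> = coeff (r n) \<alpha>" if "- (real (Suc n) * e) < \<alpha>" for n \<alpha>
    unfolding L_def using stable[of n "K \<alpha>" \<alpha>] stable[of "K \<alpha>" n \<alpha>] K that by (metis le_refl linear)
  have "is_puiseux L"
  proof (rule is_puiseuxI)
    fix x :: real
    have "L \<alpha> = coeff (r (K x)) \<alpha>" if "x \<le> \<alpha>" for \<alpha>
      using L[of "K x" \<alpha>] K[of x "K x"] that by simp
    then have "{\<alpha>. L \<alpha> \<noteq> 0 \<and> x \<le> \<alpha>} \<subseteq> {\<alpha>. coeff (r (K x)) \<alpha> \<noteq> 0 \<and> x \<le> \<alpha>}" by auto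
    then show "finite {\<alpha>. L \<alpha> \<noteq> 0 \<and> x \<le> \<alpha>}"
      using finite_support_above finite_subset by blast
  next
    show "\<forall>\<^sub>F t in at_top. (\<lambda>\<alpha>. norm (L \<alpha> * t powr \<alpha>)) summable_on UNIV"
      using conv
    proof eventually_elim
      case (elim t)
      show ?case
      proof (rule nonneg_bdd_above_summable_on)
        show "bdd_above (sum (\<lambda>\<alpha>. norm (L \<alpha> * t powr \<alpha>)) ` {F. F \<subseteq> UNIV \<and> finite F})"
        proof (rule bdd_aboveI2[where M = 1])
          fix F assume "F \<in> {F. F \<subseteq> (UNIV :: real set) \<and> finite F}"
          then have F: "finite F" by simp
          \<comment> \<open>A finite partial sum involves finitely many exponents, so a single
            iterate already carries all its coefficients.\<close>
          obtain n where n: "\<And>\<alpha>. \<alpha> \<in> F \<Longrightarrow> K \<alpha> \<le> n"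
            using F finite_nat_set_iff_bounded_le[of "K ` F"] by auto
          have "(\<Sum>\<alpha>\<in>F. norm (L \<alpha> * t powr \<alpha>)) = (\<Sum>\<alpha>\<in>F. \<bar>coeff (r n) \<alpha>\<bar> * t powr \<alpha>)"
            using L[OF K[OF n]] by (intro sum.cong) (auto simp: abs_mult)
          also have "\<dots> \<le> majorant t (r n)"
            unfolding majorant_def
            using elim F by (intro finite_sum_le_infsum) (auto simp: converges_at_abs)
          also have "\<dots> \<le> 1" using elim by blast
          finally show "(\<Sum>\<alpha>\<in>F. norm (L \<alpha> * t powr \<alpha>)) \<le> 1" .
        qed
      qed auto
    qed
  qed
  then have "coeff (Abs_puiseux L) = L" by (simp add: Abs_puiseux_inverse)
  then have "val (Abs_puiseux L - r n) \<le> ereal (- (real (Suc n) * e))" for n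
    using L by (simp add: val_le_iff)
  then show ?thesis by (rule that)
qed

text \<open>The map sending \<open>r\<close> to \<epsilon> - Q(r) contracts for the valuation: with
  all entries of valuation at most -e, each iteration gains another e. The map is polynomial, so the
  same iteration can be run on majorants at a fixed large \<open>t\<close>, where a small ball is
  invariant.\<close>

lemma quadratic_hensel:
  fixes q :: "'k::finite \<Rightarrow> 'k \<Rightarrow> 'k \<Rightarrow> puiseux" and \<epsilon> :: "'k \<Rightarrow> puiseux"
  assumes q: "\<And>i j k. val (q i j k) \<le> 0" and \<epsilon>: "\<And>i. val (\<epsilon> i) < 0"
  obtains r where "\<And>i. val (r i) < 0" "\<And>i. r i + (\<Sum>j\<in>UNIV. \<Sum>k\<in>UNIV. q i j k * r j * r k) = \<epsilon> i"
proof -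
  define Q where "Q r i = (\<Sum>j\<in>UNIV. \<Sum>k\<in>UNIV. q i j k * r j * r k)" for r i
  define m where "m = Max (range (\<lambda>i. val (\<epsilon> i)))"
  have "m \<in> range (\<lambda>i. val (\<epsilon> i))" unfolding m_def by (rule Max_in) auto
  then have "m < 0" using \<epsilon> by auto
  then obtain z where z: "m < z" "z < 0" using dense by blast
  then obtain e where e: "z = ereal (- e)" "e > 0"
    by (cases z) (auto intro: that[of "- _"])
  have "val (\<epsilon> i) \<le> m" for i unfolding m_def by simp
  then have \<epsilon>e: "val (\<epsilon> i) \<le> ereal (- e)" for i using z e by (meson le_less_trans less_imp_le)
  define r where "r = rec_nat (\<lambda>i. 0) (\<lambda>_ r i. \<epsilon> i - Q r i)"
  have r0: "r 0 = (\<lambda>i. 0)" and rS: "r (Suc n) i = \<epsilon> i - Q (r n) i" for n i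
    by (simp_all add: r_def)
  \<comment> \<open>A difference of quadratic terms splits into products of one difference and one
    entry of valuation at most -e.\<close>
  have Qle: "val (Q u i - Q v i) \<le> ereal (b - e)"
    if "\<And>i. val (u i) \<le> ereal (- e)" "\<And>i. val (v i) \<le> ereal (- e)" "\<And>i. val (u i - v i) \<le> ereal b" for u v b i
  proof -
    have "Q u i - Q v i = (\<Sum>j\<in>UNIV. \<Sum>k\<in>UNIV. q i j k * ((u j - v j) * u k + v j * (u k - v k)))"
      unfolding Q_def by (simp flip: sum_subtractf add: algebra_simps)
    also have "val \<dots> \<le> 0 + ereal (b - e)"
    proof (intro val_sum_le val_times_le q val_add_le)
      show "val ((u j - v j) * u k) \<le> ereal (b - e)" for j k
        using val_times_le[OF that(3)[of j] that(1)[of k]] by simp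
      show "val (v j * (u k - v k)) \<le> ereal (b - e)" for j k
        using val_times_le[OF that(2)[of j] that(3)[of k]] by simp
    qed
    finally show ?thesis by simp
  qed
  have Q0: "Q (\<lambda>i. 0) i = 0" for i by (simp add: Q_def)
  have rle: "val (r n i) \<le> ereal (- e)" for n i
  proof (induction n arbitrary: i)
    case (Suc n)
    have "val (Q (r n) i) \<le> ereal (- e)"
      using Qle[of "r n" "\<lambda>i. 0" "- e" i] Suc e Q0 by (auto intro: order_trans)
    then show ?case unfolding rS using \<epsilon>e by (rule val_diff_le[rotated])
  qed (simp add: r0)
  have step: "val (r (Suc n) i - r n i) \<le> ereal (- (real (Suc n) * e))" for n i
  proof (induction n arbitrary: i)
    case 0
    then show ?case by (simp add: rS r0 Q0 \<epsilon>e)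
  next
    case (Suc n)
    have "r (Suc (Suc n)) i - r (Suc n) i = - (Q (r (Suc n)) i - Q (r n) i)" by (simp add: rS)
    also have "val \<dots> = val (Q (r (Suc n)) i - Q (r n) i)" by (rule val_uminus)
    also have "\<dots> \<le> ereal (- (real (Suc n) * e) - e)" by (intro Qle rle Suc)
    finally show ?case by (simp add: algebra_simps)
  qed
  have bound: "\<forall>\<^sub>F t in at_top. \<forall>i n. converges_at (r n i) t \<and> majorant t (r n i) \<le> 1"
  proof -
    have "\<exists>C. \<forall>\<^sub>F t in at_top. majorant t (q i j k) < C" for i j k
      by (rule eventually_majorant_bounded[OF q[of i j k]]) blast
    then obtain C where C: "\<And>i j k. \<forall>\<^sub>F t in at_top. majorant t (q i j k) < C i j k" by metis
    define B where "B = (\<Sum>i\<in>UNIV. \<Sum>j\<in>UNIV. \<Sum>k\<in>UNIV. \<bar>C i j k\<bar>)"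
    have B: "B \<ge> 0" unfolding B_def by (intro sum_nonneg) auto
    \<comment> \<open>Chosen so that the total majorant \<open>E\<close> of the right-hand side is
      at most 1/(4(B + 1)). Then E + B (2E)^2 \<le> 2E, so the ball of radius 2E is invariant, and
      2E \<le> 1 as \<open>puiseux_limit\<close> requires.\<close>
    define \<delta> where "\<delta> = 1 / (4 * (B + 1) * real CARD('k))"
    have \<delta>: "\<delta> > 0" using B by (simp add: \<delta>_def)
    have "\<forall>\<^sub>F t in at_top. t > 0 \<and> (\<forall>i. converges_at (\<epsilon> i) t) \<and> (\<forall>i j k. converges_at (q i j k) t) \<and>
        (\<forall>i. majorant t (\<epsilon> i) < \<delta>) \<and> (\<forall>i j k. majorant t (q i j k) < C i j k)"
      by (intro eventually_conj eventually_all_finite eventually_converges C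
          eventually_majorant_small \<epsilon> \<delta> eventually_gt_at_top)
    then show ?thesis
    proof eventually_elim
      case (elim t)
      define E where "E = (\<Sum>i\<in>UNIV. majorant t (\<epsilon> i))"
      have E0: "E \<ge> 0" unfolding E_def by (intro sum_nonneg majorant_nonneg)
      have "E \<le> real CARD('k) * \<delta>" unfolding E_def using elim by (intro sum_bounded_above) (auto intro: less_imp_le)
      also have "\<dots> = 1 / (4 * (B + 1))" by (simp add: \<delta>_def)
      finally have E: "E \<le> 1 / (4 * (B + 1))" .
      then have E1: "4 * (B + 1) * E \<le> 1" using B by (simp add: field_simps)
      have "B * (2 * E)\<^sup>2 = (4 * B * E) * E" by (simp add: power2_eq_square)
      also have "\<dots> \<le> 1 * E" using E1 E0 by (intro mult_right_mono) (auto simp: algebra_simps)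
      finally have BE: "B * (2 * E)\<^sup>2 \<le> E" by simp
      have main: "(\<forall>i. converges_at (r n i) t) \<and> (\<Sum>i\<in>UNIV. majorant t (r n i)) \<le> 2 * E" for n
      proof (induction n)
        case 0
        then show ?case using E0 by (simp add: r0)
      next
        case (Suc n)
        define T where "T = (\<Sum>i\<in>UNIV. majorant t (r n i))"
        have T: "T \<le> 2 * E" "0 \<le> T" using Suc unfolding T_def by (auto intro: sum_nonneg majorant_nonneg)
        have rT: "majorant t (r n i) \<le> T" for i
          unfolding T_def by (rule member_le_sum) (auto intro: majorant_nonneg)
        have term_conv: "converges_at (q i j k * r n j * r n k) t" for i j k
          using Suc elim by (intro converges_at_times) auto
        have inner: "converges_at (\<Sum>k\<in>UNIV. q i j k * r n j * r n k) t" for i j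
          by (intro majorant_sum[THEN conjunct1] term_conv)
        have Qc: "converges_at (Q (r n) i) t" for i
          unfolding Q_def by (intro majorant_sum[THEN conjunct1] inner)
        have tm: "majorant t (q i j k * r n j * r n k) \<le> \<bar>C i j k\<bar> * T\<^sup>2" for i j k
        proof -
          have qC: "majorant t (q i j k) \<le> \<bar>C i j k\<bar>"
            using elim by (meson abs_ge_self less_imp_le order_trans)
          have "majorant t (q i j k * r n j * r n k) \<le> majorant t (q i j k * r n j) * majorant t (r n k)"
            using Suc elim by (intro majorant_times converges_at_times) auto
          also have "\<dots> \<le> (majorant t (q i j k) * majorant t (r n j)) * majorant t (r n k)"
            using Suc elim by (intro mult_right_mono majorant_times majorant_nonneg) auto
          also have "\<dots> \<le> (\<bar>C i j k\<bar> * T) * T"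
            using qC rT by (intro mult_mono majorant_nonneg mult_nonneg_nonneg T) auto
          finally show ?thesis by (simp add: power2_eq_square mult.assoc)
        qed
        have Qm: "majorant t (Q (r n) i) \<le> (\<Sum>j\<in>UNIV. \<Sum>k\<in>UNIV. \<bar>C i j k\<bar> * T\<^sup>2)" for i
        proof -
          have "majorant t (Q (r n) i) \<le> (\<Sum>j\<in>UNIV. majorant t (\<Sum>k\<in>UNIV. q i j k * r n j * r n k))"
            unfolding Q_def by (intro majorant_sum[THEN conjunct2] inner)
          also have "\<dots> \<le> (\<Sum>j\<in>UNIV. \<Sum>k\<in>UNIV. majorant t (q i j k * r n j * r n k))"
            by (intro sum_mono majorant_sum[THEN conjunct2] term_conv)
          also have "\<dots> \<le> (\<Sum>j\<in>UNIV. \<Sum>k\<in>UNIV. \<bar>C i j k\<bar> * T\<^sup>2)"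
            by (intro sum_mono tm)
          finally show ?thesis .
        qed
        have "majorant t (r (Suc n) i) \<le> majorant t (\<epsilon> i) + majorant t (Q (r n) i)" for i
          using majorant_add(2)[of "\<epsilon> i" t "- Q (r n) i"] elim Qc by (simp add: rS)
        then have "(\<Sum>i\<in>UNIV. majorant t (r (Suc n) i)) \<le>
            (\<Sum>i\<in>UNIV. majorant t (\<epsilon> i) + (\<Sum>j\<in>UNIV. \<Sum>k\<in>UNIV. \<bar>C i j k\<bar> * T\<^sup>2))"
          using Qm by (intro sum_mono) (meson add_left_mono order_trans)
        also have "\<dots> = E + B * T\<^sup>2"
          by (simp add: sum.distrib E_def B_def sum_distrib_right)
        also have "\<dots> \<le> E + B * (2 * E)\<^sup>2"
          using T B by (intro add_left_mono mult_left_mono power_mono) auto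
        also have "\<dots> \<le> 2 * E" using BE by simp
        finally have "(\<Sum>i\<in>UNIV. majorant t (r (Suc n) i)) \<le> 2 * E" .
        moreover have "converges_at (r (Suc n) i) t" for i
          using majorant_add(1)[of "\<epsilon> i" t "- Q (r n) i"] elim Qc by (simp add: rS)
        ultimately show ?case by blast
      qed
      have "4 * (B + 1) * E = 4 * (B * E) + 4 * E" by (simp add: algebra_simps)
      then have "2 * E \<le> 1" using E1 E0 mult_nonneg_nonneg[OF B E0] by linarith
      moreover have "majorant t (r n i) \<le> (\<Sum>i\<in>UNIV. majorant t (r n i))" for n i
        by (rule member_le_sum) (auto intro: majorant_nonneg)
      ultimately show ?case using main by (meson order_trans)
    qed
  qed
  have "\<exists>R. \<forall>n. val (R - r n i) \<le> ereal (- (real (Suc n) * e))" for i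
  proof -
    have "\<forall>\<^sub>F t in at_top. \<forall>n. converges_at (r n i) t \<and> majorant t (r n i) \<le> 1"
      using bound by eventually_elim blast
    then show ?thesis
      by (rule puiseux_limit[where r = "\<lambda>n. r n i", OF e(2) step]) blast
  qed
  then obtain R where R: "\<And>i n. val (R i - r n i) \<le> ereal (- (real (Suc n) * e))" by metis
  have Rle: "val (R i) \<le> ereal (- e)" for i
    using R[of i 0] by (simp add: r0)
  have "R i + Q R i = \<epsilon> i" for i
  proof -
    define D where "D = R i + Q R i - \<epsilon> i"
    have D: "val D \<le> ereal (- (real (Suc n) * e))" for n
    proof -
      have "D = (R i - r (Suc n) i) + (Q R i - Q (r n) i)" by (simp add: D_def rS)
      also have "val \<dots> \<le> ereal (- (real (Suc n) * e))"
      proof (rule val_add_le)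
        show "val (R i - r (Suc n) i) \<le> ereal (- (real (Suc n) * e))"
          using R[of i "Suc n"] e by (auto intro: order_trans simp: algebra_simps)
        show "val (Q R i - Q (r n) i) \<le> ereal (- (real (Suc n) * e))"
          using Qle[of R "r n" "- (real (Suc n) * e)" i] Rle rle R e(2)
          by (auto intro: order_trans)
      qed
      finally show ?thesis .
    qed
    have "coeff D \<alpha> = 0" for \<alpha>
    proof -
      obtain n where "- \<alpha> / e < real n" using reals_Archimedean2 by blast
      then have "- (real (Suc n) * e) < \<alpha>" using e(2) by (simp add: field_simps)
      then show ?thesis using D[of n] by (simp add: val_le_iff)
    qed
    then have "D = 0" by (intro puiseux_eqI) simp
    then show ?thesis by (simp add: D_def)
  qed
  moreover have "val (R i) < 0" for i
    using Rle[of i] e(2) by (auto intro: le_less_trans simp: zero_ereal_def)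
  ultimately show ?thesis using that[of R] by (simp add: Q_def)
qed

section \<open>A real barrier problem\<close>

text \<open>\<open>1 + u\<close> is the minimizer of the weighted barrier \<open>\<Sum>k. w\<^sub>k y\<^sub>k - ln y\<^sub>k\<close> over the positive part of \<open>1 + E\<close>.\<close>

lemma weighted_barrier_critical_point:
  fixes E :: "(real ^ 'k::finite) set" and w :: "real ^ 'k"
  assumes E: "subspace E" and w: "\<And>k. 0 < w $ k"
  obtains u where "u \<in> E" "\<And>k. 0 < 1 + u $ k"
    "\<And>d. d \<in> E \<Longrightarrow> (\<Sum>k\<in>UNIV. (w $ k - 1 / (1 + u $ k)) * d $ k) = 0"
proof -
  define g where "g k y = w $ k * y - ln y" for k y
  define F where "F y = (\<Sum>k\<in>UNIV. g k (y $ k))" for y :: "real ^ 'k"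
  \<comment> \<open>Every summand is at least 1 + ln of its weight, so \<open>F y\<close> \<le>
    \<open>F 1\<close> bounds each single summand by \<open>B\<close>. Dropping the linear term then
    yields \<open>lo\<close>; applying ln x \<le> x - 1 to half of the linear term yields
    \<open>hi\<close>.\<close>
  define B where "B = F 1 + (\<Sum>k\<in>UNIV. \<bar>1 + ln (w $ k)\<bar>)"
  define lo :: "real ^ 'k" where "lo = (\<chi> k. exp (- B))"
  define hi :: "real ^ 'k" where "hi = (\<chi> k. 2 * (B - 1 - ln (w $ k / 2)) / w $ k)"
  define C where "C = (\<lambda>x. 1 + x) ` E \<inter> cbox lo hi"
  have low: "1 + ln (w $ k) \<le> g k y" if "0 < y" for k y
  proof -
    have "ln (w $ k * y) \<le> w $ k * y - 1" using w that by (intro ln_le_minus_one) simp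
    then show ?thesis using w[of k] that by (simp add: g_def ln_mult)
  qed
  have box: "y \<in> cbox lo hi" if y: "\<And>k. 0 < y $ k" and F: "F y \<le> F 1" for y
  proof -
    have "lo $ k \<le> y $ k \<and> y $ k \<le> hi $ k" for k
    proof -
      have "F y = g k (y $ k) + (\<Sum>i\<in>UNIV - {k}. g i (y $ i))"
        unfolding F_def by (subst sum.remove[of UNIV k]) auto
      moreover have "- (\<Sum>i\<in>UNIV. \<bar>1 + ln (w $ i)\<bar>) \<le> (\<Sum>i\<in>UNIV - {k}. g i (y $ i))"
      proof -
        have "(\<Sum>i\<in>UNIV - {k}. - \<bar>1 + ln (w $ i)\<bar>) \<le> (\<Sum>i\<in>UNIV - {k}. g i (y $ i))"
          using low[OF y] by (intro sum_mono) (smt (verit))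
        moreover have "(\<Sum>i\<in>UNIV - {k}. \<bar>1 + ln (w $ i)\<bar>) \<le> (\<Sum>i\<in>UNIV. \<bar>1 + ln (w $ i)\<bar>)"
          by (intro sum_mono2) auto
        ultimately show ?thesis by (simp add: sum_negf)
      qed
      ultimately have gB: "g k (y $ k) \<le> B" using F by (simp add: B_def)
      have "- B \<le> ln (y $ k)" using gB mult_pos_pos[OF w[of k] y[of k]] by (simp add: g_def)
      then have "lo $ k \<le> y $ k" using y[of k] by (simp add: lo_def ln_ge_iff)
      moreover have "ln (w $ k / 2 * y $ k) \<le> w $ k / 2 * y $ k - 1"
        using w y by (intro ln_le_minus_one) simp
      then have "ln (w $ k / 2) + ln (y $ k) \<le> w $ k / 2 * y $ k - 1"
        using w[of k] y[of k] by (subst ln_mult_pos[symmetric]) auto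
      then have "w $ k * y $ k \<le> 2 * (B - 1 - ln (w $ k / 2))"
        using gB by (simp add: g_def)
      then have "y $ k \<le> hi $ k" using w[of k] by (simp add: hi_def field_simps)
      ultimately show ?thesis by blast
    qed
    then show ?thesis by (simp add: mem_box_cart)
  qed
  have lopos: "0 < lo $ k" for k by (simp add: lo_def)
  have Cpos: "0 < y $ k" if "y \<in> C" for y k
    using that lopos[of k] by (auto simp: C_def mem_box_cart intro: less_le_trans)
  have 1: "1 \<in> C"
    using subspace_0[OF E] box[of 1] unfolding C_def by force
  have "compact C"
    unfolding C_def
    using closed_translation[OF closed_subspace[OF E], of 1] by (simp add: compact_cbox closed_Int_compact)
  moreover have "continuous_on C F"
    unfolding F_def g_def using Cpos by (intro continuous_intros) (auto simp: less_le)
  ultimately obtain y where y: "y \<in> C" "\<And>z. z \<in> C \<Longrightarrow> F y \<le> F z"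
    using continuous_attains_inf[of C F] 1 by blast
  have y_min: "F y \<le> F z" if "\<And>k. 0 < z $ k" "z \<in> (\<lambda>x. 1 + x) ` E" for z
  proof (cases "F z \<le> F 1")
    case True
    then show ?thesis using box[OF that(1)] that(2) y(2) by (simp add: C_def)
  next
    case False
    then show ?thesis using y(2)[OF 1] by simp
  qed
  obtain u where u: "u \<in> E" "y = 1 + u" using y(1) by (auto simp: C_def)
  show ?thesis
  proof (rule that[OF u(1)])
    show up: "0 < 1 + u $ k" for k using Cpos[OF y(1), of k] u(2) by simp
    fix d assume d: "d \<in> E"
    define \<phi> where "\<phi> h = F (y + h *\<^sub>R d)" for h
    have der: "(\<phi> has_real_derivative (\<Sum>k\<in>UNIV. (w $ k - 1 / (1 + u $ k)) * d $ k)) (at 0)"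
      unfolding \<phi>_def F_def g_def using up
      by (auto intro!: derivative_eq_intros sum.cong simp: u(2) algebra_simps divide_inverse)
    \<comment> \<open>The minimizer has all coordinates at least exp(-B), so moving by less than
      \<delta> along \<open>d\<close> stays in the positive orthant and the local minimum criterion
      applies.\<close>
    define \<delta> where "\<delta> = exp (- B) / (1 + (\<Sum>k\<in>UNIV. \<bar>d $ k\<bar>))"
    have S: "0 \<le> (\<Sum>k\<in>UNIV. \<bar>d $ k\<bar>)" by (simp add: sum_nonneg)
    then have \<delta>: "0 < \<delta>" unfolding \<delta>_def by (intro divide_pos_pos add_pos_nonneg) auto
    have "\<phi> 0 \<le> \<phi> h" if h: "\<bar>0 - h\<bar> < \<delta>" for h
    proof -
      have "0 < (y + h *\<^sub>R d) $ k" for k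
      proof -
        have "\<bar>d $ k\<bar> \<le> (\<Sum>k\<in>UNIV. \<bar>d $ k\<bar>)" by (rule member_le_sum) auto
        then have "\<bar>h\<bar> * \<bar>d $ k\<bar> \<le> \<bar>h\<bar> * (1 + (\<Sum>k\<in>UNIV. \<bar>d $ k\<bar>))"
          by (intro mult_left_mono) auto
        also have "\<dots> < exp (- B)" using h S by (simp add: \<delta>_def pos_less_divide_eq)
        also have "\<dots> \<le> y $ k" using y(1) by (simp add: C_def mem_box_cart lo_def)
        finally have "\<bar>h * d $ k\<bar> < y $ k" by (simp add: abs_mult)
        then show ?thesis by simp
      qed
      moreover have "y + h *\<^sub>R d \<in> (\<lambda>x. 1 + x) ` E"
        using u d E by (auto simp: algebra_simps intro!: image_eqI[of _ _ "u + h *\<^sub>R d"] subspace_add subspace_scale)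
      ultimately show ?thesis unfolding \<phi>_def using y_min by simp
    qed
    then show "(\<Sum>k\<in>UNIV. (w $ k - 1 / (1 + u $ k)) * d $ k) = 0"
      using DERIV_local_min[OF der \<delta>] by blast
  qed
qed

section \<open>Central points over Puiseux series\<close>

lemma val_of_nat_le: "val (of_nat n) \<le> 0"
  by (induction n) (auto intro: val_add_le)

lemma val_const_le: "val (puiseux_monom c 0) \<le> 0"
  by (cases "c = 0") (simp_all add: val_monom zero_ereal_def val_le_iff puiseux_monom.rep_eq)

lemma val_pos_finite:
  assumes "(0::puiseux) < f"
  obtains e where "val f = ereal e"
  using assms by (auto simp: val_def)

lemma le_val: "coeff f a \<noteq> 0 \<Longrightarrow> ereal a \<le> val f"
  using lead_exp_max[of f a] by (cases "f = 0") (auto simp: val_def)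

lemma val_inverse_times:
  assumes "f \<noteq> 0" "val f = val g"
  shows "val (g / f) = 0"
proof -
  have "f * (g / f) = g" using assms(1) by simp
  then have "val f + val (g / f) = val f" using assms(2) val_times[of f "g / f"] by simp
  moreover obtain e where "val f = ereal e" using assms(1) by (auto simp: val_def)
  ultimately show ?thesis by (cases "val (g / f)") auto
qed

text \<open>Displacements of a positive \<open>p\<close> are written \<open>vscale p u\<close>, so
  that \<open>u\<close> measures relative change and its valuation does not depend on the scale of
  \<open>p\<close>.\<close>

definition vscale :: "'a::times ^ 'k \<Rightarrow> 'a ^ 'k \<Rightarrow> 'a ^ 'k" where
  "vscale p u = (\<chi> k. p $ k * u $ k)"

section \<open>Relative displacements of a positive pair\<close>

context orth_decomp
begin

text \<open>In relative displacements the linearized centrality equation is just u + v = r; it is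
  \<open>decomp\<close> for the weight \<open>p / q\<close>, divided by \<open>p\<close>.\<close>

lemma weighted_decomp:
  assumes "\<And>k. 0 < p $ k" "\<And>k. 0 < q $ k"
  obtains u v where "vscale p u \<in> V" "vscale q v \<in> W" "u + v = r"
proof -
  obtain v w where *: "v \<in> V" "w \<in> W" "\<And>k. v $ k + p $ k / q $ k * w $ k = p $ k * r $ k"
    using decomp[of "\<chi> k. p $ k / q $ k" "vscale p r"] assms by (auto simp: vscale_def)
  have nz: "p $ k \<noteq> 0" "q $ k \<noteq> 0" for k using assms[of k] by auto
  show ?thesis
  proof (rule that[of "\<chi> k. v $ k / p $ k" "\<chi> k. w $ k / q $ k"])
    have "vscale p (\<chi> k. v $ k / p $ k) = v" "vscale q (\<chi> k. w $ k / q $ k) = w"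
      using nz by (simp_all add: vscale_def vec_eq_iff)
    then show "vscale p (\<chi> k. v $ k / p $ k) \<in> V" "vscale q (\<chi> k. w $ k / q $ k) \<in> W"
      using * by simp_all
    have "v $ k / p $ k + w $ k / q $ k = r $ k" for k
      using *(3)[of k] nz[of k] by (simp add: field_simps)
    then show "(\<chi> k. v $ k / p $ k) + (\<chi> k. w $ k / q $ k) = r" by (simp add: vec_eq_iff)
  qed
qed

lemma rescale_in_V: "vscale p u \<in> V \<Longrightarrow> p - xs \<in> V \<Longrightarrow> vscale p (1 + u) - xs \<in> V"
proof -
  have "vscale p (1 + u) - xs = (p - xs) + vscale p u"
    by (simp add: vscale_def vec_eq_iff algebra_simps)
  then show "vscale p u \<in> V \<Longrightarrow> p - xs \<in> V \<Longrightarrow> ?thesis"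
    by (simp only: vec.subspace_add[OF subspace_V])
qed

lemma rescale_in_W: "vscale q v \<in> W \<Longrightarrow> q - ss \<in> W \<Longrightarrow> vscale q (1 + v) - ss \<in> W"
proof -
  have "vscale q (1 + v) - ss = (q - ss) + vscale q v"
    by (simp add: vscale_def vec_eq_iff algebra_simps)
  then show "vscale q v \<in> W \<Longrightarrow> q - ss \<in> W \<Longrightarrow> ?thesis"
    by (simp only: vec.subspace_add[OF subspace_W])
qed

text \<open>Since both products equal \<mu>, an increase of one factor forces a decrease of the
  other, so all summands of \<open>dot (p - p') (q - q')\<close> are at most 0. Their sum vanishes
  by orthogonality.\<close>

lemma center_unique:
  assumes "p - p' \<in> V" "q - q' \<in> W" "\<mu> > 0"
    and "\<And>k. 0 < p $ k" "\<And>k. 0 < q $ k" "\<And>k. 0 < p' $ k" "\<And>k. 0 < q' $ k"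
    and "\<And>k. p $ k * q $ k = \<mu>" "\<And>k. p' $ k * q' $ k = \<mu>"
  shows "p = p' \<and> q = q'"
proof -
  have neg: "(p $ k - p' $ k) * (q $ k - q' $ k) \<le> 0 \<and>
      ((p $ k - p' $ k) * (q $ k - q' $ k) = 0 \<longrightarrow> p $ k = p' $ k)" for k
  proof -
    have "(p $ k - p' $ k) * q' $ k = - (p $ k * (q $ k - q' $ k))"
      using assms(8,9)[of k] by (simp add: algebra_simps)
    then have "(p $ k - p' $ k) * q' $ k * (q $ k - q' $ k) = - ((q $ k - q' $ k)\<^sup>2 * p $ k)"
      by (simp add: power2_eq_square mult.commute mult.left_commute)
    then have "(p $ k - p' $ k) * (q $ k - q' $ k) * q' $ k = - ((q $ k - q' $ k)\<^sup>2 * p $ k)"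
      by (simp only: mult.assoc mult.commute[of "q' $ k"])
    moreover have "0 \<le> (q $ k - q' $ k)\<^sup>2 * p $ k" using assms(4)[of k] by simp
    ultimately have le: "(p $ k - p' $ k) * (q $ k - q' $ k) * q' $ k \<le> 0" by simp
    have "p $ k = p' $ k" if "q $ k = q' $ k"
      using assms(8,9)[of k] that assms(5)[of k] by (metis less_irrefl mult_cancel_right)
    then show ?thesis using le assms(7)[of k] by (auto simp: mult_le_0_iff)
  qed
  have "dot (p - p') (q - q') = 0" by (rule orth[OF assms(1,2)])
  then have "(\<Sum>k\<in>UNIV. - ((p $ k - p' $ k) * (q $ k - q' $ k))) = 0"
    by (simp add: dot_def sum_negf)
  then have "p $ k = p' $ k" for k
    using neg by (subst (asm) sum_nonneg_eq_0_iff) auto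
  moreover from this have "q $ k = q' $ k" for k
    using assms(8,9)[of k] assms(4)[of k] by (metis less_irrefl mult_cancel_left)
  ultimately show ?thesis by (simp add: vec_eq_iff)
qed

end

locale puiseux_orth_decomp = orth_decomp V W for V W :: "(puiseux ^ 'k::finite) set"
begin

text \<open>Orthogonality gives \<open>dot p q' + dot p' q = dot p q + dot p' q'\<close>, whose
  right side has valuation at most \<open>val\<close> \<mu>. The terms on the left are nonnegative,
  so each obeys the same bound, and cancelling \<open>val (p $ k)\<close> or
  \<open>val (q $ k)\<close> compares the coordinates.\<close>

lemma center_val_maximal:
  assumes "p - p' \<in> V" "q - q' \<in> W" "\<mu> > 0"
    and p: "\<And>k. 0 < p $ k" and q: "\<And>k. 0 < q $ k" and p': "\<And>k. 0 \<le> p' $ k" and q': "\<And>k. 0 \<le> q' $ k"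
    and c: "\<And>k. p $ k * q $ k = \<mu>" and le: "\<And>k. val (p' $ k * q' $ k) \<le> val \<mu>"
  shows "val (p' $ k) \<le> val (p $ k)" "val (q' $ k) \<le> val (q $ k)"
proof -
  have "dot (p - p') (q - q') = 0" by (rule orth[OF assms(1,2)])
  then have eq: "dot p q' + dot p' q = dot p q + dot p' q'" by (simp add: dot_simps algebra_simps)
  have "val (dot p q) \<le> val \<mu>" "val (dot p' q') \<le> val \<mu>"
    unfolding dot_def using le by (auto intro!: val_sum_le simp only: c)
  then have b: "val (dot p q' + dot p' q) \<le> val \<mu>" unfolding eq by (rule val_add_le)
  have n: "0 \<le> dot p q'" "0 \<le> dot p' q"
    by (intro dot_nonneg less_imp_le p q p' q')+
  have "p $ k * q' $ k \<le> dot p q'" "p' $ k * q $ k \<le> dot p' q"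
    by (intro dot_component_le less_imp_le p q p' q')+
  then have "p $ k * q' $ k \<le> dot p q' + dot p' q" "p' $ k * q $ k \<le> dot p q' + dot p' q"
    using n by linarith+
  moreover have "0 \<le> p $ k * q' $ k" "0 \<le> p' $ k * q $ k"
    using p[of k] q[of k] p'[of k] q'[of k] by simp_all
  ultimately have "val (p $ k * q' $ k) \<le> val (p $ k * q $ k)" "val (p' $ k * q $ k) \<le> val (p $ k * q $ k)"
    using b c val_mono order_trans by metis+
  then have "val (p $ k) + val (q' $ k) \<le> val (p $ k) + val (q $ k)"
    "val (p' $ k) + val (q $ k) \<le> val (p $ k) + val (q $ k)"
    unfolding val_times .
  moreover obtain a b where "val (p $ k) = ereal a" "val (q $ k) = ereal b"
    by (metis p q val_pos_finite)
  ultimately show "val (p' $ k) \<le> val (p $ k)" "val (q' $ k) \<le> val (q $ k)"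
    by (cases "val (p' $ k)"; cases "val (q' $ k)"; simp)+
qed

text \<open>Pythagoras for the weight \<open>p $ k * q $ k\<close>: the weighted squares of
  \<open>u\<close> and \<open>v\<close> add up to that of \<open>u + v\<close>, and no summand can
  cancel. Because all weights have the same valuation, the bound on \<open>u + v\<close> passes to
  every coordinate.\<close>

lemma weighted_decomp_integral:
  assumes p: "\<And>k. 0 < p $ k" and q: "\<And>k. 0 < q $ k" and val: "\<And>k. val (p $ k * q $ k) = ereal l"
    and u: "vscale p u \<in> V" and v: "vscale q v \<in> W" and r: "\<And>k. val ((u + v) $ k) \<le> 0"
  shows "val (u $ k) \<le> 0" "val (v $ k) \<le> 0"
proof -
  let ?w = "\<lambda>k. p $ k * q $ k"
  have w: "0 < ?w k" for k using p q by simp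
  have "dot (vscale p u) (vscale q v) = 0" by (rule orth[OF u v])
  then have o: "(\<Sum>k\<in>UNIV. ?w k * (u $ k * v $ k)) = 0" by (simp add: dot_def vscale_def algebra_simps)
  define S where "S = (\<Sum>k\<in>UNIV. ?w k * ((u + v) $ k)\<^sup>2)"
  have "S = (\<Sum>k\<in>UNIV. ?w k * (u $ k)\<^sup>2 + ?w k * (v $ k)\<^sup>2 + 2 * (?w k * (u $ k * v $ k)))"
    unfolding S_def by (intro sum.cong) (auto simp: power2_eq_square algebra_simps)
  also have "\<dots> = (\<Sum>k\<in>UNIV. ?w k * (u $ k)\<^sup>2 + ?w k * (v $ k)\<^sup>2)"
    using o by (simp add: sum.distrib flip: sum_distrib_left)
  finally have S: "S = (\<Sum>k\<in>UNIV. ?w k * (u $ k)\<^sup>2 + ?w k * (v $ k)\<^sup>2)" .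
  have n: "0 \<le> ?w k * (u $ k)\<^sup>2" "0 \<le> ?w k * (v $ k)\<^sup>2" for k
    using w[of k] by (auto intro!: mult_nonneg_nonneg)
  have "?w k * (u $ k)\<^sup>2 + ?w k * (v $ k)\<^sup>2 \<le> S"
    unfolding S using n by (intro member_le_sum add_nonneg_nonneg) auto
  then have le: "?w k * (u $ k)\<^sup>2 \<le> S" "?w k * (v $ k)\<^sup>2 \<le> S" using n[of k] by linarith+
  have "val S \<le> ereal l"
    unfolding S_def
  proof (rule val_sum_le)
    fix k
    have "val (((u + v) $ k)\<^sup>2) \<le> 0 + 0" unfolding power2_eq_square by (intro val_times_le r)
    then show "val (?w k * ((u + v) $ k)\<^sup>2) \<le> ereal l"
      using val_times_le[of "?w k" "ereal l" "((u + v) $ k)\<^sup>2" 0] val by simp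
  qed
  then have "val (?w k * (u $ k)\<^sup>2) \<le> ereal l" "val (?w k * (v $ k)\<^sup>2) \<le> ereal l"
    using val_mono[OF n(1) le(1)] val_mono[OF n(2) le(2)] by auto
  then have "ereal l + (val (u $ k) + val (u $ k)) \<le> ereal l" "ereal l + (val (v $ k) + val (v $ k)) \<le> ereal l"
    using val[of k] unfolding power2_eq_square val_times[of "?w k"] val_times[of "u $ k" "u $ k"] val_times[of "v $ k" "v $ k"]
    by simp_all
  then show "val (u $ k) \<le> 0" "val (v $ k) \<le> 0"
    by (cases "val (u $ k)"; cases "val (v $ k)"; simp add: zero_ereal_def)+
qed

text \<open>\<open>P j\<close> and \<open>R j\<close> are the components of the j-th unit vector
  under the two complementary projections. Being integral, they can be reduced to residues and can
  serve as coefficients in Hensel's lemma.\<close>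

lemma integral_frame:
  assumes p: "\<And>k. 0 < p $ k" and q: "\<And>k. 0 < q $ k" and val: "\<And>k. val (p $ k * q $ k) = ereal l"
  obtains P R :: "'k \<Rightarrow> puiseux ^ 'k" where
    "\<And>f. vscale p (\<Sum>j\<in>UNIV. f j *s P j) \<in> V" "\<And>f. vscale q (\<Sum>j\<in>UNIV. f j *s R j) \<in> W"
    "\<And>j. P j + R j = axis j 1" "\<And>j k. val (P j $ k) \<le> 0" "\<And>j k. val (R j $ k) \<le> 0"
proof -
  have "\<exists>u v. vscale p u \<in> V \<and> vscale q v \<in> W \<and> u + v = axis j 1" for j
    by (rule weighted_decomp[OF p q]) blast
  then obtain P R where *: "\<And>j. vscale p (P j) \<in> V" "\<And>j. vscale q (R j) \<in> W" "\<And>j. P j + R j = axis j 1"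
    by metis
  have sum: "vscale p (\<Sum>j\<in>UNIV. f j *s Q j) = (\<Sum>j\<in>UNIV. f j *s vscale p (Q j))"
    for p :: "puiseux ^ 'k" and f Q
    unfolding vscale_def vec_eq_iff by (simp add: sum_component sum_distrib_left mult.left_commute)
  have r: "val ((P j + R j) $ k) \<le> 0" for j k
    unfolding *(3) by (simp add: axis_def)
  show ?thesis
  proof (rule that[of P R])
    show "vscale p (\<Sum>j\<in>UNIV. f j *s P j) \<in> V" for f
      unfolding sum by (intro vec.subspace_sum[OF subspace_V] vec.subspace_scale[OF subspace_V] *)
    show "vscale q (\<Sum>j\<in>UNIV. f j *s R j) \<in> W" for f
      unfolding sum by (intro vec.subspace_sum[OF subspace_W] vec.subspace_scale[OF subspace_W] *)
    show "val (P j $ k) \<le> 0" "val (R j $ k) \<le> 0" for j k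
      by (intro weighted_decomp_integral[OF p q val *(1) *(2) r])+
  qed (rule *(3))
qed

text \<open>The residues of the frame decompose \<open>\<real>\<^sup>k\<close> orthogonally for the weight \<open>res (p q / \<mu>)\<close>, so the real
  weighted barrier problem yields a correction that makes all products \<open>p\<^sub>k q\<^sub>k / \<mu>\<close> have residue one.\<close>

lemma residue_center:
  assumes p: "\<And>k. 0 < p $ k" and q: "\<And>k. 0 < q $ k" and \<mu>: "\<mu> > 0"
    and val: "\<And>k. val (p $ k * q $ k) = val \<mu>"
    and pV: "p - xs \<in> V" and qW: "q - ss \<in> W"
  obtains p' q' where "p' - xs \<in> V" "q' - ss \<in> W" "\<And>k. 0 < p' $ k" "\<And>k. 0 < q' $ k"
    "\<And>k. val (p' $ k * q' $ k / \<mu>) = 0" "\<And>k. coeff (p' $ k * q' $ k / \<mu>) 0 = 1"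
proof -
  obtain l where l: "val \<mu> = ereal l" using \<mu> by (rule val_pos_finite)
  obtain P R :: "'k \<Rightarrow> puiseux ^ 'k" where PV: "\<And>f. vscale p (\<Sum>j\<in>UNIV. f j *s P j) \<in> V"
    and RW: "\<And>f. vscale q (\<Sum>j\<in>UNIV. f j *s R j) \<in> W"
    and PR: "\<And>j. P j + R j = axis j 1" and Pval: "\<And>j k. val (P j $ k) \<le> 0" and Rval: "\<And>j k. val (R j $ k) \<le> 0"
    by (rule integral_frame[OF p q val[unfolded l]]) (rule that)
  define w where "w k = p $ k * q $ k / \<mu>" for k
  have wval: "val (w k) = 0" for k unfolding w_def using val_inverse_times[of \<mu>] val \<mu> by simp
  have wpos: "0 < w k" for k unfolding w_def using p q \<mu> by simp
  have wres: "0 < coeff (w k) 0" for k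
  proof -
    have "w k \<noteq> 0" using wpos[of k] by simp
    then have "coeff (w k) 0 \<noteq> 0" using wval[of k] coeff_lead_exp[of "w k"]
      by (simp add: val_def zero_ereal_def)
    then show ?thesis using residue_nonneg[of "w k"] wval[of k] wpos[of k] by simp
  qed
  define rP where "rP j = (\<chi> k. coeff (P j $ k) 0)" for j
  define rR where "rR j = (\<chi> k. coeff (R j $ k) 0)" for j
  define rw where "rw = (\<chi> k. coeff (w k) 0)"
  have rPR: "rP j $ k + rR j $ k = (if k = j then 1 else 0)" for j k
  proof -
    have "coeff ((P j + R j) $ k) 0 = (if k = j then 1 else 0)" unfolding PR by (simp add: axis_def)
    then show ?thesis by (simp add: rP_def rR_def)
  qed
  \<comment> \<open>The residue of the orthogonality of two frame vectors after division by
    \<mu>.\<close>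
  have orth_res: "(\<Sum>k\<in>UNIV. rw $ k * (rP i $ k * rR j $ k)) = 0" for i j
  proof -
    have one: "(\<Sum>j\<in>UNIV. (if j = i then 1 else 0) *s Q j) = Q i" for i and Q :: "'k \<Rightarrow> puiseux ^ 'k"
      by (subst sum.remove[of UNIV i]) (auto intro: sum.neutral)
    have "dot (vscale p (P i)) (vscale q (R j)) = 0"
      using orth[OF PV[of "\<lambda>j. if j = i then 1 else 0"] RW[of "\<lambda>i. if i = j then 1 else 0"]]
      by (simp only: one)
    then have "(\<Sum>k\<in>UNIV. w k * (P i $ k * R j $ k)) * \<mu> = 0"
      using \<mu> unfolding sum_distrib_right by (simp add: dot_def vscale_def w_def algebra_simps)
    then have "(\<Sum>k\<in>UNIV. w k * (P i $ k * R j $ k)) = 0" using \<mu> by simp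
    then have "0 = (\<Sum>k\<in>UNIV. coeff (w k * (P i $ k * R j $ k)) 0)"
      by (simp flip: coeff_sum)
    also have "\<dots> = (\<Sum>k\<in>UNIV. rw $ k * (rP i $ k * rR j $ k))"
    proof (intro sum.cong refl)
      fix k
      have "val (P i $ k * R j $ k) \<le> 0 + 0" by (intro val_times_le Pval Rval)
      then show "coeff (w k * (P i $ k * R j $ k)) 0 = rw $ k * (rP i $ k * rR j $ k)"
        using wval Pval Rval by (simp add: coeff_zero_times rw_def rP_def rR_def)
    qed
    finally show ?thesis by simp
  qed
  define E where "E = range (\<lambda>c :: real ^ 'k. \<Sum>j\<in>UNIV. c $ j *\<^sub>R rP j)"
  have "subspace E"
    unfolding E_def by (intro linear_subspace_image subspace_UNIV linearI)
      (simp_all add: sum.distrib scaleR_left_distrib scaleR_sum_right)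
  then obtain u where u: "u \<in> E" "\<And>k. 0 < 1 + u $ k"
    "\<And>d. d \<in> E \<Longrightarrow> (\<Sum>k\<in>UNIV. (rw $ k - 1 / (1 + u $ k)) * d $ k) = 0"
    using weighted_barrier_critical_point[of E rw] wres by (auto simp: rw_def)
  obtain c :: "real ^ 'k" where c: "u = (\<Sum>j\<in>UNIV. c $ j *\<^sub>R rP j)" using u(1) by (auto simp: E_def)
  \<comment> \<open>Solves rw (1 + u)(1 + v) = 1 coordinatewise. Criticality of \<open>u\<close>
    says exactly that \<open>v\<close> is orthogonal to \<open>E\<close> for the weight
    \<open>rw\<close>.\<close>
  define v where "v = (\<chi> k. 1 / (rw $ k * (1 + u $ k)) - 1)"
  have rw: "0 < rw $ k" for k using wres by (simp add: rw_def)
  have v_orth: "(\<Sum>k\<in>UNIV. rw $ k * (d $ k * v $ k)) = 0" if "d \<in> E" for d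
  proof -
    have "rw $ k * (d $ k * v $ k) = - ((rw $ k - 1 / (1 + u $ k)) * d $ k)" for k
    proof -
      have "rw $ k * (1 / (rw $ k * (1 + u $ k))) = 1 / (1 + u $ k)" using rw[of k] by simp
      then have "rw $ k * v $ k = 1 / (1 + u $ k) - rw $ k"
        unfolding v_def vec_lambda_beta right_diff_distrib by simp
      then show ?thesis by (simp add: mult.left_commute[of _ "d $ k"] left_diff_distrib mult.commute right_diff_distrib)
    qed
    then show ?thesis using u(3)[OF that] by (simp add: sum_negf)
  qed
  \<comment> \<open>The residue frame splits \<open>v\<close> as e + g with e in \<open>E\<close>.
    As \<open>e\<close> is orthogonal to both \<open>v\<close> and \<open>g\<close>, its weighted
    norm vanishes, so \<open>v\<close> is a combination of the \<open>rR j\<close> and can be lifted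
    to the dual side.\<close>
  define e where "e = (\<Sum>j\<in>UNIV. v $ j *\<^sub>R rP j)"
  define g where "g = (\<Sum>j\<in>UNIV. v $ j *\<^sub>R rR j)"
  have v_eg: "v = e + g"
  proof -
    have "e $ k + g $ k = (\<Sum>j\<in>UNIV. v $ j * (rP j $ k + rR j $ k))" for k
      by (simp add: e_def g_def sum_component distrib_left sum.distrib)
    then show ?thesis unfolding vec_eq_iff rPR by (simp add: if_distrib[of "\<lambda>x. _ * x"] cong: if_cong)
  qed
  have eg: "(\<Sum>k\<in>UNIV. rw $ k * (e $ k * g $ k)) = 0"
  proof -
    have prod: "e $ k * g $ k = (\<Sum>i\<in>UNIV. \<Sum>j\<in>UNIV. (v $ i * rP i $ k) * (v $ j * rR j $ k))" for k
      unfolding e_def g_def sum_component vector_scaleR_component real_scaleR_def by (rule sum_product)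
    have "(\<Sum>k\<in>UNIV. rw $ k * (e $ k * g $ k)) =
        (\<Sum>k\<in>UNIV. \<Sum>i\<in>UNIV. \<Sum>j\<in>UNIV. v $ i * v $ j * (rw $ k * (rP i $ k * rR j $ k)))"
      unfolding prod sum_distrib_left by (intro sum.cong refl) (simp add: mult.commute mult.left_commute)
    also have "\<dots> = (\<Sum>i\<in>UNIV. \<Sum>k\<in>UNIV. \<Sum>j\<in>UNIV. v $ i * v $ j * (rw $ k * (rP i $ k * rR j $ k)))"
      by (rule sum.swap)
    also have "\<dots> = (\<Sum>i\<in>UNIV. \<Sum>j\<in>UNIV. \<Sum>k\<in>UNIV. v $ i * v $ j * (rw $ k * (rP i $ k * rR j $ k)))"
      by (intro sum.cong refl sum.swap)
    also have "\<dots> = 0" by (simp add: orth_res flip: sum_distrib_left)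
    finally show ?thesis .
  qed
  have "e \<in> E" by (auto simp: E_def e_def)
  from v_orth[OF this] have "(\<Sum>k\<in>UNIV. rw $ k * (e $ k * e $ k) + rw $ k * (e $ k * g $ k)) = 0"
    by (simp add: v_eg distrib_left)
  then have "(\<Sum>k\<in>UNIV. rw $ k * (e $ k * e $ k)) = 0" using eg by (simp add: sum.distrib)
  then have "rw $ k * (e $ k * e $ k) = 0" for k
    using less_imp_le[OF rw] by (subst (asm) sum_nonneg_eq_0_iff) auto
  then have "e $ k = 0" for k using rw[of k] by (metis less_irrefl mult_eq_0_iff)
  then have "e = 0" by (simp add: vec_eq_iff)
  then have "v = g" using v_eg by (metis add_0)
  then have vR: "v = (\<Sum>j\<in>UNIV. v $ j *\<^sub>R rR j)" unfolding g_def .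
  \<comment> \<open>Constant series lift the real coefficients: the residues of \<open>U\<close> and
    \<open>Z\<close> are \<open>u\<close> and \<open>v\<close>, while membership in \<open>V\<close>
    and \<open>W\<close> after scaling is exact.\<close>
  define U where "U = (\<Sum>j\<in>UNIV. puiseux_monom (c $ j) 0 *s P j)"
  define Z where "Z = (\<Sum>j\<in>UNIV. puiseux_monom (v $ j) 0 *s R j)"
  have cst: "coeff (puiseux_monom x 0) 0 = x" for x by (simp add: puiseux_monom.rep_eq)
  have tU: "val (puiseux_monom (c $ j) 0 * P j $ k) \<le> 0" and tZ: "val (puiseux_monom (v $ j) 0 * R j $ k) \<le> 0" for j k
    using val_times_le[OF val_const_le Pval] val_times_le[OF val_const_le Rval] by simp_all
  have Uval: "val (U $ k) \<le> 0" and Zval: "val (Z $ k) \<le> 0" for k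
    unfolding U_def Z_def sum_component using tU tZ by (auto intro: val_sum_le)
  have Ures: "coeff (U $ k) 0 = u $ k" for k
    unfolding c U_def sum_component coeff_sum
    by (simp add: coeff_zero_times val_const_le Pval cst rP_def)
  have Zres: "coeff (Z $ k) 0 = v $ k" for k
  proof -
    have "coeff (Z $ k) 0 = (\<Sum>j\<in>UNIV. v $ j *\<^sub>R rR j) $ k"
      unfolding Z_def sum_component coeff_sum
      by (simp add: coeff_zero_times val_const_le Rval cst rR_def)
    then show ?thesis unfolding vR[symmetric] .
  qed
  have U1: "val (1 + U $ k) \<le> 0" "coeff (1 + U $ k) 0 = 1 + u $ k" and
    Z1: "val (1 + Z $ k) \<le> 0" "coeff (1 + Z $ k) 0 = 1 / (rw $ k * (1 + u $ k))" for k
    using Uval Zval by (auto intro: val_add_le simp: Ures Zres) (simp add: v_def)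
  have Upos: "0 < 1 + U $ k" for k using U1[of k] u(2)[of k] by (intro puiseux_pos_residue) auto
  have Zpos: "0 < 1 + Z $ k" for k
    using Z1[of k] u(2)[of k] rw[of k] by (intro puiseux_pos_residue) auto
  have prod: "vscale p (1 + U) $ k * vscale q (1 + Z) $ k / \<mu> = w k * ((1 + U $ k) * (1 + Z $ k))" for k
    by (simp add: vscale_def w_def)
  have UZval: "val ((1 + U $ k) * (1 + Z $ k)) \<le> 0" for k
    using val_times_le[OF U1(1) Z1(1)] by simp
  have res1: "coeff (w k * ((1 + U $ k) * (1 + Z $ k))) 0 = 1" for k
  proof -
    have "coeff (w k * ((1 + U $ k) * (1 + Z $ k))) 0 = rw $ k * ((1 + u $ k) * (1 / (rw $ k * (1 + u $ k))))"
      using wval UZval U1 Z1 by (simp only: coeff_zero_times order_refl rw_def vec_lambda_beta)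
    moreover have "0 < rw $ k * (1 + u $ k)" using rw u(2) by simp
    ultimately show ?thesis
      by (metis divide_self less_irrefl mult.assoc mult_1_right times_divide_eq_right)
  qed
  show ?thesis
  proof (rule that[of "vscale p (1 + U)" "vscale q (1 + Z)"])
    show "vscale p (1 + U) - xs \<in> V" "vscale q (1 + Z) - ss \<in> W"
      unfolding U_def Z_def by (intro rescale_in_V rescale_in_W PV RW pV qW)+
    show "0 < vscale p (1 + U) $ k" "0 < vscale q (1 + Z) $ k" for k
      using p q Upos Zpos by (simp_all add: vscale_def)
    show "coeff (vscale p (1 + U) $ k * vscale q (1 + Z) $ k / \<mu>) 0 = 1" for k
      unfolding prod by (rule res1)
    show "val (vscale p (1 + U) $ k * vscale q (1 + Z) $ k / \<mu>) = 0" for k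
      unfolding prod
    proof (rule antisym)
      show "val (w k * ((1 + U $ k) * (1 + Z $ k))) \<le> 0"
        using val_times_le[OF eq_refl[OF wval] UZval] by simp
      show "0 \<le> val (w k * ((1 + U $ k) * (1 + Z $ k)))"
        unfolding zero_ereal_def by (rule le_val) (simp only: res1 one_neq_zero not_False_eq_True)
    qed
  qed
qed

text \<open>With \<open>U\<close> and \<open>Z\<close> the combinations of the \<open>P j\<close>
  and \<open>R j\<close> with the same coefficients r, the sum U + Z equals r. The equation (1 +
  U)(1 + Z) = 1 + \<epsilon> therefore reads r + U Z = \<epsilon>, with identity linear part and an
  integral quadratic part; \<epsilon> has negative valuation because the products already have
  residue 1.\<close>

lemma center_exists:
  assumes p: "\<And>k. 0 < p $ k" and q: "\<And>k. 0 < q $ k" and \<mu>: "\<mu> > 0"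
    and val: "\<And>k. val (p $ k * q $ k) = val \<mu>"
    and pV: "p - xs \<in> V" and qW: "q - ss \<in> W"
  obtains p' q' where "p' - xs \<in> V" "q' - ss \<in> W" "\<And>k. 0 < p' $ k" "\<And>k. 0 < q' $ k"
    "\<And>k. p' $ k * q' $ k = \<mu>"
proof -
  obtain p' q' where p'V: "p' - xs \<in> V" and q'W: "q' - ss \<in> W" and p': "\<And>k. 0 < p' $ k" and q': "\<And>k. 0 < q' $ k"
    and v0: "\<And>k. val (p' $ k * q' $ k / \<mu>) = 0" and r1: "\<And>k. coeff (p' $ k * q' $ k / \<mu>) 0 = 1"
    by (rule residue_center[OF assms]) (rule that)
  obtain l where l: "val \<mu> = ereal l" using \<mu> by (rule val_pos_finite)
  have "val (p' $ k * q' $ k) = ereal l" for k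
  proof -
    have "val (p' $ k * q' $ k / \<mu> * \<mu>) = ereal l" unfolding val_times[of _ \<mu>] v0 l by simp
    then show ?thesis using \<mu> by simp
  qed
  note val' = this
  obtain P R :: "'k \<Rightarrow> puiseux ^ 'k" where PV: "\<And>f. vscale p' (\<Sum>j\<in>UNIV. f j *s P j) \<in> V"
    and RW: "\<And>f. vscale q' (\<Sum>j\<in>UNIV. f j *s R j) \<in> W"
    and PR: "\<And>j. P j + R j = axis j 1" and Pval: "\<And>j k. val (P j $ k) \<le> 0" and Rval: "\<And>j k. val (R j $ k) \<le> 0"
    by (rule integral_frame[OF p' q' val']) (rule that)
  define \<epsilon> where "\<epsilon> k = \<mu> / (p' $ k * q' $ k) - 1" for k
  have \<epsilon>: "val (\<epsilon> k) < 0" for k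
  proof -
    let ?a = "p' $ k * q' $ k / \<mu>" and ?b = "\<mu> / (p' $ k * q' $ k)"
    have ab: "?a * ?b = 1" using p'[of k] q'[of k] \<mu> by simp
    have "val ?a + val ?b = 0" by (metis ab val_one val_times)
    then have b: "val ?b = 0" by (simp add: v0)
    have "coeff ?a 0 * coeff ?b 0 = 1"
      using coeff_zero_times[of ?a ?b] ab v0 b by simp
    then have "coeff (\<epsilon> k) 0 = 0" by (simp add: r1 \<epsilon>_def)
    moreover have "val (\<epsilon> k) \<le> 0" unfolding \<epsilon>_def using b by (intro val_diff_le) simp_all
    ultimately show ?thesis by (intro val_neg_residue)
  qed
  have PRval: "val (P j $ i * R k $ i) \<le> 0" for i j k
    using val_times_le[OF Pval Rval] by simp
  obtain r where r: "\<And>i. val (r i) < 0"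
    "\<And>i. r i + (\<Sum>j\<in>UNIV. \<Sum>k\<in>UNIV. (P j $ i * R k $ i) * r j * r k) = \<epsilon> i"
    by (rule quadratic_hensel[of "\<lambda>i j k. P j $ i * R k $ i" \<epsilon>, OF PRval \<epsilon>]) (rule that)
  define U where "U = (\<Sum>j\<in>UNIV. r j *s P j)"
  define Z where "Z = (\<Sum>j\<in>UNIV. r j *s R j)"
  have UZ_add: "U $ i + Z $ i = r i" for i
  proof -
    have "U $ i + Z $ i = (\<Sum>j\<in>UNIV. r j * (P j + R j) $ i)"
      by (simp add: U_def Z_def sum_component distrib_left sum.distrib)
    then show ?thesis unfolding PR
      by (simp add: axis_def if_distrib[of "\<lambda>x. _ * x"] cong: if_cong)
  qed
  have UZ_mult: "U $ i * Z $ i = (\<Sum>j\<in>UNIV. \<Sum>k\<in>UNIV. (P j $ i * R k $ i) * r j * r k)" for i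
    by (simp add: U_def Z_def sum_component sum_product algebra_simps)
  have UZ: "(1 + U $ i) * (1 + Z $ i) = \<mu> / (p' $ i * q' $ i)" for i
  proof -
    have "(1 + U $ i) * (1 + Z $ i) = 1 + ((U $ i + Z $ i) + U $ i * Z $ i)" by (simp add: algebra_simps)
    also have "\<dots> = 1 + \<epsilon> i" unfolding UZ_add UZ_mult r(2) ..
    finally show ?thesis by (simp add: \<epsilon>_def)
  qed
  have neg: "val (\<Sum>j\<in>UNIV. r j * Q j $ k) < 0" if "\<And>j k. val (Q j $ k) \<le> 0" for Q :: "'k \<Rightarrow> puiseux ^ 'k" and k
  proof (rule val_neg_residue)
    show "val (\<Sum>j\<in>UNIV. r j * Q j $ k) \<le> 0"
      using val_times_le[OF less_imp_le[OF r(1)] that] by (intro val_sum_le) simp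
    have "coeff (r j) 0 = 0" for j using r(1)[of j] lead_exp_max[of "r j" 0]
      by (cases "r j = 0") (auto simp: val_def zero_ereal_def)
    then show "coeff (\<Sum>j\<in>UNIV. r j * Q j $ k) 0 = 0"
      using less_imp_le[OF r(1)] that by (simp add: coeff_sum coeff_zero_times)
  qed
  have pos: "0 < 1 + f" if "val f < 0" for f
  proof (rule puiseux_pos_residue)
    show "val (1 + f) \<le> 0" using that by (intro val_add_le) auto
    have "coeff f 0 = 0" using that lead_exp_max[of f 0]
      by (cases "f = 0") (auto simp: val_def zero_ereal_def)
    then show "0 < coeff (1 + f) 0" by simp
  qed
  have Upos: "0 < 1 + U $ k" and Zpos: "0 < 1 + Z $ k" for k
    using neg[OF Pval] neg[OF Rval] by (auto intro!: pos simp: U_def Z_def sum_component)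
  show ?thesis
  proof (rule that[of "vscale p' (1 + U)" "vscale q' (1 + Z)"])
    show "vscale p' (1 + U) - xs \<in> V" "vscale q' (1 + Z) - ss \<in> W"
      unfolding U_def Z_def by (intro rescale_in_V rescale_in_W PV RW p'V q'W)+
    show "0 < vscale p' (1 + U) $ k" "0 < vscale q' (1 + Z) $ k" for k
      using p' q' Upos Zpos by (simp_all add: vscale_def)
    show "vscale p' (1 + U) $ k * vscale q' (1 + Z) $ k = \<mu>" for k
    proof -
      have "vscale p' (1 + U) $ k * vscale q' (1 + Z) $ k = (p' $ k * q' $ k) * ((1 + U $ k) * (1 + Z $ k))"
        by (simp add: vscale_def)
      also have "\<dots> = \<mu>" unfolding UZ using p'[of k] q'[of k] by simp
      finally show ?thesis .
    qed
  qed
qed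

end

locale puiseux_complementary_pair = complementary_pair V W xs ss x0 s0 + puiseux_orth_decomp V W
  for V W :: "(puiseux ^ 'k::finite) set" and xs ss x0 s0
begin

text \<open>Positive integer constants have valuation at most 0, so two-sided bounds up to the
  factors \<open>CARD('k) ^ 2\<close> and 2 become an equality of valuations.\<close>

lemma central_pair_exists:
  assumes "\<mu> > 0"
  obtains p q where "p - xs \<in> V" "q - ss \<in> W" "\<And>k. 0 < p $ k" "\<And>k. 0 < q $ k"
    "\<And>k. p $ k * q $ k = \<mu>"
proof -
  obtain p q where *: "p - xs \<in> V" "q - ss \<in> W" "\<And>i. 0 < p $ i" "\<And>i. 0 < q $ i"
    "\<And>i. \<mu> \<le> of_nat CARD('k) ^ 2 * (p $ i * q $ i)" "\<And>i. p $ i * q $ i \<le> 2 * \<mu>"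
    using approximate_center[OF assms] by metis
  have "val (p $ i * q $ i) = val \<mu>" for i
  proof (rule antisym)
    have "val (p $ i * q $ i) \<le> val (2 * \<mu>)"
      using *(3,4)[of i] *(6)[of i] by (intro val_mono) auto
    also have "\<dots> \<le> 0 + val \<mu>"
      using val_of_nat_le[of 2] by (intro val_times_le) auto
    finally show "val (p $ i * q $ i) \<le> val \<mu>" by simp
    have "val \<mu> \<le> val (of_nat (CARD('k) ^ 2) * (p $ i * q $ i))"
      using assms *(5)[of i] by (intro val_mono) auto
    also have "\<dots> \<le> 0 + val (p $ i * q $ i)"
      by (intro val_times_le val_of_nat_le) auto
    finally show "val \<mu> \<le> val (p $ i * q $ i)" by simp
  qed
  from center_exists[OF *(3,4) assms this *(1,2)] show ?thesis using that by metis
qed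

end

section \<open>The tropical central path\<close>

text \<open>Keeps the form \<open>transpose A *v y\<close> of the dual constraints from being
  rewritten to \<open>y v* A\<close>.\<close>

declare transpose_matrix_vector [simp del]

section \<open>Linear programs as pairs of orthogonal affine spaces\<close>

definition join :: "'a ^ 'n::finite \<Rightarrow> 'a ^ 'm::finite \<Rightarrow> 'a ^ ('n + 'm)" where
  "join x w = (\<chi> k. case k of Inl j \<Rightarrow> x $ j | Inr i \<Rightarrow> w $ i)"

definition left_part :: "'a ^ ('n::finite + 'm::finite) \<Rightarrow> 'a ^ 'n" where "left_part p = (\<chi> j. p $ Inl j)"

definition right_part :: "'a ^ ('n::finite + 'm::finite) \<Rightarrow> 'a ^ 'm" where "right_part p = (\<chi> i. p $ Inr i)"

lemma parts_join [simp]: "left_part (join x w) = x" "right_part (join x w) = w"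
  by (simp_all add: join_def left_part_def right_part_def vec_eq_iff)

lemma join_parts [simp]: "join (left_part p) (right_part p) = p"
  by (simp add: join_def left_part_def right_part_def vec_eq_iff split: sum.split)

lemma join_nth [simp]: "join x w $ Inl j = x $ j" "join x w $ Inr i = w $ i"
  by (simp_all add: join_def)

lemma parts_linear:
  "left_part (p + q) = left_part p + left_part q" "right_part (p + q) = right_part p + right_part q"
  "left_part (c *s p) = c *s left_part p" "right_part (c *s p) = c *s right_part p"
  "left_part (p - q) = left_part p - left_part q" "right_part (p - q) = right_part p - right_part q"
  "left_part 0 = 0" "right_part 0 = 0"
  by (simp_all add: left_part_def right_part_def vec_eq_iff)

lemma dot_join: "dot p q = dot (left_part p) (left_part q) + dot (right_part p) (right_part q)"
  unfolding dot_def UNIV_Plus_UNIV[symmetric]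
  by (subst sum.Plus) (simp_all add: left_part_def right_part_def)

lemma dot_matrix_transpose: "dot (A *v x) y = dot x (transpose A *v y)"
  for A :: "'a::linordered_field ^ 'n::finite ^ 'm::finite"
proof -
  have "dot (A *v x) y = (\<Sum>i\<in>UNIV. \<Sum>j\<in>UNIV. A $ i $ j * x $ j * y $ i)"
    by (simp add: dot_def matrix_vector_mult_def sum_distrib_right)
  also have "\<dots> = (\<Sum>j\<in>UNIV. \<Sum>i\<in>UNIV. A $ i $ j * x $ j * y $ i)" by (rule sum.swap)
  also have "\<dots> = dot x (transpose A *v y)"
    by (simp add: dot_def matrix_vector_mult_def transpose_def sum_distrib_left mult.commute mult.left_commute)
  finally show ?thesis .
qed

definition primal_dirs :: "'a::linordered_field ^ 'n::finite ^ 'm::finite \<Rightarrow> ('a ^ ('n + 'm)) set" where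
  "primal_dirs A = {p. A *v left_part p + right_part p = 0}"

definition dual_dirs :: "'a::linordered_field ^ 'n::finite ^ 'm::finite \<Rightarrow> ('a ^ ('n + 'm)) set" where
  "dual_dirs A = {q. left_part q - transpose A *v right_part q = 0}"

lemma dirs_orth: "v \<in> primal_dirs A \<Longrightarrow> w \<in> dual_dirs A \<Longrightarrow> dot v w = 0"
proof -
  assume "v \<in> primal_dirs A" "w \<in> dual_dirs A"
  then have "right_part v = - (A *v left_part v)" "left_part w = transpose A *v right_part w"
    by (simp_all add: primal_dirs_def dual_dirs_def eq_neg_iff_add_eq_0 add.commute)
  moreover have "dot (- (A *v left_part v)) u = - dot (A *v left_part v) u" for u
    by (simp add: dot_def sum_negf)
  ultimately show ?thesis
    unfolding dot_join by (simp only: dot_matrix_transpose add.right_inverse)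
qed

text \<open>\<open>f\<close> parametrizes the primal directions by the left block of
  \<open>u\<close> and \<open>g\<close> the dual ones by the right block, so \<open>T\<close> is an
  endomorphism of the full space. If \<open>T u = 0\<close> then \<open>f u = - d g u\<close>, and
  orthogonality makes the weighted norm of \<open>g u\<close> vanish. Hence \<open>T\<close> is
  injective, and surjective by finite dimension.\<close>

lemma orth_decomp_dirs: "orth_decomp (primal_dirs A) (dual_dirs A)"
  for A :: "'a::linordered_field ^ 'n::finite ^ 'm::finite"
proof
  show subV: "vec.subspace (primal_dirs A)"
  proof (rule vec.subspaceI)
    fix c x assume "x \<in> primal_dirs A"
    moreover have "A *v left_part (c *s x) + right_part (c *s x) = c *s (A *v left_part x + right_part x)"
      by (simp add: parts_linear vec.scale_right_distrib vector_scalar_commute)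
    ultimately show "c *s x \<in> primal_dirs A" by (simp add: primal_dirs_def)
  next
    fix x y assume "x \<in> primal_dirs A" "y \<in> primal_dirs A"
    moreover have "A *v left_part (x + y) + right_part (x + y) =
        (A *v left_part x + right_part x) + (A *v left_part y + right_part y)"
      by (simp add: parts_linear matrix_vector_right_distrib)
    ultimately show "x + y \<in> primal_dirs A" by (simp add: primal_dirs_def)
  qed (simp add: primal_dirs_def parts_linear)
  show subW: "vec.subspace (dual_dirs A)"
  proof (rule vec.subspaceI)
    fix c x assume "x \<in> dual_dirs A"
    moreover have "left_part (c *s x) - transpose A *v right_part (c *s x) =
        c *s (left_part x - transpose A *v right_part x)"
      by (simp add: parts_linear vec.scale_right_diff_distrib vector_scalar_commute)
    ultimately show "c *s x \<in> dual_dirs A" by (simp add: dual_dirs_def)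
  next
    fix x y assume "x \<in> dual_dirs A" "y \<in> dual_dirs A"
    moreover have "left_part (x + y) - transpose A *v right_part (x + y) =
        (left_part x - transpose A *v right_part x) + (left_part y - transpose A *v right_part y)"
      by (simp add: parts_linear matrix_vector_right_distrib)
    ultimately show "x + y \<in> dual_dirs A" by (simp add: dual_dirs_def)
  qed (simp add: dual_dirs_def parts_linear)
  fix d r :: "'a ^ ('n + 'm)" assume d: "\<And>k. 0 < d $ k"
  define f :: "'a ^ ('n + 'm) \<Rightarrow> 'a ^ ('n + 'm)" where "f u = join (left_part u) (- (A *v left_part u))" for u
  define g :: "'a ^ ('n + 'm) \<Rightarrow> 'a ^ ('n + 'm)" where "g u = join (transpose A *v right_part u) (right_part u)" for u
  define T where "T u = (\<chi> k. f u $ k + d $ k * g u $ k)" for u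
  have f_mem: "f u \<in> primal_dirs A" and g_mem: "g u \<in> dual_dirs A" for u
    by (simp_all add: f_def g_def primal_dirs_def dual_dirs_def)
  have f_add: "f (u + v) = f u + f v" and g_add: "g (u + v) = g u + g v" for u v
    by (simp_all add: f_def g_def vec_eq_iff join_def parts_linear matrix_vector_right_distrib split: sum.split)
  have f_scale: "f (c *s u) = c *s f u" and g_scale: "g (c *s u) = c *s g u" for c u
    by (simp_all add: f_def g_def vec_eq_iff join_def parts_linear vector_scalar_commute split: sum.split)
  have lin: "Vector_Spaces.linear (*s) (*s) T"
    by unfold_locales (simp_all add: T_def f_add g_add f_scale g_scale vec_eq_iff algebra_simps)
  have "u = 0" if "T u = 0" for u
  proof -
    have f: "f u $ k = - (d $ k * g u $ k)" for k
      using that by (simp add: T_def vec_eq_iff eq_neg_iff_add_eq_0)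
    have "dot (f u) (g u) = 0" by (rule dirs_orth[OF f_mem g_mem])
    then have "(\<Sum>k\<in>UNIV. d $ k * (g u $ k * g u $ k)) = 0"
      by (simp add: dot_def f sum_negf mult.assoc)
    then have "d $ k * (g u $ k * g u $ k) = 0" for k
      using less_imp_le[OF d] by (subst (asm) sum_nonneg_eq_0_iff) auto
    then have "g u $ k = 0" for k using d[of k] by (metis less_irrefl mult_eq_0_iff)
    moreover from this have "f u $ k = 0" for k using f by simp
    ultimately have "right_part (g u) = 0" "left_part (f u) = 0"
      by (simp_all add: left_part_def right_part_def vec_eq_iff)
    then have "join (left_part u) (right_part u) = join 0 0" by (simp only: f_def g_def parts_join)
    moreover have "join 0 0 = (0 :: 'a ^ ('n + 'm))" by (simp add: join_def vec_eq_iff split: sum.split)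
    ultimately show "u = 0" by simp
  qed
  then have "inj T" using module_hom.inj_iff_eq_0[OF Vector_Spaces.linear.axioms(3)[OF lin]] by blast
  then have "surj T" by (rule vec.linear_inj_imp_surj[OF lin])
  then obtain u where "r = T u" by blast
  then show "\<exists>v\<in>primal_dirs A. \<exists>w\<in>dual_dirs A. \<forall>k. v $ k + d $ k * w $ k = r $ k"
    using f_mem g_mem by (intro bexI[of _ "f u"] bexI[of _ "g u"]) (auto simp: T_def)
qed (rule dirs_orth)

fun primal_part :: "('a, 'n::finite, 'm::finite) pd_point \<Rightarrow> 'a ^ ('n + 'm)" where
  "primal_part (x, w, s, y) = join x w"

fun dual_part :: "('a, 'n::finite, 'm::finite) pd_point \<Rightarrow> 'a ^ ('n + 'm)" where
  "dual_part (x, w, s, y) = join s y"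

lemma coords_nth [simp]: "coords z $ Inl k = primal_part z $ k" "coords z $ Inr k = dual_part z $ k"
  by (cases z; simp add: join_def split: sum.split)+

lemma all_sum_iff: "(\<forall>k. P k) \<longleftrightarrow> (\<forall>k. P (Inl k)) \<and> (\<forall>k. P (Inr k))"
  by (metis sum.exhaust)

lemma parts_inject: "primal_part z = primal_part z' \<Longrightarrow> dual_part z = dual_part z' \<Longrightarrow> z = z'"
  by (cases z; cases z') (metis dual_part.simps parts_join primal_part.simps)

lemma pd_feasible_iff:
  "z \<in> pd_feasible A b c \<longleftrightarrow> A *v left_part (primal_part z) + right_part (primal_part z) = b \<and>
    left_part (dual_part z) - transpose A *v right_part (dual_part z) = c \<and>
    (\<forall>k. 0 \<le> primal_part z $ k) \<and> (\<forall>k. 0 \<le> dual_part z $ k)"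
  by (cases z) (simp add: pd_feasible_def all_sum_iff[of "\<lambda>k. 0 \<le> coords _ $ k"] del: coords.simps)

lemma pd_strict_iff:
  "z \<in> pd_strict A b c \<longleftrightarrow> z \<in> pd_feasible A b c \<and> (\<forall>k. 0 < primal_part z $ k) \<and> (\<forall>k. 0 < dual_part z $ k)"
  by (simp add: pd_strict_def all_sum_iff[of "\<lambda>k. 0 < coords _ $ k"] del: coords.simps)

lemma feasible_diff:
  assumes "z \<in> pd_feasible A b c" "z' \<in> pd_feasible A b c"
  shows "primal_part z - primal_part z' \<in> primal_dirs A" "dual_part z - dual_part z' \<in> dual_dirs A"
  using assms by (auto simp: pd_feasible_iff primal_dirs_def dual_dirs_def parts_linear
      matrix_vector_mult_diff_distrib algebra_simps)

lemma feasible_of_parts: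
  assumes "z \<in> pd_feasible A b c" "p - primal_part z \<in> primal_dirs A" "q - dual_part z \<in> dual_dirs A"
    and "\<And>k. 0 \<le> p $ k" "\<And>k. 0 \<le> q $ k"
  obtains z' where "z' \<in> pd_feasible A b c" "primal_part z' = p" "dual_part z' = q"
proof -
  have "A *v left_part p + right_part p = b" "left_part q - transpose A *v right_part q = c"
    using assms(1-3) by (auto simp: pd_feasible_iff primal_dirs_def dual_dirs_def parts_linear
      matrix_vector_mult_diff_distrib algebra_simps)
  then show ?thesis
    using assms(4,5) by (intro that[of "(left_part p, right_part p, left_part q, right_part q)"])
      (simp_all add: pd_feasible_iff)
qed

lemma products_iff:
  "(case z of (x, w, s, y) \<Rightarrow> (\<forall>j. P (x $ j * s $ j)) \<and> (\<forall>i. P (w $ i * y $ i))) \<longleftrightarrow>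
    (\<forall>k. P (primal_part z $ k * dual_part z $ k))"
  by (cases z) (simp add: all_sum_iff[of "\<lambda>k. P (join _ _ $ k * join _ _ $ k)"])

text \<open>The inner product of a primal and a dual feasible point is the duality gap, which the
  common optimal value makes zero.\<close>

lemma optimal_complementary:
  fixes A :: "'a::linordered_field ^ 'n::finite ^ 'm::finite"
  assumes "primal_value A b c \<nu>" "dual_value A b c \<nu>"
    and "primal_optimal A b c (xs, ws)" "dual_optimal A b c (ss, ys)"
  shows "(xs, ws, ss, ys) \<in> pd_feasible A b c" "dot (join xs ws) (join ss ys) = 0"
proof -
  have P: "A *v xs + ws = b" "\<And>j. 0 \<le> xs $ j" "\<And>i. 0 \<le> ws $ i"
    and D: "ss - transpose A *v ys = c" "\<And>j. 0 \<le> ss $ j" "\<And>i. 0 \<le> ys $ i"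
    using assms(3,4) by (auto simp: primal_optimal_def dual_optimal_def primal_feasible_def dual_feasible_def)
  show "(xs, ws, ss, ys) \<in> pd_feasible A b c"
    using P D by (simp add: pd_feasible_iff all_sum_iff[of "\<lambda>k. 0 \<le> join _ _ $ k"])
  have "dot c xs = \<nu>"
    using assms(1,3) unfolding primal_value_def primal_optimal_def by (metis antisym fst_conv)
  moreover have "- dot b ys = \<nu>"
    using assms(2,4) unfolding dual_value_def dual_optimal_def by (metis antisym snd_conv)
  moreover have "dot xs ss + dot ws ys = dot c xs + dot b ys"
    unfolding P(1)[symmetric] D(1)[symmetric]
    by (simp add: dot_simps dot_matrix_transpose dot_commute[of xs ss] dot_commute[of xs "transpose A *v ys"])
  ultimately show "dot (join xs ws) (join ss ys) = 0" by (simp add: dot_join)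
qed

section \<open>The central path over Puiseux series and its valuation\<close>

locale puiseux_program =
  fixes A :: "puiseux ^ 'n::finite ^ 'm::finite" and b :: "puiseux ^ 'm" and c :: "puiseux ^ 'n" and \<nu> xs ws ss ys
  assumes strict: "pd_strict A b c \<noteq> {}"
    and vals: "primal_value A b c \<nu>" "dual_value A b c \<nu>"
    and optimal: "primal_optimal A b c (xs, ws)" "dual_optimal A b c (ss, ys)"
begin

sublocale puiseux_orth_decomp "primal_dirs A" "dual_dirs A"
  by (intro puiseux_orth_decomp.intro orth_decomp_dirs)

abbreviation "F \<equiv> pd_feasible A b c"

lemma central_exists:
  assumes "\<mu> > 0"
  obtains z where "z \<in> pd_strict A b c" "\<And>k. primal_part z $ k * dual_part z $ k = \<mu>"
proof -
  obtain z0 where z0: "z0 \<in> pd_strict A b c" using strict by blast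
  let ?z = "(xs, ws, ss, ys)"
  have z: "?z \<in> F" "dot (join xs ws) (join ss ys) = 0"
    by (rule optimal_complementary[OF vals optimal])+
  interpret puiseux_complementary_pair "primal_dirs A" "dual_dirs A" "primal_part ?z" "dual_part ?z"
    "primal_part z0" "dual_part z0"
  proof
    show "0 \<le> primal_part ?z $ k" "0 \<le> dual_part ?z $ k" for k using z(1) by (auto simp only: pd_feasible_iff)
    show "dot (primal_part ?z) (dual_part ?z) = 0" using z(2) by simp
    show "0 < primal_part z0 $ k" "0 < dual_part z0 $ k" for k using z0 by (auto simp only: pd_strict_iff)
    show "primal_part z0 - primal_part ?z \<in> primal_dirs A" "dual_part z0 - dual_part ?z \<in> dual_dirs A"
      using z0 z(1) by (auto simp only: pd_strict_iff intro: feasible_diff)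
  qed
  obtain p q where pq: "p - primal_part ?z \<in> primal_dirs A" "q - dual_part ?z \<in> dual_dirs A"
    "\<And>k. 0 < p $ k" "\<And>k. 0 < q $ k" "\<And>k. p $ k * q $ k = \<mu>"
    by (rule central_pair_exists[OF assms]) (rule that)
  obtain z' where "z' \<in> F" "primal_part z' = p" "dual_part z' = q"
    by (rule feasible_of_parts[OF z(1) pq(1,2) less_imp_le[OF pq(3)] less_imp_le[OF pq(4)]]) (rule that)
  then show ?thesis using pq by (intro that[of z']) (auto simp: pd_strict_iff)
qed

lemma central_point:
  assumes "\<mu> > 0"
  shows "central_point A b c \<mu> \<in> pd_strict A b c"
    and "primal_part (central_point A b c \<mu>) $ k * dual_part (central_point A b c \<mu>) $ k = \<mu>"
proof -
  have "\<exists>!z. z \<in> pd_strict A b c \<and> (\<forall>k. primal_part z $ k * dual_part z $ k = \<mu>)"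
  proof (rule ex_ex1I)
    show "\<exists>z. z \<in> pd_strict A b c \<and> (\<forall>k. primal_part z $ k * dual_part z $ k = \<mu>)"
      by (rule central_exists[OF assms]) blast
    fix z z'
    assume z: "z \<in> pd_strict A b c \<and> (\<forall>k. primal_part z $ k * dual_part z $ k = \<mu>)"
      and z': "z' \<in> pd_strict A b c \<and> (\<forall>k. primal_part z' $ k * dual_part z' $ k = \<mu>)"
    have "primal_part z = primal_part z' \<and> dual_part z = dual_part z'"
      using z z' assms by (intro center_unique[of _ _ _ _ \<mu>] feasible_diff) (auto simp: pd_strict_iff)
    then show "z = z'" using parts_inject by blast
  qed
  from theI'[OF this] show "central_point A b c \<mu> \<in> pd_strict A b c"
    "primal_part (central_point A b c \<mu>) $ k * dual_part (central_point A b c \<mu>) $ k = \<mu>"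
    unfolding central_point_def products_iff[where P = "\<lambda>x. x = \<mu>"] by blast+
qed

lemma central_point_maximal:
  assumes "\<mu> > 0" "z \<in> F" "\<And>k. val (primal_part z $ k * dual_part z $ k) \<le> val \<mu>"
  shows "val_vec (coords z) $ k \<le> val_vec (coords (central_point A b c \<mu>)) $ k"
proof -
  let ?C = "central_point A b c \<mu>"
  have C: "?C \<in> F" "\<And>k. 0 < primal_part ?C $ k" "\<And>k. 0 < dual_part ?C $ k"
    using central_point(1)[OF assms(1)] by (auto simp only: pd_strict_iff)
  have z: "0 \<le> primal_part z $ k" "0 \<le> dual_part z $ k" for k using assms(2) by (auto simp only: pd_feasible_iff)
  note max = center_val_maximal[OF feasible_diff[OF C(1) assms(2)] assms(1) C(2,3) z
      central_point(2)[OF assms(1)] assms(3)]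
  show ?thesis by (cases k) (simp_all add: val_vec_def max)
qed

text \<open>Two central points whose parameters have equal valuation compete in each other's
  maximality property, so their valuations agree.\<close>

lemma trop_central_path_eq:
  assumes "\<mu> > 0" "val \<mu> = ereal l"
  shows "trop_central_path A b c l = val_vec (coords (central_point A b c \<mu>))"
  unfolding trop_central_path_def
proof (rule the_equality, intro allI impI)
  fix \<mu>' :: puiseux assume \<mu>': "\<mu>' > 0" "val \<mu>' = ereal l"
  have "val_vec (coords (central_point A b c \<mu>1)) $ k \<le> val_vec (coords (central_point A b c \<mu>2)) $ k"
    if "\<mu>1 > 0" "\<mu>2 > 0" "val \<mu>1 = ereal l" "val \<mu>2 = ereal l" for \<mu>1 \<mu>2 k
    using that central_point[OF that(1)] by (intro central_point_maximal) (auto simp: pd_strict_iff)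
  then show "val_vec (coords (central_point A b c \<mu>')) = val_vec (coords (central_point A b c \<mu>))"
    using assms \<mu>' by (intro vec_eq_iff[THEN iffD2] allI antisym) auto
qed (use assms in auto)

lemma trop_maximal:
  assumes "z \<in> F" "\<And>k. val_vec (coords z) $ Inl k + val_vec (coords z) $ Inr k \<le> ereal l"
  shows "val_vec (coords z) $ k \<le> trop_central_path A b c l $ k"
  using central_point_maximal[of "puiseux_monom 1 l" z k] assms trop_central_path_eq[of "puiseux_monom 1 l" l]
  by (simp add: monom_pos val_monom val_times val_vec_def)

lemma trop_finite:
  obtains \<tau> where "\<And>k. trop_central_path A b c l $ k = ereal (\<tau> k)" "\<And>k. \<tau> (Inl k) + \<tau> (Inr k) = l"
proof -
  define \<mu> where "\<mu> = puiseux_monom 1 l"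
  have \<mu>: "\<mu> > 0" "val \<mu> = ereal l" by (simp_all add: \<mu>_def monom_pos val_monom)
  let ?C = "central_point A b c \<mu>"
  note C = central_point[OF \<mu>(1)] and eq = trop_central_path_eq[OF \<mu>]
  define \<tau> where "\<tau> k = lead_exp (coords ?C $ k)" for k
  have "0 < coords ?C $ k" for k using C(1) by (cases k) (auto simp: pd_strict_iff)
  then have \<tau>: "val (coords ?C $ k) = ereal (\<tau> k)" for k
    by (auto simp: \<tau>_def val_def less_le)
  show ?thesis
  proof (rule that[of \<tau>])
    show "trop_central_path A b c l $ k = ereal (\<tau> k)" for k
      unfolding eq val_vec_def by (simp add: \<tau>)
    show "\<tau> (Inl k) + \<tau> (Inr k) = l" for k
      using val_times[of "coords ?C $ Inl k" "coords ?C $ Inr k"] C(2)[of k] \<mu>(2) unfolding \<tau> by simp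
  qed
qed

text \<open>By maximality no coordinate decreases when the parameter grows. The sum of two partners
  grows by exactly \<open>h\<close>, so neither grows by more.\<close>

lemma trop_lipschitz:
  assumes "0 \<le> h"
  shows "trop_central_path A b c (l + h) $ k \<le> trop_central_path A b c l $ k + ereal h"
proof -
  obtain \<tau> where \<tau>: "\<And>k. trop_central_path A b c l $ k = ereal (\<tau> k)" "\<And>k. \<tau> (Inl k) + \<tau> (Inr k) = l"
    by (rule trop_finite) (rule that)
  obtain \<sigma> where \<sigma>: "\<And>k. trop_central_path A b c (l + h) $ k = ereal (\<sigma> k)" "\<And>k. \<sigma> (Inl k) + \<sigma> (Inr k) = l + h"
    by (rule trop_finite) (rule that)
  define \<mu> where "\<mu> = puiseux_monom 1 l"
  have \<mu>: "\<mu> > 0" "val \<mu> = ereal l" by (simp_all add: \<mu>_def monom_pos val_monom)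
  let ?C = "central_point A b c \<mu>"
  note eq = trop_central_path_eq[OF \<mu>]
  have "?C \<in> F" using central_point(1)[OF \<mu>(1)] by (simp add: pd_strict_iff)
  then have "val_vec (coords ?C) $ k \<le> trop_central_path A b c (l + h) $ k" for k
    by (rule trop_maximal) (simp add: eq[symmetric] \<tau> assms)
  then have le: "\<tau> k \<le> \<sigma> k" for k by (simp add: eq[symmetric] \<tau>(1) \<sigma>(1))
  have "\<sigma> k \<le> \<tau> k + h"
  proof (cases k)
    case (Inl i)
    then show ?thesis using le[of "Inr i"] \<tau>(2)[of i] \<sigma>(2)[of i] by simp
  next
    case (Inr i)
    then show ?thesis using le[of "Inl i"] \<tau>(2)[of i] \<sigma>(2)[of i] by simp
  qed
  then show ?thesis by (simp add: \<tau>(1) \<sigma>(1))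
qed

end

section \<open>The distance to the tropical central path\<close>

lemma delta_F_le: "0 \<le> \<rho> \<Longrightarrow> (\<And>k. y $ k \<le> x $ k + ereal \<rho>) \<Longrightarrow> delta_F x y \<le> ereal \<rho>"
  unfolding delta_F_def by (rule Inf_lower) auto

lemma delta_F_nonneg: "0 \<le> delta_F x y"
  unfolding delta_F_def by (rule Inf_greatest) auto

lemma d_H_lessD:
  assumes "d_H x y < ereal r"
  obtains a b where "0 \<le> a" "0 \<le> b" "a + b < r" "\<And>k. y $ k \<le> x $ k + ereal a" "\<And>k. x $ k \<le> y $ k + ereal b"
proof -
  have n: "0 \<le> delta_F x y" "0 \<le> delta_F y x" by (rule delta_F_nonneg)+
  obtain u v where uv: "delta_F x y = ereal u" "delta_F y x = ereal v"
    using assms n unfolding d_H_def by (cases "delta_F x y"; cases "delta_F y x") auto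
  \<comment> \<open>Splits the slack of the strict inequality evenly between the two infima.\<close>
  define e where "e = (r - u - v) / 2"
  have e: "e > 0" using assms by (simp add: d_H_def uv e_def)
  have "delta_F x y < ereal (u + e)" "delta_F y x < ereal (v + e)" using e uv by simp_all
  then obtain a b where "0 \<le> a" "\<forall>k. y $ k \<le> x $ k + ereal a" "a < u + e"
    "0 \<le> b" "\<forall>k. x $ k \<le> y $ k + ereal b" "b < v + e"
    unfolding delta_F_def Inf_less_iff by auto
  moreover from this have "a + b < r" by (simp add: e_def field_simps)
  ultimately show ?thesis using that by blast
qed

lemma nbhd_products:
  fixes z :: "(real, 'n::finite, 'm::finite) pd_point"
  assumes "z \<in> wide_nbhd \<theta> A b c \<mu>"
  shows "0 < primal_part z $ k" "0 < dual_part z $ k"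
    "(1 - \<theta>) * \<mu> \<le> primal_part z $ k * dual_part z $ k"
    "primal_part z $ k * dual_part z $ k \<le> real (CARD('n) + CARD('m)) * \<mu>"
proof -
  obtain x w s y where z: "z = (x, w, s, y)" by (cases z)
  have *: "z \<in> pd_strict A b c" "duality_measure z = \<mu>"
    "\<forall>k. (1 - \<theta>) * \<mu> \<le> primal_part z $ k * dual_part z $ k"
    using assms products_iff[of "(\<le>) ((1 - \<theta>) * \<mu>)" z] by (auto simp: z wide_nbhd_def)
  then show pos: "0 < primal_part z $ k" "0 < dual_part z $ k"
    "(1 - \<theta>) * \<mu> \<le> primal_part z $ k * dual_part z $ k" for k by (auto simp: pd_strict_iff)
  have "primal_part z $ k * dual_part z $ k \<le> dot (primal_part z) (dual_part z)"
    by (intro dot_component_le less_imp_le pos)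
  also have "\<dots> = real (CARD('n) + CARD('m)) * \<mu>"
  proof -
    have "real (CARD('n) + CARD('m)) \<noteq> 0" using zero_less_card_finite[where 'a = 'n] by linarith
    moreover have "dot (primal_part z) (dual_part z) / real (CARD('n) + CARD('m)) = \<mu>"
      using *(2) by (simp add: z dot_join)
    ultimately show ?thesis by (metis nonzero_divide_eq_eq mult.commute)
  qed
  finally show "primal_part z $ k * dual_part z $ k \<le> real (CARD('n) + CARD('m)) * \<mu>" .
qed

text \<open>Let \<alpha> and \<beta> be the two one-sided distances to a point of
  \<open>val F\<close>. Both factors of a product may rise by \<alpha>, which raises the parameter
  by log_t N + 2\<alpha>; returning to the original coordinate costs \<beta>. The total error
  2\<alpha> + \<beta> is at most 2(\<alpha> + \<beta>), so twice the sum metric \<open>d_H\<close>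
  suffices.\<close>

lemma (in puiseux_program) nbhd_log_bound:
  fixes z :: "(real, 'n, 'm) pd_point"
  assumes z: "z \<in> wide_nbhd \<theta> A' b' c' \<mu>" and t: "t > 1" and \<mu>: "\<mu> > 0" and \<theta>: "0 < \<theta>" "\<theta> < 1"
    and D: "(INF y\<in>(\<lambda>z. val_vec (coords z)) ` F. d_H (log_vec t (coords z)) y) \<le> ereal d"
    and d: "0 \<le> d"
  shows "d_inf (log_vec t (coords z)) (trop_central_path A b c (log t \<mu>)) \<le>
    ereal (log t (real (CARD('n) + CARD('m)) / (1 - \<theta>)) + 2 * d)"
proof -
  let ?X = "log_vec t (coords z)" and ?l = "log t \<mu>" and ?N = "real (CARD('n) + CARD('m))"
  note zp = nbhd_products[OF z]
  define \<xi> where "\<xi> k = log t (coords z $ k)" for k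
  have pos: "0 < coords z $ k" for k by (cases k) (simp_all add: zp)
  have X: "?X $ k = ereal (\<xi> k)" for k
    using pos[of k] by (simp add: log_vec_def log_ext_def \<xi>_def)
  have \<xi>_add: "\<xi> (Inl k) + \<xi> (Inr k) = log t (primal_part z $ k * dual_part z $ k)" for k
    using zp(1,2)[of k] t by (simp add: \<xi>_def log_mult_pos)
  have N: "?N \<ge> 1" using zero_less_card_finite[where 'a = 'n] by linarith
  have \<xi>_le: "\<xi> (Inl k) + \<xi> (Inr k) \<le> ?l + log t ?N" for k
  proof -
    have "\<xi> (Inl k) + \<xi> (Inr k) \<le> log t (?N * \<mu>)"
      unfolding \<xi>_add using zp[of k] t by (intro log_mono) auto
    then show ?thesis using N \<mu> t by (simp add: log_mult_pos)
  qed
  have \<xi>_ge: "?l + log t (1 - \<theta>) \<le> \<xi> (Inl k) + \<xi> (Inr k)" for k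
  proof -
    have "log t ((1 - \<theta>) * \<mu>) \<le> \<xi> (Inl k) + \<xi> (Inr k)"
      unfolding \<xi>_add using zp[of k] t \<mu> \<theta> by (intro log_mono) auto
    then show ?thesis using \<theta> \<mu> t by (simp add: log_mult_pos)
  qed
  have logN: "0 \<le> log t ?N" using N t by (simp add: zero_le_log_cancel_iff)
  have log\<theta>: "log t (1 - \<theta>) \<le> 0" using \<theta> t by (simp add: log_le_zero_cancel_iff)
  obtain \<tau> where \<tau>: "\<And>k. trop_central_path A b c ?l $ k = ereal (\<tau> k)" "\<And>k. \<tau> (Inl k) + \<tau> (Inr k) = ?l"
    by (rule trop_finite) (rule that)
  have upper: "\<xi> k \<le> \<tau> k + (log t ?N + 2 * d)" for k
  proof (rule field_le_epsilon)
    fix e :: real assume e: "0 < e"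
    \<comment> \<open>The infimum may not be attained; a slack of e/2 becomes e after
      doubling.\<close>
    have "(INF y\<in>(\<lambda>z. val_vec (coords z)) ` F. d_H ?X y) < ereal (d + e / 2)"
      using D e by (auto intro: le_less_trans)
    then obtain z' where z': "z' \<in> F" "d_H ?X (val_vec (coords z')) < ereal (d + e / 2)"
      by (auto simp: INF_less_iff)
    define Y where "Y = val_vec (coords z')"
    obtain \<alpha> \<beta> where ab: "0 \<le> \<alpha>" "0 \<le> \<beta>" "\<alpha> + \<beta> < d + e / 2"
      "\<And>k. Y $ k \<le> ?X $ k + ereal \<alpha>" "\<And>k. ?X $ k \<le> Y $ k + ereal \<beta>"
      by (rule d_H_lessD[OF z'(2), folded Y_def]) (rule that)
    let ?h = "log t ?N + 2 * \<alpha>"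
    have "Y $ Inl k + Y $ Inr k \<le> ereal (?l + ?h)" for k
    proof -
      have "Y $ Inl k + Y $ Inr k \<le> ereal (\<xi> (Inl k) + \<alpha>) + ereal (\<xi> (Inr k) + \<alpha>)"
        using ab(4)[of "Inl k"] ab(4)[of "Inr k"] unfolding X by (intro add_mono) simp_all
      also have "\<dots> \<le> ereal (?l + ?h)" using \<xi>_le[of k] by simp
      finally show ?thesis .
    qed
    then have "Y $ k \<le> trop_central_path A b c (?l + ?h) $ k"
      unfolding Y_def by (rule trop_maximal[OF z'(1)])
    also have "\<dots> \<le> ereal (\<tau> k) + ereal ?h"
      using trop_lipschitz[of ?h ?l k] ab(1) logN by (simp add: \<tau>(1))
    finally have "Y $ k \<le> ereal (\<tau> k + ?h)" by simp
    then have "ereal (\<xi> k) \<le> ereal (\<tau> k + ?h) + ereal \<beta>"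
      using ab(5)[of k] unfolding X by (meson add_right_mono order_trans)
    then show "\<xi> k \<le> \<tau> k + (log t ?N + 2 * d) + e" using ab(2,3) by simp
  qed
  let ?R = "log t (?N / (1 - \<theta>)) + 2 * d"
  have R: "?R = log t ?N - log t (1 - \<theta>) + 2 * d" using N \<theta> t by (simp add: log_divide_pos)
  have R0: "0 \<le> ?R" unfolding R using logN log\<theta> d by simp
  \<comment> \<open>The partner's upper bound, subtracted from the lower bound on the sum of the two
    logarithms.\<close>
  have lower: "\<tau> k \<le> \<xi> k + ?R" for k
  proof (cases k)
    case (Inl i)
    then show ?thesis using upper[of "Inr i"] \<xi>_ge[of i] \<tau>(2)[of i] unfolding R by simp
  next
    case (Inr i)
    then show ?thesis using upper[of "Inl i"] \<xi>_ge[of i] \<tau>(2)[of i] unfolding R by simp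
  qed
  have "\<xi> k \<le> \<tau> k + ?R" for k using upper[of k] log\<theta> unfolding R by simp
  then show ?thesis
    unfolding d_inf_def using lower R0 by (intro max.boundedI delta_F_le) (simp_all add: X \<tau>(1))
qed

theorem theorem19:
  fixes A :: "puiseux ^ 'n::finite ^ 'm::finite"
    and b :: "puiseux ^ 'm" and c :: "puiseux ^ 'n"
    and \<nu> :: puiseux
    and xs :: "puiseux ^ 'n" and ws :: "puiseux ^ 'm"
    and ss :: "puiseux ^ 'n" and ys :: "puiseux ^ 'm"
    and \<theta> t0 t \<mu> :: real
  assumes "pd_strict A b c \<noteq> {}"
    and "primal_value A b c \<nu>" and "dual_value A b c \<nu>"
    and "primal_optimal A b c (xs, ws)" and "dual_optimal A b c (ss, ys)"
    and "admissible_threshold A b c \<nu> xs ws ss ys t0"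
    and "0 < \<theta>" and "\<theta> < 1"
    and "t > t0" and "t > 1" and "\<mu> > 0"
  shows "set_dist d_inf
      ((\<lambda>z. log_vec t (coords z)) ` wide_nbhd \<theta> (eval_mat t A) (eval_vec t b) (eval_vec t c) \<mu>)
      {trop_central_path A b c (log t \<mu>)}
    \<le> ereal (log t (real (CARD('n) + CARD('m)) / (1 - \<theta>))) + delta_log A b c t"
proof -
  interpret puiseux_program A b c \<nu> xs ws ss ys
    using assms(1-5) by unfold_locales
  let ?Ft = "pd_feasible (eval_mat t A) (eval_vec t b) (eval_vec t c)"
  let ?N = "wide_nbhd \<theta> (eval_mat t A) (eval_vec t b) (eval_vec t c) \<mu>"
  define D where "D = set_dist d_H ((\<lambda>z. log_vec t (coords z)) ` ?Ft) ((\<lambda>z. val_vec (coords z)) ` F)"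
  have "d_inf (log_vec t (coords z)) (trop_central_path A b c (log t \<mu>)) \<le>
      ereal (log t (real (CARD('n) + CARD('m)) / (1 - \<theta>))) + 2 * D" if z: "z \<in> ?N" for z
  proof -
    have "z \<in> ?Ft" using z by (cases z) (auto simp: wide_nbhd_def pd_strict_def)
    then have le: "(INF y\<in>(\<lambda>z. val_vec (coords z)) ` F. d_H (log_vec t (coords z)) y) \<le> D"
      unfolding D_def set_dist_def by (intro SUP_upper imageI)
    have "0 \<le> (INF y\<in>(\<lambda>z. val_vec (coords z)) ` F. d_H (log_vec t (coords z)) y)"
      by (intro INF_greatest) (simp add: d_H_def delta_F_nonneg)
    then have D0: "0 \<le> D" using le by (rule order_trans)
    show ?thesis
    \<comment> \<open>An infinite distance makes the bound trivial, and \<open>D0\<close> excludes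
      minus infinity.\<close>
    proof (cases D)
      case (real d)
      then show ?thesis
        using nbhd_log_bound[OF z assms(10,11,7,8), of d] le D0 by simp
    qed (use D0 in auto)
  qed
  then show ?thesis
    unfolding set_dist_def[of d_inf] delta_log_def D_def[symmetric]
    by (auto intro!: SUP_least)
qed

end
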